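(* If $T_\psi$ is transitive then $h_{\mathrm{Gur}}(T_\psi) =h_{\mathrm{Gur}}(T_{\psi^{\mathrm{ab}}})$ if and only if $G$ is amenable.
   Context: Let $\sigma:\Sigma\to\Sigma$ be a mixing subshift of finite type, $G$ a countable group with identity $e$, and $\psi:\Sigma\to G$ a function (depending on finitely many, e.g. two, coordinates). The $G$-extension (skew product) is $T_\psi:\Sigma\times G\to\Sigma\times G$, $T_\psi(x,g)=(\sigma x, g\psi(x))$, and $\psi^n(x)=\psi(x)\psi(\sigma x)\cdots\psi(\sigma^{n-1}x)$. The Gurevič entropy is $h_{\mathrm{Gur}}(T_\psi) = \limsup_{n\to\infty}\frac1n\log\#\{x\in\Sigma : \sigma^n x = x,\ \psi^n(x)=e\}$. With $G^{\mathrm{ab}}=G/[G,G]$ the abelianization, $\pi:G\to G^{\mathrm{ab}}$ the projection and $\psi^{\mathrm{ab}}=\pi\circ\psi$, $T_{\psi^{\mathrm{ab}}}:\Sigma\times G^{\mathrm{ab}}\to\Sigma\times G^{\mathrm{ab}}$ is the induced $G^{\mathrm{ab}}$-extension (with $h_{\mathrm{Gur}}$ defined analogously, using the identity of $G^{\mathrm{ab}}$). *)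

theory Defs
  imports "HOL-Analysis.Analysis" "HOL-Algebra.Algebra" "HOL-Library.Extended_Real"
begin

definition sft :: "('a \<Rightarrow> 'a \<Rightarrow> bool) \<Rightarrow> (nat \<Rightarrow> 'a) set" where
  "sft A = {x. \<forall>n. A (x n) (x (Suc n))}"

definition shift :: "(nat \<Rightarrow> 'a) \<Rightarrow> (nat \<Rightarrow> 'a)" where
  "shift x = (\<lambda>i. x (Suc i))"

text \<open>Topological mixing of the shift on S, stated on basic open sets (cylinders).\<close>
definition shift_mixing :: "(nat \<Rightarrow> 'a) set \<Rightarrow> bool" where
  "shift_mixing S \<longleftrightarrow> (\<forall>x\<in>S. \<forall>y\<in>S. \<forall>m. \<exists>N. \<forall>n\<ge>N. \<exists>z\<in>S.
      (\<forall>i<m. z i = x i) \<and> (\<forall>i<m. (shift ^^ n) z i = y i))"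

fun cocycle :: "('g, 'b) monoid_scheme \<Rightarrow> ((nat \<Rightarrow> 'a) \<Rightarrow> 'g) \<Rightarrow> nat \<Rightarrow> (nat \<Rightarrow> 'a) \<Rightarrow> 'g" where
  "cocycle G psi 0 x = \<one>\<^bsub>G\<^esub>"
| "cocycle G psi (Suc n) x = cocycle G psi n x \<otimes>\<^bsub>G\<^esub> psi ((shift ^^ n) x)"

definition locally_constant_cocycle ::
  "('g, 'b) monoid_scheme \<Rightarrow> (nat \<Rightarrow> 'a) set \<Rightarrow> ((nat \<Rightarrow> 'a) \<Rightarrow> 'g) \<Rightarrow> bool" where
  "locally_constant_cocycle G S psi \<longleftrightarrow> (\<forall>x\<in>S. psi x \<in> carrier G) \<and>
     (\<exists>k. \<forall>x\<in>S. \<forall>y\<in>S. (\<forall>i<k. x i = y i) \<longrightarrow> psi x = psi y)"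

text \<open>Topological transitivity of the skew product T_psi(x,g) = (sigma x, g psi(x)) on
  S \<times> G (G discrete), stated on basic open sets: cylinder \<times> singleton.
  Note T_psi^n (z,g) = (sigma^n z, g psi^n(z)).\<close>
definition skew_transitive ::
  "('g, 'b) monoid_scheme \<Rightarrow> (nat \<Rightarrow> 'a) set \<Rightarrow> ((nat \<Rightarrow> 'a) \<Rightarrow> 'g) \<Rightarrow> bool" where
  "skew_transitive G S psi \<longleftrightarrow>
     (\<forall>x\<in>S. \<forall>y\<in>S. \<forall>g\<in>carrier G. \<forall>h\<in>carrier G. \<forall>m. \<exists>n>0. \<exists>z\<in>S.
        (\<forall>i<m. z i = x i) \<and> (\<forall>i<m. (shift ^^ n) z i = y i) \<and>
        g \<otimes>\<^bsub>G\<^esub> cocycle G psi n z = h)"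

definition gurevic_entropy ::
  "('g, 'b) monoid_scheme \<Rightarrow> (nat \<Rightarrow> 'a) set \<Rightarrow> ((nat \<Rightarrow> 'a) \<Rightarrow> 'g) \<Rightarrow> ereal" where
  "gurevic_entropy G S psi = limsup (\<lambda>n.
     let c = card {x\<in>S. (shift ^^ n) x = x \<and> cocycle G psi n x = \<one>\<^bsub>G\<^esub>}
     in if c = 0 then -\<infinity> else ereal (ln (real c) / real n))"

definition abelianization :: "('g, 'b) monoid_scheme \<Rightarrow> 'g set monoid" where
  "abelianization G = G Mod (derived G (carrier G))"

definition ab_proj :: "('g, 'b) monoid_scheme \<Rightarrow> 'g \<Rightarrow> 'g set" where
  "ab_proj G g = derived G (carrier G) #>\<^bsub>G\<^esub> g"

definition amenable :: "('g, 'b) monoid_scheme \<Rightarrow> bool" where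
  "amenable G \<longleftrightarrow> (\<exists>\<mu> :: 'g set \<Rightarrow> real.
     (\<forall>A. A \<subseteq> carrier G \<longrightarrow> \<mu> A \<ge> 0) \<and>
     \<mu> (carrier G) = 1 \<and>
     (\<forall>A B. A \<subseteq> carrier G \<longrightarrow> B \<subseteq> carrier G \<longrightarrow> A \<inter> B = {} \<longrightarrow> \<mu> (A \<union> B) = \<mu> A + \<mu> B) \<and>
     (\<forall>g\<in>carrier G. \<forall>A. A \<subseteq> carrier G \<longrightarrow> \<mu> (g <#\<^bsub>G\<^esub> A) = \<mu> A))"

end

theory Submission
  imports Defs
begin

text \<open>Recode the skew product as a finite graph on the words of the subshift whose vertices carry
  labels in \<open>G\<close>; the entropy is the growth rate of the closed paths with trivial label.

  If \<open>G\<close> is amenable and \<open>t\<close> exceeds the exponential of the entropy, the Green function \<open>H\<close> of the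
  skew product at \<open>t\<close> is finite and superharmonic. Averaging \<open>ln (H (v, g a) / H (v\<^sub>0, g))\<close> over \<open>g\<close> with
  an invariant mean gives a character \<open>\<kappa>\<close> of \<open>G\<close> and a positive vector \<open>u\<close> on the graph, and Jensen's
  inequality shows that the \<open>\<kappa>\<close>-weighted adjacency matrix maps \<open>u\<close> below \<open>t u\<close>. Since \<open>\<kappa>\<close> is trivial
  on commutators, it bounds the number of closed paths whose label vanishes in the abelianization by
  a multiple of \<open>t ^ n\<close>.

  Conversely, the same construction on the (amenable) abelianization gives such \<open>\<kappa>\<close> and \<open>u\<close> for every
  \<open>t\<close> above its growth rate. Normalising by \<open>u\<close> and a left counterpart turns the weighted graph
  into a substochastic walk on the skew product over \<open>G\<close>. If \<open>G\<close> is not amenable, it has no almost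
  invariant vectors, so the lazy walk contracts the Hilbert space of square summable functions by a
  factor that does not depend on \<open>t\<close>. Letting \<open>t\<close> tend to the growth rate of the abelianization, the
  growth rate of \<open>G\<close> is strictly smaller.\<close>

text \<open>Supereigenvectors are available only for \<open>t\<close> strictly above the growth
  rate, and the proof never passes to a limit of them. A separate spectral gap for each
  \<open>t\<close> would not help, so \<open>return_decay\<close> fixes the contraction before
  \<open>s\<close>, \<open>t\<close>, \<open>\<kappa>\<close> and \<open>u\<close> are chosen; this
  requires a lower bound for the normalised edge weights that depends only on the graph and on an
  upper bound \<open>T\<close> for \<open>t\<close>. The walk need not be reversible, so
  self-adjointness is not at hand. The left vector makes up for it: together with \<open>u\<close>
  it bounds row sums and column sums, and the walk becomes a contraction of a weighted square norm.
  Between the two forms of amenability one passage is made, by compactness, from Reiter's condition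
  to an invariant set function. For abelian groups Reiter's condition is built directly, which is
  how the abelianization is seen to be amenable. Logarithms are averaged, not the Green function
  itself, because they turn products of quotients into sums and because transitivity bounds them
  uniformly over the group, as an invariant mean demands.\<close>

section \<open>Finitely additive integration\<close>

lemma real_eqI_eps:
  fixes a b k :: real
  assumes "\<And>\<delta>. \<delta> > 0 \<Longrightarrow> \<bar>a - b\<bar> \<le> k * \<delta>"
  shows "a = b"
proof (rule ccontr)
  assume "a \<noteq> b"
  then have "\<bar>a - b\<bar> > 0" by simp
  define \<delta> where "\<delta> = \<bar>a - b\<bar> / (2 * (\<bar>k\<bar> + 1))"
  have "\<delta> > 0" using \<open>a \<noteq> b\<close> by (simp add: \<delta>_def)
  have "k * \<delta> \<le> (\<bar>k\<bar> + 1) * \<delta>"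
    using \<open>\<delta> > 0\<close> by (intro mult_right_mono) auto
  also have "\<dots> = \<bar>a - b\<bar> / 2"
    by (simp add: \<delta>_def field_simps)
  finally show False
    using order_trans[OF assms[OF \<open>\<delta> > 0\<close>], of "\<bar>a - b\<bar> / 2"] \<open>\<bar>a - b\<bar> > 0\<close> by simp
qed

lemma finite_pair_image: "finite (f ` S) \<Longrightarrow> finite (h ` S) \<Longrightarrow> finite ((\<lambda>x. (f x, h x)) ` S)"
  by (rule finite_subset[of _ "f ` S \<times> h ` S"]) auto

locale finitely_additive_prob =
  fixes \<Omega> :: "'x set" and \<mu> :: "'x set \<Rightarrow> real"
  assumes nonneg: "B \<subseteq> \<Omega> \<Longrightarrow> 0 \<le> \<mu> B"
    and total: "\<mu> \<Omega> = 1"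
    and additive: "B \<subseteq> \<Omega> \<Longrightarrow> C \<subseteq> \<Omega> \<Longrightarrow> B \<inter> C = {} \<Longrightarrow> \<mu> (B \<union> C) = \<mu> B + \<mu> C"
begin

lemma empty_eq_0: "\<mu> {} = 0"
  using additive[of "{}" "{}"] by simp

lemma Union_eq_sum:
  assumes "finite I" "\<And>i. i \<in> I \<Longrightarrow> B i \<subseteq> \<Omega>" "disjoint_family_on B I"
  shows "\<mu> (\<Union>i\<in>I. B i) = (\<Sum>i\<in>I. \<mu> (B i))"
  using assms
proof (induction I rule: finite_induct)
  case empty
  then show ?case by (simp add: empty_eq_0)
next
  case (insert j I)
  have "B j \<inter> (\<Union>i\<in>I. B i) = {}"
    using insert.prems(2) insert.hyps(2) by (fastforce simp: disjoint_family_on_def)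
  moreover have "\<mu> (\<Union>i\<in>I. B i) = (\<Sum>i\<in>I. \<mu> (B i))"
    using insert by (auto simp: disjoint_family_on_def)
  moreover have "(\<Union>i\<in>I. B i) \<subseteq> \<Omega>" "B j \<subseteq> \<Omega>"
    using insert.prems(1) by auto
  ultimately show ?case
    using insert.hyps additive[of "B j" "\<Union>i\<in>I. B i"] by simp
qed

definition simple_integral :: "('x \<Rightarrow> real) \<Rightarrow> real" where
  "simple_integral f = (\<Sum>y\<in>f ` \<Omega>. y * \<mu> {x\<in>\<Omega>. f x = y})"

text \<open>Two simple functions are added or compared on a common refinement of their level sets,
  that of the pair \<open>(f x, h x)\<close>. Additivity of \<open>\<mu>\<close> lets cells with
  equal values be merged.\<close>

lemma simple_integral_partition:
  assumes fin: "finite (p ` \<Omega>)" and f: "\<And>x. x \<in> \<Omega> \<Longrightarrow> f x = c (p x)"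
  shows "simple_integral f = (\<Sum>i\<in>p ` \<Omega>. c i * \<mu> {x\<in>\<Omega>. p x = i})"
proof -
  have img: "f ` \<Omega> = c ` p ` \<Omega>"
    using f by (auto simp: image_iff)
  have "(\<Sum>i\<in>p ` \<Omega>. c i * \<mu> {x\<in>\<Omega>. p x = i})
      = (\<Sum>y\<in>c ` p ` \<Omega>. \<Sum>i\<in>{i \<in> p ` \<Omega>. c i = y}. c i * \<mu> {x\<in>\<Omega>. p x = i})"
    by (rule sum.image_gen[OF fin])
  also have "\<dots> = (\<Sum>y\<in>c ` p ` \<Omega>. y * \<mu> {x\<in>\<Omega>. f x = y})"
  proof (rule sum.cong[OF refl])
    fix y assume "y \<in> c ` p ` \<Omega>"
    have "{x\<in>\<Omega>. f x = y} = (\<Union>i\<in>{i \<in> p ` \<Omega>. c i = y}. {x\<in>\<Omega>. p x = i})"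
      using f by auto
    then have "\<mu> {x\<in>\<Omega>. f x = y} = (\<Sum>i\<in>{i \<in> p ` \<Omega>. c i = y}. \<mu> {x\<in>\<Omega>. p x = i})"
      using fin Union_eq_sum[of "{i \<in> p ` \<Omega>. c i = y}" "\<lambda>i. {x\<in>\<Omega>. p x = i}"]
      by (auto simp: disjoint_family_on_def)
    then show "(\<Sum>i\<in>{i \<in> p ` \<Omega>. c i = y}. c i * \<mu> {x\<in>\<Omega>. p x = i}) = y * \<mu> {x\<in>\<Omega>. f x = y}"
      by (auto simp: sum_distrib_left intro: sum.cong)
  qed
  finally show ?thesis
    by (simp add: simple_integral_def img)
qed

lemma simple_integral_add:
  assumes "finite (f ` \<Omega>)" "finite (h ` \<Omega>)"
  shows "simple_integral (\<lambda>x. f x + h x) = simple_integral f + simple_integral h"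
proof -
  let ?p = "\<lambda>x. (f x, h x)"
  have fin: "finite (?p ` \<Omega>)"
    using assms by (rule finite_pair_image)
  show ?thesis
    using simple_integral_partition[OF fin, of f fst] simple_integral_partition[OF fin, of h snd]
      simple_integral_partition[OF fin, of "\<lambda>x. f x + h x" "\<lambda>(a, b). a + b"]
    by (simp add: sum.distrib[symmetric] distrib_right case_prod_unfold)
qed

lemma simple_integral_mono:
  assumes "finite (f ` \<Omega>)" "finite (h ` \<Omega>)" "\<And>x. x \<in> \<Omega> \<Longrightarrow> f x \<le> h x"
  shows "simple_integral f \<le> simple_integral h"
proof -
  let ?p = "\<lambda>x. (f x, h x)"
  have fin: "finite (?p ` \<Omega>)"
    using assms(1,2) by (rule finite_pair_image)
  have "(\<Sum>i\<in>?p ` \<Omega>. fst i * \<mu> {x\<in>\<Omega>. ?p x = i}) \<le> (\<Sum>i\<in>?p ` \<Omega>. snd i * \<mu> {x\<in>\<Omega>. ?p x = i})"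
    using assms(3) by (auto intro!: sum_mono mult_right_mono nonneg)
  then show ?thesis
    using simple_integral_partition[OF fin, of f fst] simple_integral_partition[OF fin, of h snd]
    by simp
qed

lemma nonempty: "\<Omega> \<noteq> {}"
  using total empty_eq_0 by auto

lemma simple_integral_const: "simple_integral (\<lambda>x. c) = c"
proof -
  have "(\<lambda>x. c) ` \<Omega> = {c}" using nonempty by auto
  then show ?thesis by (simp add: simple_integral_def total)
qed

lemma simple_integral_cmult:
  assumes "finite (f ` \<Omega>)"
  shows "simple_integral (\<lambda>x. c * f x) = c * simple_integral f"
  using simple_integral_partition[OF assms, of "\<lambda>x. c * f x" "\<lambda>y. c * y"]
  by (simp add: simple_integral_def sum_distrib_left mult.assoc)

text \<open>A lower integral. It is applied to bounded functions, which are uniform limits of simple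
  ones because \<open>\<mu>\<close> measures every subset.\<close>

definition fa_integral :: "('x \<Rightarrow> real) \<Rightarrow> real" where
  "fa_integral f = Sup {simple_integral s | s. finite (s ` \<Omega>) \<and> (\<forall>x\<in>\<Omega>. s x \<le> f x)}"

text \<open>\<open>s - \<delta>\<close> competes in the supremum, and monotonicity puts every
  competitor below \<open>s + \<delta>\<close>. Through this estimate all further properties of the
  integral are inherited from simple functions.\<close>

lemma fa_integral_approx:
  assumes s: "finite (s ` \<Omega>)" and \<delta>: "\<And>x. x \<in> \<Omega> \<Longrightarrow> \<bar>f x - s x\<bar> \<le> \<delta>"
  shows "\<bar>fa_integral f - simple_integral s\<bar> \<le> \<delta>"
proof -
  let ?S = "{simple_integral s | s. finite (s ` \<Omega>) \<and> (\<forall>x\<in>\<Omega>. s x \<le> f x)}"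
  have shift: "simple_integral (\<lambda>x. s x + c) = simple_integral s + c" "finite ((\<lambda>x. s x + c) ` \<Omega>)" for c
  proof -
    have "finite ((\<lambda>x. c) ` \<Omega>)"
      by (rule finite_subset[of _ "{c}"]) auto
    with s show "simple_integral (\<lambda>x. s x + c) = simple_integral s + c"
      by (simp add: simple_integral_add simple_integral_const)
    have "(\<lambda>x. s x + c) ` \<Omega> = (\<lambda>y. y + c) ` s ` \<Omega>" by auto
    with s show "finite ((\<lambda>x. s x + c) ` \<Omega>)" by simp
  qed
  have "\<forall>x\<in>\<Omega>. s x + - \<delta> \<le> f x"
    using \<delta> by (force simp: abs_le_iff)
  then have mem: "simple_integral s + - \<delta> \<in> ?S"
    using shift[of "- \<delta>"] by (intro CollectI exI[of _ "\<lambda>x. s x + - \<delta>"]) simp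
  have upper: "y \<le> simple_integral s + \<delta>" if "y \<in> ?S" for y
  proof -
    from that obtain s' where s': "y = simple_integral s'" "finite (s' ` \<Omega>)" "\<forall>x\<in>\<Omega>. s' x \<le> f x"
      by auto
    have "s' x \<le> s x + \<delta>" if "x \<in> \<Omega>" for x
      using s'(3) \<delta>[OF that] that by (force simp: abs_le_iff)
    then show ?thesis
      using simple_integral_mono[OF s'(2) shift(2)[of \<delta>]] shift(1)[of \<delta>] s'(1) by simp
  qed
  have "fa_integral f \<le> simple_integral s + \<delta>"
    unfolding fa_integral_def using mem upper by (intro cSup_least) blast+
  moreover have "simple_integral s + - \<delta> \<le> fa_integral f"
    unfolding fa_integral_def using mem upper by (intro cSup_upper bdd_aboveI)
  ultimately show ?thesis by linarith
qed

lemma simple_approx: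
  fixes f :: "'x \<Rightarrow> real"
  assumes "bounded (f ` \<Omega>)" and "\<delta> > 0"
  obtains s where "finite (s ` \<Omega>)" "\<And>x. x \<in> \<Omega> \<Longrightarrow> \<bar>f x - s x\<bar> \<le> \<delta>"
proof
  \<comment> \<open>Rounding down to a grid of mesh \<open>\<delta>\<close>; a bounded function
    meets finitely many grid points.\<close>
  let ?s = "\<lambda>x. \<delta> * real_of_int \<lfloor>f x / \<delta>\<rfloor>"
  obtain B where B: "\<And>x. x \<in> \<Omega> \<Longrightarrow> \<bar>f x\<bar> \<le> B"
    using assms(1) by (auto simp: bounded_iff)
  have "\<lfloor>f x / \<delta>\<rfloor> \<in> {\<lfloor>- B / \<delta>\<rfloor>..\<lfloor>B / \<delta>\<rfloor>}" if "x \<in> \<Omega>" for x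
    using B[OF that] \<open>\<delta> > 0\<close> unfolding atLeastAtMost_iff
    by (intro conjI floor_mono divide_right_mono) (auto simp: abs_le_iff)
  then have "?s ` \<Omega> \<subseteq> (\<lambda>k. \<delta> * real_of_int k) ` {\<lfloor>- B / \<delta>\<rfloor>..\<lfloor>B / \<delta>\<rfloor>}"
    by blast
  then show "finite (?s ` \<Omega>)"
    by (rule finite_subset) simp
  fix x
  have "\<delta> * k \<le> f x \<and> f x \<le> \<delta> * k + \<delta>" if "k \<le> f x / \<delta>" "f x / \<delta> \<le> k + 1" for k
    using that \<open>\<delta> > 0\<close> by (simp add: field_simps)
  from this[of "real_of_int \<lfloor>f x / \<delta>\<rfloor>"] show "\<bar>f x - ?s x\<bar> \<le> \<delta>"
    by linarith
qed

lemma fa_integral_add: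
  assumes "bounded (f ` \<Omega>)" "bounded (h ` \<Omega>)"
  shows "fa_integral (\<lambda>x. f x + h x) = fa_integral f + fa_integral h"
proof (rule real_eqI_eps[where k = 4])
  fix \<delta> :: real assume "\<delta> > 0"
  obtain s where s: "finite (s ` \<Omega>)" "\<And>x. x \<in> \<Omega> \<Longrightarrow> \<bar>f x - s x\<bar> \<le> \<delta>"
    using simple_approx[OF assms(1) \<open>\<delta> > 0\<close>] by blast
  obtain r where r: "finite (r ` \<Omega>)" "\<And>x. x \<in> \<Omega> \<Longrightarrow> \<bar>h x - r x\<bar> \<le> \<delta>"
    using simple_approx[OF assms(2) \<open>\<delta> > 0\<close>] by blast
  have "finite ((\<lambda>x. s x + r x) ` \<Omega>)"
    using finite_imageI[OF finite_pair_image[OF s(1) r(1)], of "\<lambda>(a, b). a + b"]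
    by (simp add: image_image)
  moreover have "\<bar>(f x + h x) - (s x + r x)\<bar> \<le> 2 * \<delta>" if "x \<in> \<Omega>" for x
    using s(2)[OF that] r(2)[OF that] by linarith
  ultimately have "\<bar>fa_integral (\<lambda>x. f x + h x) - simple_integral (\<lambda>x. s x + r x)\<bar> \<le> 2 * \<delta>"
    by (rule fa_integral_approx)
  then show "\<bar>fa_integral (\<lambda>x. f x + h x) - (fa_integral f + fa_integral h)\<bar> \<le> 4 * \<delta>"
    using fa_integral_approx[OF s] fa_integral_approx[OF r] simple_integral_add[OF s(1) r(1)]
    by linarith
qed

lemma fa_integral_cmult:
  assumes "bounded (f ` \<Omega>)"
  shows "fa_integral (\<lambda>x. c * f x) = c * fa_integral f"
proof (rule real_eqI_eps[where k = "2 * \<bar>c\<bar>"])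
  fix \<delta> :: real assume "\<delta> > 0"
  obtain s where s: "finite (s ` \<Omega>)" "\<And>x. x \<in> \<Omega> \<Longrightarrow> \<bar>f x - s x\<bar> \<le> \<delta>"
    using simple_approx[OF assms(1) \<open>\<delta> > 0\<close>] by blast
  have *: "\<bar>c * a - c * b\<bar> \<le> \<bar>c\<bar> * \<delta>" if "\<bar>a - b\<bar> \<le> \<delta>" for a b
    using mult_left_mono[OF that abs_ge_zero[of c]]
    by (simp add: abs_mult[symmetric] right_diff_distrib)
  have "finite ((\<lambda>x. c * s x) ` \<Omega>)"
    using finite_imageI[OF s(1), of "\<lambda>y. c * y"] by (simp add: image_image)
  then have "\<bar>fa_integral (\<lambda>x. c * f x) - c * simple_integral s\<bar> \<le> \<bar>c\<bar> * \<delta>"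
    using fa_integral_approx[of "\<lambda>x. c * s x" "\<lambda>x. c * f x"] s * by (simp add: simple_integral_cmult)
  then show "\<bar>fa_integral (\<lambda>x. c * f x) - c * fa_integral f\<bar> \<le> 2 * \<bar>c\<bar> * \<delta>"
    using *[OF fa_integral_approx[OF s]] by linarith
qed

lemma fa_integral_le:
  assumes "bounded (f ` \<Omega>)" "\<And>x. x \<in> \<Omega> \<Longrightarrow> f x \<le> c"
  shows "fa_integral f \<le> c"
proof (rule field_le_epsilon)
  fix e :: real assume "e > 0"
  then have "e / 2 > 0" by simp
  obtain s where s: "finite (s ` \<Omega>)" "\<And>x. x \<in> \<Omega> \<Longrightarrow> \<bar>f x - s x\<bar> \<le> e / 2"
    using simple_approx[OF assms(1) \<open>e / 2 > 0\<close>] by blast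
  have "s x \<le> c + e / 2" if "x \<in> \<Omega>" for x
    using s(2)[OF that] assms(2)[OF that] by linarith
  moreover have "finite ((\<lambda>x. c + e / 2) ` \<Omega>)"
    by (rule finite_subset[of _ "{c + e / 2}"]) auto
  ultimately have "simple_integral s \<le> c + e / 2"
    using simple_integral_mono[OF s(1), of "\<lambda>x. c + e / 2"] by (simp add: simple_integral_const)
  with fa_integral_approx[OF s] show "fa_integral f \<le> c + e"
    by linarith
qed

text \<open>Composition with \<open>\<tau>\<close> keeps the mass of every level set of a simple
  approximant.\<close>

lemma fa_integral_invariant:
  assumes f: "bounded (f ` \<Omega>)" and \<tau>: "\<And>x. x \<in> \<Omega> \<Longrightarrow> \<tau> x \<in> \<Omega>"
    and inv: "\<And>B. B \<subseteq> \<Omega> \<Longrightarrow> \<mu> {x\<in>\<Omega>. \<tau> x \<in> B} = \<mu> B"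
  shows "fa_integral (\<lambda>x. f (\<tau> x)) = fa_integral f"
proof (rule real_eqI_eps[where k = 2])
  fix \<delta> :: real assume "\<delta> > 0"
  obtain s where s: "finite (s ` \<Omega>)" "\<And>x. x \<in> \<Omega> \<Longrightarrow> \<bar>f x - s x\<bar> \<le> \<delta>"
    using simple_approx[OF f \<open>\<delta> > 0\<close>] by blast
  have sub: "(\<lambda>x. s (\<tau> x)) ` \<Omega> \<subseteq> s ` \<Omega>"
    using \<tau> by auto
  have eq: "\<mu> {x\<in>\<Omega>. s (\<tau> x) = y} = \<mu> {x\<in>\<Omega>. s x = y}" for y
  proof -
    have "{x\<in>\<Omega>. s (\<tau> x) = y} = {x\<in>\<Omega>. \<tau> x \<in> {x\<in>\<Omega>. s x = y}}"
      using \<tau> by auto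
    then show ?thesis
      using inv[of "{x\<in>\<Omega>. s x = y}"] by simp
  qed
  have "simple_integral (\<lambda>x. s (\<tau> x)) = (\<Sum>y\<in>s ` \<Omega>. y * \<mu> {x\<in>\<Omega>. s (\<tau> x) = y})"
    unfolding simple_integral_def
  \<comment> \<open>A value of \<open>s\<close> that is missed after composition with
    \<open>\<tau>\<close> has an empty level set and contributes nothing.\<close>
  proof (rule sum.mono_neutral_left[OF s(1) sub], intro ballI)
    fix y assume "y \<in> s ` \<Omega> - (\<lambda>x. s (\<tau> x)) ` \<Omega>"
    then have "{x\<in>\<Omega>. s (\<tau> x) = y} = {}" by blast
    then show "y * \<mu> {x\<in>\<Omega>. s (\<tau> x) = y} = 0" by (simp only: empty_eq_0 mult_zero_right)
  qed
  then have "simple_integral (\<lambda>x. s (\<tau> x)) = simple_integral s"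
    by (simp add: eq simple_integral_def)
  then have "\<bar>fa_integral (\<lambda>x. f (\<tau> x)) - simple_integral s\<bar> \<le> \<delta>"
    using fa_integral_approx[of "\<lambda>x. s (\<tau> x)" "\<lambda>x. f (\<tau> x)" \<delta>] s(2) \<tau> finite_subset[OF sub s(1)]
    by simp
  with fa_integral_approx[OF s] show "\<bar>fa_integral (\<lambda>x. f (\<tau> x)) - fa_integral f\<bar> \<le> 2 * \<delta>"
    by linarith
qed

end

section \<open>Invariant means\<close>

locale right_invariant_mean = group G for G (structure) +
  fixes M :: "('a \<Rightarrow> real) \<Rightarrow> real"
  assumes mean_add: "bounded (f ` carrier G) \<Longrightarrow> bounded (h ` carrier G) \<Longrightarrow>
      M (\<lambda>x. f x + h x) = M f + M h"
    and mean_cmult: "bounded (f ` carrier G) \<Longrightarrow> M (\<lambda>x. c * f x) = c * M f"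
    and mean_le: "bounded (f ` carrier G) \<Longrightarrow> (\<And>x. x \<in> carrier G \<Longrightarrow> f x \<le> c) \<Longrightarrow> M f \<le> c"
    and mean_right: "bounded (f ` carrier G) \<Longrightarrow> a \<in> carrier G \<Longrightarrow> M (\<lambda>x. f (x \<otimes> a)) = M f"

text \<open>Integrating along inversion turns left invariance of \<open>\<mu>\<close> into right
  invariance of the mean. The right side is wanted because edges of the skew product multiply on the
  right.\<close>

lemma amenable_imp_right_invariant_mean:
  assumes "group G" and "amenable G"
  shows "\<exists>M. right_invariant_mean G M"
proof -
  interpret group G by fact
  from \<open>amenable G\<close> obtain \<mu> :: "'a set \<Rightarrow> real" where
    \<mu>: "\<forall>A. A \<subseteq> carrier G \<longrightarrow> \<mu> A \<ge> 0" "\<mu> (carrier G) = 1"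
      "\<forall>A B. A \<subseteq> carrier G \<longrightarrow> B \<subseteq> carrier G \<longrightarrow> A \<inter> B = {} \<longrightarrow> \<mu> (A \<union> B) = \<mu> A + \<mu> B"
      "\<forall>g\<in>carrier G. \<forall>A. A \<subseteq> carrier G \<longrightarrow> \<mu> (g <#\<^bsub>G\<^esub> A) = \<mu> A"
    unfolding amenable_def by (elim exE conjE)
  interpret finitely_additive_prob "carrier G" \<mu>
    by unfold_locales (simp_all only: \<mu>)
  let ?M = "\<lambda>f. fa_integral (\<lambda>x. f (inv\<^bsub>G\<^esub> x))"
  have bdd: "bounded ((\<lambda>x. f (inv\<^bsub>G\<^esub> x)) ` carrier G)" if "bounded (f ` carrier G)" for f :: "'a \<Rightarrow> real"
    by (rule bounded_subset[OF that]) auto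
  have "right_invariant_mean G ?M"
  proof
    fix f h :: "'a \<Rightarrow> real"
    assume "bounded (f ` carrier G)" "bounded (h ` carrier G)"
    then show "?M (\<lambda>x. f x + h x) = ?M f + ?M h"
      by (intro fa_integral_add bdd)
  next
    fix f :: "'a \<Rightarrow> real" and c
    assume "bounded (f ` carrier G)"
    then show "?M (\<lambda>x. c * f x) = c * ?M f"
      by (intro fa_integral_cmult bdd)
  next
    fix f :: "'a \<Rightarrow> real" and c
    assume "bounded (f ` carrier G)" "\<And>x. x \<in> carrier G \<Longrightarrow> f x \<le> c"
    then show "?M f \<le> c"
      by (intro fa_integral_le bdd) auto
  next
    fix f :: "'a \<Rightarrow> real" and a
    assume f: "bounded (f ` carrier G)" and a: "a \<in> carrier G"
    have "fa_integral (\<lambda>x. f (inv\<^bsub>G\<^esub> (inv\<^bsub>G\<^esub> a \<otimes>\<^bsub>G\<^esub> x))) = ?M f"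
    proof (rule fa_integral_invariant[OF bdd[OF f]])
      fix B assume B: "B \<subseteq> carrier G"
      have "{x \<in> carrier G. inv\<^bsub>G\<^esub> a \<otimes>\<^bsub>G\<^esub> x \<in> B} = a <#\<^bsub>G\<^esub> B" (is "?L = ?R")
      proof
        show "?L \<subseteq> ?R"
        proof
          fix x assume x: "x \<in> ?L"
          then have "x = a \<otimes>\<^bsub>G\<^esub> (inv\<^bsub>G\<^esub> a \<otimes>\<^bsub>G\<^esub> x)"
            using a by (simp add: m_assoc[symmetric])
          with x show "x \<in> ?R" by (auto simp: l_coset_def)
        qed
        show "?R \<subseteq> ?L"
        proof
          fix x assume "x \<in> ?R"
          then obtain b where b: "b \<in> B" "x = a \<otimes>\<^bsub>G\<^esub> b" by (auto simp: l_coset_def)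
          then have "b \<in> carrier G" using B by auto
          then have "inv\<^bsub>G\<^esub> a \<otimes>\<^bsub>G\<^esub> x = b" "x \<in> carrier G"
            using a b(2) by (simp_all add: m_assoc[symmetric])
          then show "x \<in> ?L" using b(1) by simp
        qed
      qed
      then show "\<mu> {x \<in> carrier G. inv\<^bsub>G\<^esub> a \<otimes>\<^bsub>G\<^esub> x \<in> B} = \<mu> B"
        using \<mu>(4) a B by simp
    qed (use a in auto)
    \<comment> \<open>The two integrands agree on the carrier, not as functions on the whole type;
      one simple approximant serves both.\<close>
    moreover have "fa_integral (\<lambda>x. f (inv\<^bsub>G\<^esub> (inv\<^bsub>G\<^esub> a \<otimes>\<^bsub>G\<^esub> x))) = ?M (\<lambda>x. f (x \<otimes>\<^bsub>G\<^esub> a))"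
    proof (rule real_eqI_eps[where k = 2])
      fix \<delta> :: real assume "\<delta> > 0"
      let ?h = "\<lambda>x. f (inv\<^bsub>G\<^esub> x \<otimes>\<^bsub>G\<^esub> a)"
      have "bounded (?h ` carrier G)"
        by (rule bounded_subset[OF f]) (use a in auto)
      then obtain s where s: "finite (s ` carrier G)" "\<And>x. x \<in> carrier G \<Longrightarrow> \<bar>?h x - s x\<bar> \<le> \<delta>"
        using simple_approx \<open>\<delta> > 0\<close> by blast
      have "\<bar>f (inv\<^bsub>G\<^esub> (inv\<^bsub>G\<^esub> a \<otimes>\<^bsub>G\<^esub> x)) - s x\<bar> \<le> \<delta>" if "x \<in> carrier G" for x
        using s(2)[OF that] a that by (simp add: inv_mult_group)
      from fa_integral_approx[OF s(1) this] fa_integral_approx[OF s]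
      show "\<bar>fa_integral (\<lambda>x. f (inv\<^bsub>G\<^esub> (inv\<^bsub>G\<^esub> a \<otimes>\<^bsub>G\<^esub> x))) - ?M (\<lambda>x. f (x \<otimes>\<^bsub>G\<^esub> a))\<bar> \<le> 2 * \<delta>"
        by linarith
    qed
    ultimately show "?M (\<lambda>x. f (x \<otimes>\<^bsub>G\<^esub> a)) = ?M f" by simp
  qed
  then show ?thesis by blast
qed

context right_invariant_mean
begin

text \<open>Functions live on the whole type, while the mean should see only the carrier. This
  follows from \<open>mean_le\<close> with bound 0, applied to the difference in both
  directions.\<close>

lemma mean_cong:
  assumes "bounded (f ` carrier G)" "\<And>x. x \<in> carrier G \<Longrightarrow> f x = h x"
  shows "M f = M h"
proof -
  have b: "bounded (h ` carrier G)"
    using assms image_cong[of "carrier G" "carrier G" f h] by simp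
  have neg: "bounded ((\<lambda>x. - 1 * k x) ` carrier G)" if "bounded (k ` carrier G)" for k :: "'a \<Rightarrow> real"
    using bounded_scaling[OF that, of "- 1"] by (simp add: image_image)
  have le: "M k \<le> M k'"
    if "bounded (k ` carrier G)" "bounded (k' ` carrier G)" "\<And>x. x \<in> carrier G \<Longrightarrow> k x = k' x" for k k'
  proof -
    have "M (\<lambda>x. k x + - 1 * k' x) = M k + - 1 * M k'"
      using that(1,2) by (simp only: mean_add[OF that(1) neg] mean_cmult)
    moreover have "M (\<lambda>x. k x + - 1 * k' x) \<le> 0"
    proof (rule mean_le)
      have "(\<lambda>x. k x + - 1 * k' x) ` carrier G \<subseteq> {0}" using that(3) by auto
      then show "bounded ((\<lambda>x. k x + - 1 * k' x) ` carrier G)"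
        by (rule bounded_subset[rotated]) simp
    qed (use that(3) in auto)
    ultimately show ?thesis by simp
  qed
  show ?thesis
    using le[OF assms(1) b] le[OF b assms(1)] assms(2) by (simp add: order_antisym)
qed

lemma mean_sum:
  assumes "finite I" "\<And>i. i \<in> I \<Longrightarrow> bounded (f i ` carrier G)"
  shows "bounded ((\<lambda>x. \<Sum>i\<in>I. f i x) ` carrier G) \<and> M (\<lambda>x. \<Sum>i\<in>I. f i x) = (\<Sum>i\<in>I. M (f i))"
  using assms
proof (induction I rule: finite_induct)
  case empty
  have "bounded ((\<lambda>x. 0::real) ` carrier G)"
    by (rule bounded_subset[of "{0}"]) auto
  then show ?case
    using mean_cmult[of "\<lambda>x. 0" 0] by simp
next
  case (insert i I)
  then have "bounded (f i ` carrier G)" "bounded ((\<lambda>x. \<Sum>i\<in>I. f i x) ` carrier G)"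
    "M (\<lambda>x. \<Sum>i\<in>I. f i x) = (\<Sum>i\<in>I. M (f i))"
    by auto
  with insert.hyps show ?case
    by (simp add: mean_add bounded_plus_comp)
qed

lemma mean_const: "M (\<lambda>x. c) = c"
proof (rule antisym)
  have b: "bounded ((\<lambda>x. d::real) ` carrier G)" for d
    by (rule bounded_subset[of "{d}"]) auto
  show "M (\<lambda>x. c) \<le> c" using b by (rule mean_le) simp
  have "M (\<lambda>x. - 1 * c) \<le> - c" using b by (rule mean_le) simp
  then show "c \<le> M (\<lambda>x. c)" using mean_cmult[OF b, of "- 1" c] by simp
qed

text \<open>Jensen's inequality, from the tangent line bound at the means of the functions.\<close>

lemma sum_exp_mean_le:
  assumes I: "finite I" and b: "\<And>i. i \<in> I \<Longrightarrow> bounded (f i ` carrier G)"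
    and le: "\<And>x. x \<in> carrier G \<Longrightarrow> (\<Sum>i\<in>I. exp (f i x)) \<le> t"
  shows "(\<Sum>i\<in>I. exp (M (f i))) \<le> t"
proof -
  let ?e = "\<lambda>i. exp (M (f i))"
  let ?h = "\<lambda>i x. ?e i * (1 - M (f i)) + ?e i * f i x"
  have bc: "bounded ((\<lambda>x. d::real) ` carrier G)" for d
    by (rule bounded_subset[of "{d}"]) auto
  have bm: "bounded ((\<lambda>x. ?e i * f i x) ` carrier G)" if "i \<in> I" for i
    using bounded_scaling[OF b[OF that], of "?e i"] by (simp add: image_image)
  have "M (?h i) = ?e i" if "i \<in> I" for i
    using mean_add[OF bc bm[OF that]] mean_cmult[OF b[OF that]]
    by (simp add: mean_const right_diff_distrib)
  moreover have bh: "bounded (?h i ` carrier G)" if "i \<in> I" for i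
    using bounded_plus_comp[OF bc bm[OF that]] by simp
  ultimately have "(\<Sum>i\<in>I. ?e i) = M (\<lambda>x. \<Sum>i\<in>I. ?h i x)"
    using mean_sum[OF I, of ?h] by simp
  also have "\<dots> \<le> t"
  proof (rule mean_le)
    show "bounded ((\<lambda>x. \<Sum>i\<in>I. ?h i x) ` carrier G)"
      using mean_sum[OF I, of ?h] bh by blast
    fix x assume x: "x \<in> carrier G"
    have "?h i x \<le> exp (f i x)" for i
    proof -
      have "?e i * (1 + (f i x - M (f i))) \<le> ?e i * exp (f i x - M (f i))"
        by (intro mult_left_mono exp_ge_add_one_self) simp
      also have "\<dots> = exp (f i x)" by (simp add: exp_diff)
      finally show ?thesis by (simp add: algebra_simps)
    qed
    then have "(\<Sum>i\<in>I. ?h i x) \<le> (\<Sum>i\<in>I. exp (f i x))"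
      by (intro sum_mono)
    with le[OF x] show "(\<Sum>i\<in>I. ?h i x) \<le> t" by linarith
  qed
  finally show ?thesis .
qed

end

section \<open>Finitely supported sums on a group\<close>

text \<open>Finite support is enough for the Hilbert space estimates: a walk started from a point
  mass reaches finitely many group elements in each step, so summability is automatic.\<close>

definition finsupp :: "'x set \<Rightarrow> ('x \<Rightarrow> real) \<Rightarrow> bool" where
  "finsupp C f \<longleftrightarrow> finite {x \<in> C. f x \<noteq> 0}"

lemma finsupp_summable: "finsupp C f \<Longrightarrow> f summable_on C"
  unfolding finsupp_def by (rule finite_nonzero_values_imp_summable_on)

lemma finsupp_of1:
  assumes "finsupp C f" "\<And>x. x \<in> C \<Longrightarrow> f x = 0 \<Longrightarrow> k x = 0"
  shows "finsupp C k"
  using assms(1) unfolding finsupp_def by (rule rev_finite_subset) (use assms(2) in auto)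

lemma finsupp_of2:
  assumes "finsupp C f" "finsupp C h" "\<And>x. x \<in> C \<Longrightarrow> f x = 0 \<Longrightarrow> h x = 0 \<Longrightarrow> k x = 0"
  shows "finsupp C k"
proof -
  have "finite ({x \<in> C. f x \<noteq> 0} \<union> {x \<in> C. h x \<noteq> 0})"
    using assms(1,2) by (simp add: finsupp_def)
  then show ?thesis
    unfolding finsupp_def by (rule rev_finite_subset) (use assms(3) in auto)
qed

lemma finsupp_sum:
  assumes "finite I" "\<And>i. i \<in> I \<Longrightarrow> finsupp C (f i)"
  shows "finsupp C (\<lambda>x. \<Sum>i\<in>I. f i x)"
proof -
  have "finite (\<Union>i\<in>I. {x \<in> C. f i x \<noteq> 0})"
    using assms by (simp add: finsupp_def)
  then show ?thesis
    unfolding finsupp_def by (rule rev_finite_subset) (auto dest: sum.not_neutral_contains_not_neutral)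
qed

lemma infsum_sum_finsupp:
  assumes "finite I" "\<And>i. i \<in> I \<Longrightarrow> finsupp C (f i)"
  shows "infsum (\<lambda>x. \<Sum>i\<in>I. f i x) C = (\<Sum>i\<in>I. infsum (f i) C)"
  using assms
proof (induction I rule: finite_induct)
  case (insert j I)
  then show ?case
    by (simp add: infsum_add finsupp_summable finsupp_sum)
qed simp

lemma infsum_diff_finsupp:
  assumes "finsupp C f" "finsupp C h"
  shows "infsum (\<lambda>x. f x - h x) C = infsum f C - infsum h C"
proof -
  have "finsupp C (\<lambda>x. - h x)"
    by (rule finsupp_of1[OF assms(2)]) simp
  from infsum_add[OF finsupp_summable[OF assms(1)] finsupp_summable[OF this]]
  show ?thesis by (simp add: infsum_uminus)
qed

lemma infsum_abs_le:
  assumes "finsupp C f" shows "\<bar>infsum f C\<bar> \<le> infsum (\<lambda>x. \<bar>f x\<bar>) C"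
proof -
  have a: "finsupp C (\<lambda>x. \<bar>f x\<bar>)" "finsupp C (\<lambda>x. - f x)"
    by (rule finsupp_of1[OF assms]; simp)+
  have "infsum f C \<le> infsum (\<lambda>x. \<bar>f x\<bar>) C" "infsum (\<lambda>x. - f x) C \<le> infsum (\<lambda>x. \<bar>f x\<bar>) C"
    by (intro infsum_mono finsupp_summable assms a; simp)+
  then show ?thesis by (simp add: infsum_uminus)
qed

section \<open>Sums over a group under right translation\<close>

lemma (in group) bij_betw_right_mult:
  "a \<in> carrier G \<Longrightarrow> bij_betw (\<lambda>x. x \<otimes> a) (carrier G) (carrier G)"
  by (rule bij_betw_byWitness[where f' = "\<lambda>x. x \<otimes> inv a"]) (auto simp: m_assoc)

lemma (in group) infsum_right_mult:
  "a \<in> carrier G \<Longrightarrow> infsum (\<lambda>x. f (x \<otimes> a)) (carrier G) = infsum f (carrier G)"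
  by (rule infsum_reindex_bij_betw[OF bij_betw_right_mult])

lemma (in group) finsupp_right_mult:
  assumes "a \<in> carrier G" "finsupp (carrier G) f"
  shows "finsupp (carrier G) (\<lambda>x. f (x \<otimes> a))"
proof -
  have "{x \<in> carrier G. f (x \<otimes> a) \<noteq> 0} \<subseteq> (\<lambda>x. x \<otimes> inv a) ` {x \<in> carrier G. f x \<noteq> 0}"
  proof
    fix x assume "x \<in> {x \<in> carrier G. f (x \<otimes> a) \<noteq> 0}"
    then have "x = (x \<otimes> a) \<otimes> inv a" "x \<otimes> a \<in> {x \<in> carrier G. f x \<noteq> 0}"
      using assms(1) by (auto simp: m_assoc)
    then show "x \<in> (\<lambda>x. x \<otimes> inv a) ` {x \<in> carrier G. f x \<noteq> 0}" by blast
  qed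
  with assms(2) show ?thesis
    unfolding finsupp_def by (blast intro: finite_subset finite_imageI)
qed

section \<open>Reiter's condition\<close>

text \<open>This form of amenability is the one that a square norm estimate can contradict: the
  normalised square of an almost invariant vector is such an \<open>F\<close>.\<close>

definition reiter :: "('g, 'b) monoid_scheme \<Rightarrow> bool" where
  "reiter G \<longleftrightarrow> (\<forall>K \<epsilon>. finite K \<longrightarrow> K \<subseteq> carrier G \<longrightarrow> \<epsilon> > 0 \<longrightarrow>
     (\<exists>F. finsupp (carrier G) F \<and> (\<forall>g\<in>carrier G. F g \<ge> 0) \<and> infsum F (carrier G) = 1 \<and>
        (\<forall>h\<in>K. infsum (\<lambda>g. \<bar>F (g \<otimes>\<^bsub>G\<^esub> h) - F g\<bar>) (carrier G) \<le> \<epsilon>)))"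

text \<open>Tychonoff's theorem; the cube is where an invariant set function will be found as a
  cluster point.\<close>

lemma compact_unit_cube: "compact {\<mu>::'i \<Rightarrow> real. \<forall>i. \<mu> i \<in> {0..1}}"
proof -
  have "compactin (product_topology (\<lambda>_. euclidean) UNIV) (Pi\<^sub>E UNIV (\<lambda>_::'i. {0..1::real}))"
    by (simp add: compactin_PiE)
  then show ?thesis
    by (simp add: euclidean_product_topology PiE_def Pi_def extensional_def)
qed

text \<open>The set functions in the compact cube are evaluated on inverses, which turns right translations
  of \<open>F\<close> into left translations of sets.\<close>

lemma (in group) reiter_imp_amenable:
  assumes "reiter G"
  shows "amenable G"
proof -
  let ?C = "carrier G"
  define Fin :: "('a set \<Rightarrow> real) set" where
    "Fin = {\<mu>. (\<forall>A B. A \<subseteq> ?C \<longrightarrow> B \<subseteq> ?C \<longrightarrow> A \<inter> B = {} \<longrightarrow> \<mu> (A \<union> B) = \<mu> A + \<mu> B) \<and> \<mu> ?C = 1}"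
  define Inv :: "'a \<times> nat \<Rightarrow> ('a set \<Rightarrow> real) set" where
    "Inv = (\<lambda>(h, n). {\<mu>. \<forall>B. B \<subseteq> ?C \<longrightarrow> \<bar>\<mu> (h <#\<^bsub>G\<^esub> B) - \<mu> B\<bar> \<le> inverse (real (Suc n))})"
  have closed_Fin: "closed Fin"
    unfolding Fin_def
    by (intro closed_Collect_conj closed_Collect_all closed_Collect_imp open_Collect_const
        closed_Collect_eq continuous_intros continuous_on_product_coordinates)
  have closed_Inv: "closed (Inv p)" for p
    unfolding Inv_def
    by (cases p) (auto intro!: closed_Collect_all closed_Collect_imp open_Collect_const
        closed_Collect_le continuous_intros continuous_on_product_coordinates)
  let ?Q = "{\<mu>::'a set \<Rightarrow> real. \<forall>B. \<mu> B \<in> {0..1}} \<inter> Fin"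
  have "compact ?Q"
    using compact_unit_cube closed_Fin by (rule compact_Int_closed)
  \<comment> \<open>Finite intersection property: finitely many constraints \<open>(h, n)\<close>
    involve finitely many translations and a largest precision, so a single \<open>F\<close> meets
    them all.\<close>
  moreover have "?Q \<inter> \<Inter>\<B> \<noteq> {}" if sub: "\<B> \<subseteq> Inv ` (?C \<times> UNIV)" and fin: "finite \<B>" for \<B>
  proof -
    obtain P where P: "P \<subseteq> ?C \<times> UNIV" "finite P" "\<B> = Inv ` P"
      using finite_subset_image[OF fin sub] by blast
    define n where "n = Max (insert 0 (snd ` P))"
    \<comment> \<open>Left translation of a set by \<open>h\<close> becomes right translation of
      \<open>F\<close> by \<open>inv h\<close>, whence the inverses.\<close>
    define K where "K = (\<lambda>p. inv (fst p)) ` P"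
    have K: "finite K" "K \<subseteq> ?C"
      using P by (auto simp: K_def)
    then obtain F where F: "finsupp ?C F" "\<And>g. g \<in> ?C \<Longrightarrow> F g \<ge> 0" "infsum F ?C = 1"
      and FK: "\<And>h. h \<in> K \<Longrightarrow> infsum (\<lambda>g. \<bar>F (g \<otimes> h) - F g\<bar>) ?C \<le> inverse (real (Suc n))"
      using assms[unfolded reiter_def, rule_format, of K "inverse (real (Suc n))"] by auto
    define \<mu> where "\<mu> B = infsum (\<lambda>g. if inv g \<in> B then F g else 0) ?C" for B
    have fB: "finsupp ?C (\<lambda>g. if inv g \<in> B then F g else 0)" for B
      by (rule finsupp_of1[OF F(1)]) simp
    have "\<mu> B \<in> {0..1}" for B
    proof -
      have "\<mu> B \<le> infsum F ?C"
        unfolding \<mu>_def using F(2) by (intro infsum_mono finsupp_summable fB F(1)) auto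
      moreover have "0 \<le> \<mu> B"
        unfolding \<mu>_def using F(2) by (intro infsum_nonneg) auto
      ultimately show ?thesis using F(3) by simp
    qed
    moreover have "\<mu> \<in> Fin"
    proof -
      have "\<mu> (A \<union> B) = \<mu> A + \<mu> B" if "A \<inter> B = {}" for A B
      proof -
        have "(\<lambda>g. if inv g \<in> A \<union> B then F g else 0)
            = (\<lambda>g. (if inv g \<in> A then F g else 0) + (if inv g \<in> B then F g else 0))"
          using that by (intro ext) auto
        then show ?thesis
          unfolding \<mu>_def by (simp only: infsum_add[OF finsupp_summable[OF fB] finsupp_summable[OF fB]])
      qed
      moreover have "\<mu> ?C = 1"
        unfolding \<mu>_def using F(3) by (subst infsum_cong[where g = F]) auto
      ultimately show ?thesis by (simp add: Fin_def)
    qed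
    moreover have "\<mu> \<in> Inv p" if "p \<in> P" for p
    proof -
      obtain h k where p: "p = (h, k)" by (cases p)
      have h: "h \<in> ?C" "inv h \<in> K" using that P(1) by (auto simp: p K_def image_iff intro: bexI[of _ p])
      have "k \<le> n" unfolding n_def using P(2) that p by (intro Max_ge) (auto simp: image_iff intro: bexI[of _ p])
      have "\<bar>\<mu> (h <#\<^bsub>G\<^esub> B) - \<mu> B\<bar> \<le> inverse (real (Suc k))" if B: "B \<subseteq> ?C" for B
      proof -
        let ?f = "\<lambda>g. if inv g \<in> B then F (g \<otimes> inv h) else 0"
        have "\<mu> (h <#\<^bsub>G\<^esub> B) = infsum (\<lambda>g. if inv (g \<otimes> inv h) \<in> h <#\<^bsub>G\<^esub> B then F (g \<otimes> inv h) else 0) ?C"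
          unfolding \<mu>_def using h(1) by (intro infsum_right_mult[symmetric]) simp
        also have "\<dots> = infsum ?f ?C"
        proof (rule infsum_cong)
          fix g assume g: "g \<in> ?C"
          have "inv (g \<otimes> inv h) = h \<otimes> inv g"
            using g h(1) by (simp add: inv_mult_group)
          moreover have "h \<otimes> inv g \<in> h <#\<^bsub>G\<^esub> B \<longleftrightarrow> inv g \<in> B"
            using g h(1) B by (auto simp: l_coset_def)
          ultimately show "(if inv (g \<otimes> inv h) \<in> h <#\<^bsub>G\<^esub> B then F (g \<otimes> inv h) else 0) = ?f g"
            by simp
        qed
        finally have \<mu>h: "\<mu> (h <#\<^bsub>G\<^esub> B) = infsum ?f ?C" .
        have Fh: "finsupp ?C (\<lambda>g. F (g \<otimes> inv h))"
          using h(1) F(1) by (intro finsupp_right_mult) auto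
        have fh: "finsupp ?C ?f"
          by (rule finsupp_of1[OF Fh]) simp
        have d: "finsupp ?C (\<lambda>g. \<bar>F (g \<otimes> inv h) - F g\<bar>)"
          by (rule finsupp_of2[OF Fh F(1)]) simp
        have e: "finsupp ?C (\<lambda>g. ?f g - (if inv g \<in> B then F g else 0))"
          by (rule finsupp_of2[OF Fh F(1)]) simp
        have e': "finsupp ?C (\<lambda>g. \<bar>?f g - (if inv g \<in> B then F g else 0)\<bar>)"
          by (rule finsupp_of1[OF e]) simp
        have "\<mu> (h <#\<^bsub>G\<^esub> B) - \<mu> B = infsum (\<lambda>g. ?f g - (if inv g \<in> B then F g else 0)) ?C"
          unfolding \<mu>h unfolding \<mu>_def by (rule infsum_diff_finsupp[OF fh fB, symmetric])
        also have "\<bar>\<dots>\<bar> \<le> infsum (\<lambda>g. \<bar>?f g - (if inv g \<in> B then F g else 0)\<bar>) ?C"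
          using e by (rule infsum_abs_le)
        \<comment> \<open>Summing over the whole group removes the dependence on
          \<open>B\<close>.\<close>
        also have "\<dots> \<le> infsum (\<lambda>g. \<bar>F (g \<otimes> inv h) - F g\<bar>) ?C"
          by (intro infsum_mono finsupp_summable d e') auto
        also have "\<dots> \<le> inverse (real (Suc n))"
          using h(2) by (rule FK)
        also have "\<dots> \<le> inverse (real (Suc k))"
          using \<open>k \<le> n\<close> by (intro le_imp_inverse_le) auto
        finally show ?thesis .
      qed
      then show ?thesis by (simp add: Inv_def p)
    qed
    ultimately have "\<mu> \<in> ?Q \<inter> \<Inter>\<B>" using P(3) by blast
    then show ?thesis by blast
  qed
  ultimately have "?Q \<inter> \<Inter>(Inv ` (?C \<times> UNIV)) \<noteq> {}"
    using closed_Inv unfolding compact_fip by blast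
  then obtain \<mu> where \<mu>: "\<forall>B. \<mu> B \<in> {0..1}" "\<mu> \<in> Fin" "\<And>h n. h \<in> ?C \<Longrightarrow> \<mu> \<in> Inv (h, n)"
    by blast
  have "\<mu> (h <#\<^bsub>G\<^esub> B) = \<mu> B" if "h \<in> ?C" "B \<subseteq> ?C" for h B
  proof (rule ccontr)
    assume "\<mu> (h <#\<^bsub>G\<^esub> B) \<noteq> \<mu> B"
    then have "\<bar>\<mu> (h <#\<^bsub>G\<^esub> B) - \<mu> B\<bar> > 0" by simp
    then obtain n where "inverse (real (Suc n)) < \<bar>\<mu> (h <#\<^bsub>G\<^esub> B) - \<mu> B\<bar>"
      using reals_Archimedean by blast
    moreover have "\<bar>\<mu> (h <#\<^bsub>G\<^esub> B) - \<mu> B\<bar> \<le> inverse (real (Suc n))"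
      using \<mu>(3)[OF that(1), of n] that(2) unfolding Inv_def by auto
    ultimately show False by linarith
  qed
  then show ?thesis
    using \<mu>(1,2) unfolding amenable_def Fin_def by (intro exI[of _ \<mu>]) auto
qed

text \<open>The elements of \<open>K\<close> are treated one at a time. Averaging \<open>F\<close>
  over the first \<open>n\<close> powers of \<open>h\<close> makes it almost invariant under
  \<open>h\<close>, since the difference telescopes to two terms of mass one, and commutativity
  keeps the invariance already reached for the other elements.\<close>

lemma (in comm_group) reiter: "reiter G"
  unfolding reiter_def
proof (intro allI impI)
  fix K and \<epsilon> :: real
  let ?C = "carrier G"
  assume "finite K" "K \<subseteq> ?C" "\<epsilon> > 0"
  then show "\<exists>F. finsupp ?C F \<and> (\<forall>g\<in>?C. F g \<ge> 0) \<and> infsum F ?C = 1 \<and>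
        (\<forall>h\<in>K. infsum (\<lambda>g. \<bar>F (g \<otimes> h) - F g\<bar>) ?C \<le> \<epsilon>)"
  proof (induction K rule: finite_induct)
    case empty
    let ?F = "\<lambda>g. if g = \<one> then 1 else 0 :: real"
    have "finsupp ?C ?F"
      unfolding finsupp_def by (rule finite_subset[of _ "{\<one>}"]) auto
    moreover have "infsum ?F ?C = infsum ?F {\<one>}"
      by (rule infsum_cong_neutral) auto
    ultimately show ?case by (intro exI[of _ ?F]) simp
  next
    case (insert h K)
    then obtain F where F: "finsupp ?C F" "\<And>g. g \<in> ?C \<Longrightarrow> F g \<ge> 0" "infsum F ?C = 1"
      and FK: "\<And>k. k \<in> K \<Longrightarrow> infsum (\<lambda>g. \<bar>F (g \<otimes> k) - F g\<bar>) ?C \<le> \<epsilon>"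
      by auto
    have h: "h \<in> ?C" and K: "K \<subseteq> ?C" using insert.prems by auto
    obtain n :: nat where "2 / \<epsilon> < real n"
      using reals_Archimedean2 by blast
    moreover from this have "n > 0"
      using \<open>\<epsilon> > 0\<close> by (cases n) (auto simp: field_simps)
    ultimately have n: "n > 0" "2 / real n \<le> \<epsilon>"
      using \<open>\<epsilon> > 0\<close> by (auto simp: field_simps)
    define T where "T j g = F (g \<otimes> h [^] j)" for j :: nat and g
    define F' where "F' g = (1 / real n) * (\<Sum>j<n. T j g)" for g
    have T: "finsupp ?C (T j)" for j
      unfolding T_def using h F(1) by (intro finsupp_right_mult) auto
    have T1: "infsum (T j) ?C = 1" for j
      unfolding T_def using infsum_right_mult[of "h [^] j" F] h F(3) by simp
    have T0: "T j g \<ge> 0" if "g \<in> ?C" for j g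
      using that h F(2) by (simp add: T_def)
    have F': "finsupp ?C F'"
      by (rule finsupp_of1[OF finsupp_sum[of "{..<n}" ?C T]]) (auto simp: T F'_def)
    have "infsum F' ?C = (1 / real n) * (\<Sum>j<n. infsum (T j) ?C)"
      unfolding F'_def using T by (simp only: infsum_cmult_right' infsum_sum_finsupp[OF finite_lessThan])
    then have "infsum F' ?C = 1"
      using n(1) by (simp add: T1)
    moreover have "\<forall>g\<in>?C. F' g \<ge> 0"
      unfolding F'_def by (auto intro!: divide_nonneg_nonneg sum_nonneg T0)
    moreover have "infsum (\<lambda>g. \<bar>F' (g \<otimes> k) - F' g\<bar>) ?C \<le> \<epsilon>" if "k \<in> insert h K" for k
    proof (cases "k = h")
      case True
      have step: "T j (g \<otimes> h) = T (Suc j) g" if "g \<in> ?C" for j g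
        using that h nat_pow_Suc2[OF h, of j] by (simp add: T_def m_assoc)
      let ?R = "\<lambda>g. (1 / real n) * (T n g + T 0 g)"
      have R: "finsupp ?C ?R" "finsupp ?C (\<lambda>g. \<bar>F' (g \<otimes> h) - F' g\<bar>)"
        using finsupp_of2[OF T[of n] T[of 0]] finsupp_of2[OF finsupp_right_mult[OF h F'] F'] by simp_all
      have "infsum (\<lambda>g. \<bar>F' (g \<otimes> h) - F' g\<bar>) ?C \<le> infsum ?R ?C"
      proof (intro infsum_mono finsupp_summable R)
        fix g assume g: "g \<in> ?C"
        have "F' (g \<otimes> h) - F' g = (1 / real n) * ((\<Sum>j<n. T (Suc j) g) - (\<Sum>j<n. T j g))"
          using g by (simp add: F'_def step right_diff_distrib)
        also have "(\<Sum>j<n. T (Suc j) g) - (\<Sum>j<n. T j g) = T n g - T 0 g"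
          using sum_lessThan_telescope[of "\<lambda>j. T j g" n] by (simp only: sum_subtractf)
        finally have "\<bar>F' (g \<otimes> h) - F' g\<bar> = (1 / real n) * \<bar>T n g - T 0 g\<bar>"
          using n(1) by (simp add: abs_mult)
        also have "\<dots> \<le> ?R g"
          using T0[OF g, of n] T0[OF g, of 0] by (intro mult_left_mono) auto
        finally show "\<bar>F' (g \<otimes> h) - F' g\<bar> \<le> ?R g" .
      qed
      also have "\<dots> = 2 / real n"
        unfolding infsum_cmult_right'
        using infsum_add[OF finsupp_summable[OF T[of n]] finsupp_summable[OF T[of 0]]]
        by (simp add: T1)
      finally show ?thesis using n(2) True by simp
    next
      case False
      with that have k: "k \<in> K" "k \<in> ?C" using K by auto
      define D where "D g = \<bar>F (g \<otimes> k) - F g\<bar>" for g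
      have D: "finsupp ?C D"
        unfolding D_def by (rule finsupp_of2[OF finsupp_right_mult[OF k(2) F(1)] F(1)]) simp
      define DT where "DT j g = D (g \<otimes> h [^] j)" for j :: nat and g
      have DT: "finsupp ?C (DT j)" for j
        unfolding DT_def using h D by (intro finsupp_right_mult) auto
      have DT1: "infsum (DT j) ?C \<le> \<epsilon>" for j
        unfolding DT_def using infsum_right_mult[of "h [^] j" D] h FK[OF k(1), folded D_def] by simp
      have R: "finsupp ?C (\<lambda>g. (1 / real n) * (\<Sum>j<n. DT j g))" "finsupp ?C (\<lambda>g. \<bar>F' (g \<otimes> k) - F' g\<bar>)"
        using finsupp_of1[OF finsupp_sum[of "{..<n}" ?C DT]] DT
          finsupp_of2[OF finsupp_right_mult[OF k(2) F'] F'] by simp_all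
      have "infsum (\<lambda>g. \<bar>F' (g \<otimes> k) - F' g\<bar>) ?C \<le> infsum (\<lambda>g. (1 / real n) * (\<Sum>j<n. DT j g)) ?C"
      proof (intro infsum_mono finsupp_summable R)
        fix g assume g: "g \<in> ?C"
        \<comment> \<open>Commutativity enters here: translation by \<open>k\<close> passes through
          translation by a power of \<open>h\<close>.\<close>
        have eq: "\<bar>T j (g \<otimes> k) - T j g\<bar> = DT j g" for j
          using g h k(2) by (simp add: T_def DT_def D_def m_ac)
        have "\<bar>F' (g \<otimes> k) - F' g\<bar> = (1 / real n) * \<bar>\<Sum>j<n. T j (g \<otimes> k) - T j g\<bar>"
          using n(1) by (simp add: F'_def sum_subtractf right_diff_distrib[symmetric] abs_mult
              del: times_divide_eq_left mult_1 flip: diff_divide_distrib)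
        also have "\<dots> \<le> (1 / real n) * (\<Sum>j<n. DT j g)"
          unfolding eq[symmetric] by (intro mult_left_mono sum_abs) simp
        finally show "\<bar>F' (g \<otimes> k) - F' g\<bar> \<le> (1 / real n) * (\<Sum>j<n. DT j g)" .
      qed
      also have "\<dots> = (1 / real n) * (\<Sum>j<n. infsum (DT j) ?C)"
        using DT by (simp only: infsum_cmult_right' infsum_sum_finsupp[OF finite_lessThan])
      also have "\<dots> \<le> (1 / real n) * (\<Sum>j<n. \<epsilon>)"
        using DT1 by (intro mult_left_mono sum_mono) auto
      also have "\<dots> = \<epsilon>" using n(1) by simp
      finally show ?thesis .
    qed
    ultimately show ?case
      using F' by (intro exI[of _ F']) blast
  qed
qed

section \<open>Labelled graphs\<close>

lemma (in group) mult_inv_cancel_left: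
  "x \<in> carrier G \<Longrightarrow> y \<in> carrier G \<Longrightarrow> x \<otimes> (inv x \<otimes> y) = y"
  by (simp add: m_assoc[symmetric])

locale labelled_graph = group G for G (structure) +
  fixes V :: "'v set" and E :: "'v \<Rightarrow> 'v \<Rightarrow> bool" and lab :: "'v \<Rightarrow> 'a"
  assumes finite_V: "finite V"
    and lab_closed: "v \<in> V \<Longrightarrow> lab v \<in> carrier G"
begin

definition succs :: "'v \<Rightarrow> 'v set" where
  "succs v = {w \<in> V. E v w}"

lemma succs_V: "w \<in> succs v \<Longrightarrow> w \<in> V"
  by (simp add: succs_def)

lemma finite_succs: "finite (succs v)"
  using finite_V by (simp add: succs_def)

text \<open>The label of the last vertex of a path does not count.\<close>

primrec npaths :: "nat \<Rightarrow> 'v \<Rightarrow> 'v \<Rightarrow> 'a \<Rightarrow> nat" where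
  "npaths 0 v w g = (if v = w \<and> g = \<one> then 1 else 0)"
| "npaths (Suc n) v w g = (\<Sum>v'\<in>succs v. npaths n v' w (inv (lab v) \<otimes> g))"

text \<open>Concatenation at \<open>w\<close>. Since the last label of a path is not counted, the
  label of \<open>w\<close> is counted exactly once, by the second path.\<close>

lemma npaths_mult_le:
  assumes "v \<in> V" "a \<in> carrier G" "b \<in> carrier G"
  shows "npaths n v w a * npaths m w z b \<le> npaths (n + m) v z (a \<otimes> b)"
  using assms
proof (induction n arbitrary: v a)
  case 0
  then show ?case by simp
next
  case (Suc n)
  have "npaths n v' w (inv (lab v) \<otimes> a) * npaths m w z b \<le> npaths (n + m) v' z (inv (lab v) \<otimes> (a \<otimes> b))"
    if "v' \<in> succs v" for v'
    using Suc.IH[of v' "inv (lab v) \<otimes> a"] Suc.prems that by (simp add: succs_V lab_closed m_assoc)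
  then show ?case
    by (simp add: sum_distrib_right sum_mono)
qed

lemma npaths_le: "npaths n v w g \<le> card V ^ n"
proof (induction n arbitrary: v g)
  case (Suc n)
  have "npaths (Suc n) v w g \<le> (\<Sum>v'\<in>succs v. card V ^ n)"
    unfolding npaths.simps by (intro sum_mono Suc.IH)
  also have "\<dots> \<le> card V * card V ^ n"
    using finite_V by (simp add: succs_def card_mono)
  finally show ?case by simp
qed simp

text \<open>Iterating the inequality bounds the sum of \<open>H\<close> over the endpoints of all
  paths of length \<open>n\<close>; all of them but those ending at one chosen point are
  dropped.\<close>

lemma npaths_superharmonic:
  fixes H :: "'v \<Rightarrow> 'a \<Rightarrow> real"
  assumes super: "\<And>v g. v \<in> V \<Longrightarrow> g \<in> carrier G \<Longrightarrow> (\<Sum>w\<in>succs v. H w (g \<otimes> lab v)) \<le> t * H v g"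
    and t: "t \<ge> 0" and nonneg: "\<And>v g. v \<in> V \<Longrightarrow> g \<in> carrier G \<Longrightarrow> 0 \<le> H v g"
    and "v \<in> V" "g \<in> carrier G" "a \<in> carrier G"
  shows "real (npaths n v w a) * H w (g \<otimes> a) \<le> t ^ n * H v g"
  using assms(4-6)
proof (induction n arbitrary: v g a)
  case 0
  then show ?case using nonneg by simp
next
  case (Suc n)
  have "real (npaths (Suc n) v w a) * H w (g \<otimes> a)
      = (\<Sum>v'\<in>succs v. real (npaths n v' w (inv (lab v) \<otimes> a)) * H w ((g \<otimes> lab v) \<otimes> (inv (lab v) \<otimes> a)))"
    using Suc.prems lab_closed by (simp add: sum_distrib_right m_assoc mult_inv_cancel_left)
  also have "\<dots> \<le> (\<Sum>v'\<in>succs v. t ^ n * H v' (g \<otimes> lab v))"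
    using Suc.prems lab_closed by (intro sum_mono Suc.IH) (auto simp: succs_V)
  also have "\<dots> = t ^ n * (\<Sum>v'\<in>succs v. H v' (g \<otimes> lab v))"
    by (simp add: sum_distrib_left)
  also have "\<dots> \<le> t ^ n * (t * H v g)"
    using super Suc.prems t by (intro mult_left_mono) auto
  finally show ?case by (simp add: mult_ac)
qed

definition character :: "('a \<Rightarrow> real) \<Rightarrow> bool" where
  "character \<kappa> \<longleftrightarrow> (\<forall>a\<in>carrier G. \<kappa> a > 0) \<and> (\<forall>a\<in>carrier G. \<forall>b\<in>carrier G. \<kappa> (a \<otimes> b) = \<kappa> a * \<kappa> b)"

lemma character_one: "character \<kappa> \<Longrightarrow> \<kappa> \<one> = 1"
proof -
  assume "character \<kappa>"
  then have "\<kappa> \<one> > 0" "\<kappa> (\<one> \<otimes> \<one>) = \<kappa> \<one> * \<kappa> \<one>"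
    unfolding character_def by blast+
  then show ?thesis by simp
qed

text \<open>Equivalently, \<open>\<kappa> g * u v\<close> is a positive superharmonic function at
  \<open>t\<close> on the skew product, of product form.\<close>

definition supereigen :: "('a \<Rightarrow> real) \<Rightarrow> ('v \<Rightarrow> real) \<Rightarrow> real \<Rightarrow> bool" where
  "supereigen \<kappa> u t \<longleftrightarrow> character \<kappa> \<and> (\<forall>v\<in>V. u v > 0) \<and>
     (\<forall>v\<in>V. (\<Sum>w\<in>succs v. \<kappa> (lab v) * u w) \<le> t * u v)"

lemma supereigen_npaths_le:
  assumes s: "supereigen \<kappa> u t" and "t \<ge> 0" "v \<in> V" "a \<in> carrier G"
  shows "real (npaths n v w a) * (\<kappa> a * u w) \<le> t ^ n * u v"
proof -
  let ?H = "\<lambda>v g. \<kappa> g * u v"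
  have \<kappa>: "character \<kappa>" and u: "\<And>v. v \<in> V \<Longrightarrow> u v > 0"
    and le: "\<And>v. v \<in> V \<Longrightarrow> (\<Sum>w\<in>succs v. \<kappa> (lab v) * u w) \<le> t * u v"
    using s by (auto simp: supereigen_def)
  have "(\<Sum>w\<in>succs v. ?H w (g \<otimes> lab v)) \<le> t * ?H v g" if "v \<in> V" "g \<in> carrier G" for v g
  proof -
    have "(\<Sum>w\<in>succs v. ?H w (g \<otimes> lab v)) = \<kappa> g * (\<Sum>w\<in>succs v. \<kappa> (lab v) * u w)"
      using \<kappa> that lab_closed by (simp add: character_def sum_distrib_left mult.assoc)
    also have "\<dots> \<le> \<kappa> g * (t * u v)"
      using \<kappa> that le by (intro mult_left_mono) (auto simp: character_def less_imp_le)
    finally show ?thesis by (simp add: mult_ac)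
  qed
  moreover have "0 \<le> ?H v g" if "v \<in> V" "g \<in> carrier G" for v g
    using \<kappa> u that by (simp add: character_def less_imp_le)
  ultimately have "real (npaths n v w a) * ?H w (\<one> \<otimes> a) \<le> t ^ n * ?H v \<one>"
    by (rule npaths_superharmonic[where H = ?H, OF _ \<open>t \<ge> 0\<close> _ \<open>v \<in> V\<close> one_closed \<open>a \<in> carrier G\<close>])
  then show ?thesis using \<kappa> assms by (simp add: character_one)
qed

end

section \<open>Transitive skew products and their Green function\<close>

locale transitive_labelled_graph = labelled_graph +
  assumes nonempty_V: "V \<noteq> {}"
    and transitive: "v \<in> V \<Longrightarrow> w \<in> V \<Longrightarrow> g \<in> carrier G \<Longrightarrow> \<exists>n>0. npaths n v w g > 0"
begin

text \<open>Appending one fixed path from \<open>w\<close> to \<open>v\<close> with label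
  \<open>inv a\<close> closes every counted path and makes its label trivial. This costs only the
  factor \<open>s ^ m\<close>.\<close>

lemma npaths_growth:
  assumes growth: "\<And>n v. v \<in> V \<Longrightarrow> real (npaths n v v \<one>) \<le> C * s ^ n"
    and "v \<in> V" "w \<in> V" "a \<in> carrier G"
  shows "\<exists>C'. \<forall>n. real (npaths n v w a) \<le> C' * s ^ n"
proof -
  obtain m where m: "npaths m w v (inv a) > 0"
    using transitive[OF assms(3,2) inv_closed[OF assms(4)]] by auto
  have "real (npaths n v w a) \<le> C * s ^ m * s ^ n" for n
  proof -
    have "npaths n v w a * 1 \<le> npaths n v w a * npaths m w v (inv a)"
      using m by (intro mult_left_mono) auto
    also have "\<dots> \<le> npaths (n + m) v v \<one>"
      using npaths_mult_le[of v a "inv a" n w m v] assms by simp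
    finally have "real (npaths n v w a) \<le> real (npaths (n + m) v v \<one>)"
      by simp
    also have "\<dots> \<le> C * s ^ (n + m)"
      by (rule growth[OF assms(2)])
    finally show ?thesis by (simp add: power_add mult_ac)
  qed
  then show ?thesis by blast
qed

text \<open>The Green function of the skew product graph is superharmonic. Averaging the logarithms of
  its quotients over the group yields a character; the inequality survives by convexity.\<close>

lemma amenable_imp_supereigen:
  assumes "amenable G" and s: "0 < s" "s < t"
    and growth: "\<And>n v. v \<in> V \<Longrightarrow> real (npaths n v v \<one>) \<le> C * s ^ n"
  shows "\<exists>\<kappa> u. supereigen \<kappa> u t"
proof -
  obtain M where "right_invariant_mean G M"
    using amenable_imp_right_invariant_mean[OF is_group \<open>amenable G\<close>] by blast
  then interpret right_invariant_mean G M .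
  have t: "t > 0" using s by simp
  obtain v0 where v0: "v0 \<in> V" using nonempty_V by blast
  \<comment> \<open>The inverse makes these the paths from \<open>(v, g)\<close> to
    \<open>(v0, \<one>)\<close> in the skew product, so \<open>H\<close> is the Green function with
    its second argument fixed.\<close>
  define h where "h v g n = real (npaths n v v0 (inv g)) / t ^ n" for v g n
  define H where "H v g = suminf (h v g)" for v g
  have h0: "h v g n \<ge> 0" for v g n
    using t by (simp add: h_def)
  have sum: "summable (h v g)" if vg: "v \<in> V" "g \<in> carrier G" for v g
  proof -
    obtain C' where C': "\<And>n. real (npaths n v v0 (inv g)) \<le> C' * s ^ n"
      using npaths_growth[OF growth vg(1) v0 inv_closed[OF vg(2)]] by auto
    have le: "norm (h v g n) \<le> C' * (s / t) ^ n" for n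
    proof -
      have "h v g n \<le> C' * s ^ n / t ^ n"
        unfolding h_def using t by (intro divide_right_mono C') simp
      with h0[of v g n] show ?thesis by (simp add: power_divide)
    qed
    have "summable (\<lambda>n. C' * (s / t) ^ n)"
      using s by (intro summable_mult summable_geometric) simp
    then show ?thesis
      by (rule summable_comparison_test'[where N = 0]) (rule le)
  qed
  have H_pos: "H v g > 0" if vg: "v \<in> V" "g \<in> carrier G" for v g
  proof -
    obtain n where "npaths n v v0 (inv g) > 0"
      using transitive[OF vg(1) v0 inv_closed[OF vg(2)]] by auto
    then have "h v g n > 0" using t by (simp add: h_def)
    then show ?thesis
      unfolding H_def using sum[OF vg] h0 by (intro suminf_pos2) auto
  qed
  have super: "(\<Sum>w\<in>succs v. H w (g \<otimes> lab v)) \<le> t * H v g" if vg: "v \<in> V" "g \<in> carrier G" for v g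
  proof -
    have gl: "g \<otimes> lab v \<in> carrier G" using vg lab_closed by simp
    have "(\<Sum>w\<in>succs v. H w (g \<otimes> lab v)) = suminf (\<lambda>n. \<Sum>w\<in>succs v. h w (g \<otimes> lab v) n)"
      unfolding H_def by (rule suminf_sum[symmetric]) (rule sum[OF succs_V gl])
    \<comment> \<open>Splitting off the first edge of a path shifts the index by one. The lost term
      \<open>n = 0\<close> is why \<open>H\<close> is superharmonic and not harmonic.\<close>
    also have "(\<lambda>n. \<Sum>w\<in>succs v. h w (g \<otimes> lab v) n) = (\<lambda>n. t * h v g (Suc n))"
      using vg lab_closed t
      by (simp add: h_def inv_mult_group sum_divide_distrib[symmetric])
    also have "suminf (\<lambda>n. t * h v g (Suc n)) = t * suminf (\<lambda>n. h v g (Suc n))"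
      by (rule suminf_mult) (use sum[OF vg] in \<open>simp add: summable_Suc_iff\<close>)
    also have "\<dots> \<le> t * H v g"
      using suminf_split_head[OF sum[OF vg]] h0[of v g 0] t by (simp add: H_def)
    finally show ?thesis .
  qed
  \<comment> \<open>A Harnack inequality: one path from \<open>v\<close> to \<open>w\<close>
    compares the values of \<open>H\<close>, with a constant independent of
    \<open>g\<close>.\<close>
  have H_le: "H w (g \<otimes> a) \<le> t ^ n * H v g"
    if "npaths n v w a > 0" "v \<in> V" "w \<in> V" "g \<in> carrier G" "a \<in> carrier G" for n v w g a
  proof -
    have "1 * H w (g \<otimes> a) \<le> real (npaths n v w a) * H w (g \<otimes> a)"
      using that H_pos[of w "g \<otimes> a"] by (intro mult_right_mono) (auto simp: less_imp_le)
    also have "\<dots> \<le> t ^ n * H v g"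
      using t H_pos
      by (intro npaths_superharmonic[where H = H, OF super _ _ that(2,4,5)]) (simp_all add: less_imp_le)
    finally show ?thesis by simp
  qed
  define \<phi> where "\<phi> v a g = ln (H v (g \<otimes> a)) - ln (H v0 g)" for v a g
  \<comment> \<open>Paths in both directions give Harnack bounds from above and from below.\<close>
  have \<phi>_bdd: "bounded (\<phi> v a ` carrier G)" if va: "v \<in> V" "a \<in> carrier G" for v a
  proof -
    obtain n where n: "npaths n v0 v a > 0" using transitive[OF v0 va] by auto
    obtain m where m: "npaths m v v0 (inv a) > 0" using transitive[OF va(1) v0 inv_closed[OF va(2)]] by auto
    have "\<bar>\<phi> v a g\<bar> \<le> \<bar>real n * ln t\<bar> + \<bar>real m * ln t\<bar>" if g: "g \<in> carrier G" for g
    proof -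
      have pos: "H v (g \<otimes> a) > 0" "H v0 g > 0" using H_pos va v0 g by auto
      have "ln (H v (g \<otimes> a)) \<le> ln (t ^ n * H v0 g)"
        using H_le[OF n v0 va(1) g va(2)] pos by (intro ln_mono) auto
      also have "\<dots> = real n * ln t + ln (H v0 g)"
        using pos t by (simp add: ln_mult ln_realpow)
      finally have 1: "\<phi> v a g \<le> real n * ln t" by (simp add: \<phi>_def)
      have "ln (H v0 g) \<le> ln (t ^ m * H v (g \<otimes> a))"
        using H_le[OF m va(1) v0, of "g \<otimes> a"] pos g va by (intro ln_mono) (auto simp: m_assoc)
      also have "\<dots> = real m * ln t + ln (H v (g \<otimes> a))"
        using pos t by (simp add: ln_mult ln_realpow)
      finally have "- \<phi> v a g \<le> real m * ln t" by (simp add: \<phi>_def)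
      with 1 show ?thesis by linarith
    qed
    then show ?thesis
      unfolding bounded_iff by (intro exI[of _ "\<bar>real n * ln t\<bar> + \<bar>real m * ln t\<bar>"]) auto
  qed
  define \<kappa> where "\<kappa> a = exp (M (\<phi> v0 a))" for a
  define u where "u v = exp (M (\<phi> v \<one>))" for v
  \<comment> \<open>\<open>\<phi> v (a \<otimes> b) g\<close> splits as
    \<open>\<phi> v0 a g + \<phi> v b (g \<otimes> a)\<close>, and right invariance of the mean
    removes the shift by \<open>a\<close>. With \<open>v = v0\<close> this makes
    \<open>\<kappa>\<close> multiplicative; with \<open>b = \<one>\<close> it separates
    \<open>\<kappa>\<close> from \<open>u\<close>.\<close>
  have M_mult: "M (\<phi> v (a \<otimes> b)) = M (\<phi> v0 a) + M (\<phi> v b)"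
    if "v \<in> V" "a \<in> carrier G" "b \<in> carrier G" for v a b
  proof -
    have b: "bounded ((\<lambda>g. \<phi> v b (g \<otimes> a)) ` carrier G)"
      using that by (intro bounded_subset[OF \<phi>_bdd[of v b]]) auto
    have "M (\<phi> v (a \<otimes> b)) = M (\<lambda>g. \<phi> v0 a g + \<phi> v b (g \<otimes> a))"
      using that by (intro mean_cong \<phi>_bdd) (auto simp: \<phi>_def m_assoc)
    also have "\<dots> = M (\<phi> v0 a) + M (\<lambda>g. \<phi> v b (g \<otimes> a))"
      using that v0 by (intro mean_add \<phi>_bdd b) auto
    also have "M (\<lambda>g. \<phi> v b (g \<otimes> a)) = M (\<phi> v b)"
      using that by (intro mean_right \<phi>_bdd) auto
    finally show ?thesis .
  qed
  have "character \<kappa>"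
    unfolding character_def \<kappa>_def by (simp add: M_mult[OF v0] exp_add)
  moreover have "(\<Sum>w\<in>succs v. \<kappa> (lab v) * u w) \<le> t * u v" if v: "v \<in> V" for v
  proof -
    \<comment> \<open>The reference value at \<open>v0\<close> cancels: \<open>?f w g\<close> is the
      logarithm of \<open>H w (g \<otimes> lab v) / H v g\<close>, and superharmonicity bounds the
      sum of these quotients by \<open>t\<close>.\<close>
    let ?f = "\<lambda>w g. \<phi> w (lab v) g + - 1 * \<phi> v \<one> g"
    have neg: "bounded ((\<lambda>g. - 1 * \<phi> v \<one> g) ` carrier G)"
      using bounded_scaling[OF \<phi>_bdd[of v \<one>], of "- 1"] v by (simp add: image_image)
    have f: "bounded (?f w ` carrier G)" if "w \<in> succs v" for w
      using that v by (intro bounded_plus_comp neg \<phi>_bdd) (auto simp: succs_V lab_closed)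
    have "(\<Sum>w\<in>succs v. exp (M (?f w))) \<le> t"
    proof (rule sum_exp_mean_le[OF finite_succs f])
      fix g assume g: "g \<in> carrier G"
      have "exp (?f w g) = H w (g \<otimes> lab v) / H v g" if "w \<in> succs v" for w
        using H_pos[of w "g \<otimes> lab v"] H_pos[of v g] succs_V[OF that] lab_closed[OF v] v g
        by (simp add: \<phi>_def exp_diff exp_minus)
      then have "(\<Sum>w\<in>succs v. exp (?f w g)) = (\<Sum>w\<in>succs v. H w (g \<otimes> lab v)) / H v g"
        by (simp add: sum_divide_distrib)
      also have "\<dots> \<le> t"
        using super[OF v g] H_pos[OF v g] by (simp add: pos_divide_le_eq)
      finally show "(\<Sum>w\<in>succs v. exp (?f w g)) \<le> t" .
    qed
    moreover have "exp (M (?f w)) = \<kappa> (lab v) * u w / u v" if w: "w \<in> succs v" for w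
    proof -
      have "M (?f w) = M (\<phi> w (lab v)) + - 1 * M (\<phi> v \<one>)"
        unfolding mean_add[OF \<phi>_bdd[OF succs_V[OF w] lab_closed[OF v]] neg]
          mean_cmult[OF \<phi>_bdd[OF v one_closed]] ..
      also have "M (\<phi> w (lab v)) = M (\<phi> v0 (lab v)) + M (\<phi> w \<one>)"
        using M_mult[of w "lab v" \<one>] w v by (simp add: succs_V lab_closed)
      finally show ?thesis by (simp add: \<kappa>_def u_def exp_add exp_diff)
    qed
    ultimately have "(\<Sum>w\<in>succs v. \<kappa> (lab v) * u w) / u v \<le> t"
      by (simp add: sum_divide_distrib)
    then show ?thesis
      by (simp add: u_def pos_divide_le_eq)
  qed
  ultimately have "supereigen \<kappa> u t"
    by (simp add: supereigen_def u_def)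
  then show ?thesis by blast
qed

end

section \<open>Coercivity of the energy on groups without Reiter's condition\<close>

lemma sq_add_le: "(x + y)\<^sup>2 \<le> 2 * x\<^sup>2 + 2 * (y::real)\<^sup>2"
  using sum_squares_ge_zero[of "x - y" 0] by (simp add: power2_eq_square algebra_simps)

text \<open>Factor the difference and apply the weighted inequality of arithmetic and geometric
  means. The weight is chosen so that after summation over the group the last term is half of
  \<open>\<epsilon>\<close> times the square norm and can be absorbed.\<close>

lemma abs_diff_squares_le:
  fixes x y \<epsilon> :: real
  assumes "\<epsilon> > 0"
  shows "\<bar>x\<^sup>2 - y\<^sup>2\<bar> \<le> 2 / \<epsilon> * (y - x)\<^sup>2 + \<epsilon> / 4 * (x\<^sup>2 + y\<^sup>2)"
proof -
  have "\<bar>x\<^sup>2 - y\<^sup>2\<bar> = \<bar>y - x\<bar> * \<bar>x + y\<bar>"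
    by (simp add: abs_mult[symmetric] power2_eq_square algebra_simps abs_minus_commute)
  also have "\<dots> \<le> 2 / \<epsilon> * (y - x)\<^sup>2 + \<epsilon> / 8 * (x + y)\<^sup>2"
  proof -
    have "0 \<le> (2 / \<epsilon>) * (\<bar>y - x\<bar> - \<epsilon> / 4 * \<bar>x + y\<bar>)\<^sup>2"
      using assms by simp
    also have "\<dots> = 2 / \<epsilon> * (y - x)\<^sup>2 + \<epsilon> / 8 * (x + y)\<^sup>2 - \<bar>y - x\<bar> * \<bar>x + y\<bar>"
      using assms by (simp add: power2_diff power_mult_distrib field_simps) (simp add: power2_eq_square)
    finally show ?thesis by simp
  qed
  also have "\<epsilon> / 8 * (x + y)\<^sup>2 \<le> \<epsilon> / 8 * (2 * x\<^sup>2 + 2 * y\<^sup>2)"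
    using assms by (intro mult_left_mono sq_add_le) simp
  finally show ?thesis by (simp add: algebra_simps)
qed

section \<open>Square norms and Dirichlet energy on the skew product\<close>

context labelled_graph
begin

definition finsupp_family :: "('v \<Rightarrow> 'a \<Rightarrow> real) \<Rightarrow> bool" where
  "finsupp_family f \<longleftrightarrow> (\<forall>v\<in>V. finsupp (carrier G) (f v))"

definition sqnorm :: "('v \<Rightarrow> 'a \<Rightarrow> real) \<Rightarrow> 'v \<Rightarrow> real" where
  "sqnorm f v = infsum (\<lambda>g. (f v g)\<^sup>2) (carrier G)"

definition sqdist :: "('v \<Rightarrow> 'a \<Rightarrow> real) \<Rightarrow> 'v \<Rightarrow> 'v \<Rightarrow> 'a \<Rightarrow> real" where
  "sqdist f v w a = infsum (\<lambda>g. (f v g - f w (g \<otimes> a))\<^sup>2) (carrier G)"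

text \<open>The Dirichlet form of the skew product graph with unit weight on every edge.\<close>

definition energy :: "('v \<Rightarrow> 'a \<Rightarrow> real) \<Rightarrow> real" where
  "energy f = (\<Sum>v\<in>V. \<Sum>w\<in>succs v. sqdist f v w (lab v))"

lemma sqnorm_nonneg: "sqnorm f v \<ge> 0"
  unfolding sqnorm_def by (rule infsum_nonneg) simp

lemma sqdist_nonneg: "sqdist f v w a \<ge> 0"
  unfolding sqdist_def by (rule infsum_nonneg) simp

lemma energy_nonneg: "energy f \<ge> 0"
  unfolding energy_def by (intro sum_nonneg sqdist_nonneg)

lemma sqdist_edge_le_energy:
  assumes "v \<in> V" "w \<in> succs v"
  shows "sqdist f v w (lab v) \<le> energy f"
proof -
  have "sqdist f v w (lab v) \<le> (\<Sum>w\<in>succs v. sqdist f v w (lab v))"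
    using assms finite_succs by (intro member_le_sum[of w "succs v" "\<lambda>w. sqdist f v w (lab v)"]) (auto simp: sqdist_nonneg)
  also have "\<dots> \<le> energy f"
    unfolding energy_def using assms finite_V
    by (intro member_le_sum[of v V "\<lambda>v. \<Sum>w\<in>succs v. sqdist f v w (lab v)"]) (auto intro!: sum_nonneg sqdist_nonneg)
  finally show ?thesis .
qed

lemma finsupp_sqnorm:
  assumes "finsupp_family f" "v \<in> V"
  shows "finsupp (carrier G) (\<lambda>g. (f v g)\<^sup>2)"
  by (rule finsupp_of1[of _ "f v"]) (use assms in \<open>auto simp: finsupp_family_def\<close>)

lemma finsupp_translate:
  assumes "finsupp_family f" "w \<in> V" "a \<in> carrier G"
  shows "finsupp (carrier G) (\<lambda>g. f w (g \<otimes> a))"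
  using assms by (intro finsupp_right_mult) (auto simp: finsupp_family_def)

lemma finsupp_sqdist:
  assumes "finsupp_family f" "v \<in> V" "w \<in> V" "a \<in> carrier G"
  shows "finsupp (carrier G) (\<lambda>g. (f v g - f w (g \<otimes> a))\<^sup>2)"
  by (rule finsupp_of2[OF _ finsupp_translate[OF assms(1,3,4)], of "f v"])
    (use assms in \<open>auto simp: finsupp_family_def\<close>)

text \<open>Right translation by \<open>a\<close> preserves the sum over the group, so the second
  leg can start at \<open>g \<otimes> a\<close> instead of \<open>g\<close>.\<close>

lemma sqdist_triangle:
  assumes f: "finsupp_family f" and V: "v \<in> V" "v' \<in> V" "w \<in> V" and C: "a \<in> carrier G" "b \<in> carrier G"
  shows "sqdist f v w (a \<otimes> b) \<le> 2 * sqdist f v v' a + 2 * sqdist f v' w b"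
proof -
  let ?C = "carrier G"
  let ?k = "\<lambda>g. (f v' (g \<otimes> a) - f w (g \<otimes> a \<otimes> b))\<^sup>2"
  have k: "finsupp ?C ?k" "infsum ?k ?C = sqdist f v' w b"
    using finsupp_right_mult[OF C(1) finsupp_sqdist[OF f V(2,3) C(2)]]
      infsum_right_mult[OF C(1), of "\<lambda>g. (f v' g - f w (g \<otimes> b))\<^sup>2"] by (simp_all add: sqdist_def)
  let ?h = "\<lambda>g. 2 * (f v g - f v' (g \<otimes> a))\<^sup>2 + 2 * ?k g"
  have fs: "finsupp ?C (\<lambda>g. 2 * (f v g - f v' (g \<otimes> a))\<^sup>2)" "finsupp ?C (\<lambda>g. 2 * ?k g)"
    by (rule finsupp_of1[OF finsupp_sqdist[OF f V(1,2) C(1)]]; simp) (rule finsupp_of1[OF k(1)]; simp)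
  have h: "finsupp ?C ?h"
    by (rule finsupp_of2[OF fs]) simp
  have "sqdist f v w (a \<otimes> b) \<le> infsum ?h ?C"
    unfolding sqdist_def
  proof (intro infsum_mono finsupp_summable h finsupp_sqdist f V m_closed C)
    fix g assume g: "g \<in> ?C"
    have "f v g - f w (g \<otimes> (a \<otimes> b)) = (f v g - f v' (g \<otimes> a)) + (f v' (g \<otimes> a) - f w (g \<otimes> a \<otimes> b))"
      using g C by (simp add: m_assoc)
    then show "(f v g - f w (g \<otimes> (a \<otimes> b)))\<^sup>2 \<le> ?h g"
      by (simp only: sq_add_le)
  qed
  also have "infsum ?h ?C = 2 * sqdist f v v' a + 2 * infsum ?k ?C"
    unfolding sqdist_def infsum_cmult_right'[symmetric]
    by (rule infsum_add[OF finsupp_summable[OF fs(1)] finsupp_summable[OF fs(2)]])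
  finally show ?thesis by (simp add: k(2))
qed

lemma npaths_SucE:
  assumes "npaths (Suc n) v w a > 0"
  obtains v' where "v' \<in> succs v" "npaths n v' w (inv (lab v) \<otimes> a) > 0"
proof (rule ccontr)
  assume "\<not> thesis"
  with that have "\<forall>v'\<in>succs v. npaths n v' w (inv (lab v) \<otimes> a) = 0" by blast
  with assms show False by simp
qed

text \<open>Each edge of the path costs at most the full energy, and each use of
  \<open>sqdist_triangle\<close> a factor 2. The base 4 is generous; what matters is that the bound
  depends on \<open>n\<close> alone.\<close>

lemma sqdist_path_le:
  assumes f: "finsupp_family f" and "npaths n v w a > 0" "v \<in> V" "w \<in> V" "a \<in> carrier G"
  shows "sqdist f v w a \<le> 4 ^ n * energy f"
  using assms(2-)
proof (induction n arbitrary: v a)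
  case 0
  then have "v = w" "a = \<one>" by (auto split: if_splits)
  then have "sqdist f v w a = infsum (\<lambda>g. 0) (carrier G)"
    unfolding sqdist_def by (intro infsum_cong) simp
  then show ?case using energy_nonneg by simp
next
  case (Suc n)
  let ?b = "inv (lab v) \<otimes> a"
  obtain v' where v': "v' \<in> succs v" "npaths n v' w ?b > 0"
    using npaths_SucE[OF Suc.prems(1)] by blast
  have b: "?b \<in> carrier G" "lab v \<otimes> ?b = a"
    using Suc.prems lab_closed by (auto simp: mult_inv_cancel_left)
  have "sqdist f v w (lab v \<otimes> ?b) \<le> 2 * sqdist f v v' (lab v) + 2 * sqdist f v' w ?b"
    using Suc.prems v' b lab_closed by (intro sqdist_triangle f) (auto simp: succs_V)
  also have "\<dots> \<le> 2 * energy f + 2 * (4 ^ n * energy f)"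
    using Suc.IH[OF v'(2) succs_V[OF v'(1)] _ b(1)] Suc.prems sqdist_edge_le_energy[OF _ v'(1)]
    by (intro add_mono mult_left_mono) auto
  also have "\<dots> \<le> 2 * (4 ^ n * energy f) + 2 * (4 ^ n * energy f)"
    using mult_right_mono[OF one_le_power[of "4::real" n] energy_nonneg[of f]] by linarith
  finally show ?case by (simp add: b(2) mult_ac)
qed

lemma sqnorm_le:
  assumes f: "finsupp_family f" and V: "v \<in> V" "w \<in> V" and a: "a \<in> carrier G"
  shows "sqnorm f v \<le> 2 * sqdist f v w a + 2 * sqnorm f w"
proof -
  let ?C = "carrier G"
  let ?k = "\<lambda>g. (f w (g \<otimes> a))\<^sup>2"
  have k: "finsupp ?C ?k" "infsum ?k ?C = sqnorm f w"
    using finsupp_right_mult[OF a finsupp_sqnorm[OF f V(2)]]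
      infsum_right_mult[OF a, of "\<lambda>g. (f w g)\<^sup>2"] by (simp_all add: sqnorm_def)
  let ?h = "\<lambda>g. 2 * (f v g - f w (g \<otimes> a))\<^sup>2 + 2 * ?k g"
  have fs: "finsupp ?C (\<lambda>g. 2 * (f v g - f w (g \<otimes> a))\<^sup>2)" "finsupp ?C (\<lambda>g. 2 * ?k g)"
    by (rule finsupp_of1[OF finsupp_sqdist[OF f V a]]; simp) (rule finsupp_of1[OF k(1)]; simp)
  have h: "finsupp ?C ?h"
    by (rule finsupp_of2[OF fs]) simp
  have "sqnorm f v \<le> infsum ?h ?C"
    unfolding sqnorm_def
  proof (intro infsum_mono finsupp_summable h finsupp_sqnorm f V)
    fix g
    show "(f v g)\<^sup>2 \<le> ?h g"
      using sq_add_le[of "f v g - f w (g \<otimes> a)" "f w (g \<otimes> a)"] by simp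
  qed
  also have "infsum ?h ?C = 2 * sqdist f v w a + 2 * infsum ?k ?C"
    unfolding sqdist_def infsum_cmult_right'[symmetric]
    by (rule infsum_add[OF finsupp_summable[OF fs(1)] finsupp_summable[OF fs(2)]])
  finally show ?thesis by (simp add: k(2))
qed

text \<open>The squares of an almost invariant vector in the Hilbert space of square summable functions
  form an almost invariant probability vector.\<close>

lemma sqnorm_le_sqdist:
  assumes f: "finsupp_family f" and v: "v \<in> V" and h: "h \<in> carrier G" and "\<epsilon> > 0"
    and large: "\<epsilon> * sqnorm f v \<le> infsum (\<lambda>g. \<bar>(f v (g \<otimes> h))\<^sup>2 - (f v g)\<^sup>2\<bar>) (carrier G)"
  shows "sqnorm f v \<le> 4 / \<epsilon>\<^sup>2 * sqdist f v v h"
proof -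
  let ?C = "carrier G"
  let ?x = "\<lambda>g. (f v (g \<otimes> h))\<^sup>2" and ?y = "\<lambda>g. (f v g)\<^sup>2" and ?d = "\<lambda>g. (f v g - f v (g \<otimes> h))\<^sup>2"
  have y: "finsupp ?C ?y" "infsum ?y ?C = sqnorm f v"
    using finsupp_sqnorm[OF f v] by (simp_all add: sqnorm_def)
  have x: "finsupp ?C ?x" "infsum ?x ?C = sqnorm f v"
    using finsupp_right_mult[OF h y(1)] infsum_right_mult[OF h, of ?y] y(2) by simp_all
  have d: "finsupp ?C ?d" by (rule finsupp_sqdist[OF f v v h])
  have xy: "finsupp ?C (\<lambda>g. ?x g + ?y g)" by (rule finsupp_of2[OF x(1) y(1)]) simp
  have d': "finsupp ?C (\<lambda>g. 2 / \<epsilon> * ?d g)" by (rule finsupp_of1[OF d]) simp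
  have xy': "finsupp ?C (\<lambda>g. \<epsilon> / 4 * (?x g + ?y g))" by (rule finsupp_of1[OF xy]) simp
  have "finsupp ?C (\<lambda>g. 2 / \<epsilon> * ?d g + \<epsilon> / 4 * (?x g + ?y g))"
    by (rule finsupp_of2[OF d xy]) (simp add: sum_power2_eq_zero_iff)
  moreover have "finsupp ?C (\<lambda>g. \<bar>?x g - ?y g\<bar>)" by (rule finsupp_of2[OF x(1) y(1)]) simp
  ultimately have "infsum (\<lambda>g. \<bar>?x g - ?y g\<bar>) ?C \<le> infsum (\<lambda>g. 2 / \<epsilon> * ?d g + \<epsilon> / 4 * (?x g + ?y g)) ?C"
    by (intro infsum_mono finsupp_summable abs_diff_squares_le \<open>\<epsilon> > 0\<close>)
  also have "\<dots> = 2 / \<epsilon> * infsum ?d ?C + \<epsilon> / 4 * infsum (\<lambda>g. ?x g + ?y g) ?C"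
    unfolding infsum_cmult_right'[symmetric]
    by (rule infsum_add[OF finsupp_summable[OF d'] finsupp_summable[OF xy']])
  also have "infsum (\<lambda>g. ?x g + ?y g) ?C = 2 * sqnorm f v"
    using infsum_add[OF finsupp_summable[OF x(1)] finsupp_summable[OF y(1)]] x(2) y(2) by simp
  finally have "\<epsilon> * sqnorm f v \<le> 2 / \<epsilon> * sqdist f v v h + \<epsilon> / 4 * (2 * sqnorm f v)"
    using large by (simp add: sqdist_def)
  then have "\<epsilon> * sqnorm f v \<le> 4 / \<epsilon> * sqdist f v v h" by simp
  then show ?thesis
    using \<open>\<epsilon> > 0\<close> by (simp add: field_simps power2_eq_square)
qed

end

section \<open>Coercivity from the failure of Reiter's condition\<close>

context transitive_labelled_graph
begin

text \<open>Finitely many requests for paths are met within a common length. The constants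
  \<open>4 ^ m\<close> and \<open>T ^ m\<close> of the later estimates come from here.\<close>

lemma uniform_length:
  assumes "finite S" "S \<subseteq> V \<times> V \<times> carrier G"
  shows "\<exists>m. \<forall>v w g. (v, w, g) \<in> S \<longrightarrow> (\<exists>n\<le>m. npaths n v w g > 0)"
proof -
  have "\<forall>p\<in>S. \<exists>n. npaths n (fst p) (fst (snd p)) (snd (snd p)) > 0"
  proof
    fix p assume "p \<in> S"
    then have "fst p \<in> V" "fst (snd p) \<in> V" "snd (snd p) \<in> carrier G" using assms(2) by auto
    from transitive[OF this] show "\<exists>n. npaths n (fst p) (fst (snd p)) (snd (snd p)) > 0" by auto
  qed
  from bchoice[OF this] obtain N where
    N: "\<And>p. p \<in> S \<Longrightarrow> npaths (N p) (fst p) (fst (snd p)) (snd (snd p)) > 0" by auto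
  show ?thesis
  proof (rule exI[of _ "\<Sum>p\<in>S. N p"], intro allI impI)
    fix v w g assume p: "(v, w, g) \<in> S"
    have "N (v, w, g) \<le> (\<Sum>p\<in>S. N p)"
      using p assms(1) by (intro member_le_sum) auto
    with N[OF p] show "\<exists>n\<le>(\<Sum>p\<in>S. N p). npaths n v w g > 0" by auto
  qed
qed

text \<open>If the energy of \<open>f\<close> were small, paths would make \<open>f v0\<close>
  almost invariant under all of \<open>K\<close>, and its normalised square would be the vector that
  \<open>K\<close> and \<open>\<epsilon>\<close> exclude. Paths with trivial label carry the bound
  from \<open>v0\<close> to the other vertices.\<close>

lemma coercive:
  assumes "\<not> reiter G"
  obtains \<eta> where "\<eta> > 0" "\<And>f. finsupp_family f \<Longrightarrow> \<eta> * (\<Sum>v\<in>V. sqnorm f v) \<le> energy f"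
proof -
  let ?C = "carrier G"
  obtain K \<epsilon> where K: "finite K" "K \<subseteq> ?C" and \<epsilon>: "\<epsilon> > (0::real)"
    and notF: "\<not> (\<exists>F. finsupp ?C F \<and> (\<forall>g\<in>?C. F g \<ge> 0) \<and> infsum F ?C = 1 \<and>
        (\<forall>h\<in>K. infsum (\<lambda>g. \<bar>F (g \<otimes> h) - F g\<bar>) ?C \<le> \<epsilon>))"
    using assms unfolding reiter_def not_all not_imp by (elim exE conjE)
  obtain v0 where v0: "v0 \<in> V" using nonempty_V by blast
  \<comment> \<open>The paths used: from every vertex to \<open>v0\<close> with trivial label, and
    loops at \<open>v0\<close> labelled by \<open>K\<close>.\<close>
  define S where "S = (\<lambda>v. (v, v0, \<one>)) ` V \<union> (\<lambda>h. (v0, v0, h)) ` K"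
  have S: "finite S" "S \<subseteq> V \<times> V \<times> ?C"
    using finite_V K v0 by (auto simp: S_def)
  obtain m where m: "\<forall>v w g. (v, w, g) \<in> S \<longrightarrow> (\<exists>n\<le>m. npaths n v w g > 0)"
    using uniform_length[OF S] by (elim exE)
  define D :: real where "D = 4 ^ m"
  have D: "sqdist f v w a \<le> D * energy f"
    if f: "finsupp_family f" and vwa: "(v, w, a) \<in> S" for f v w a
  proof -
    obtain n where n: "n \<le> m" "npaths n v w a > 0" using m vwa by blast
    have "sqdist f v w a \<le> 4 ^ n * energy f"
      using S(2) vwa by (intro sqdist_path_le[OF f n(2)]) auto
    also have "\<dots> \<le> D * energy f"
      unfolding D_def using n(1) by (intro mult_right_mono power_increasing energy_nonneg) auto
    finally show ?thesis .
  qed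
  have "D > 0" by (simp add: D_def)
  \<comment> \<open>\<open>2 * D\<close> pays for moving from a vertex to \<open>v0\<close>, and
    \<open>8 / \<epsilon>\<^sup>2 * D\<close> is twice the bound at \<open>v0\<close>; then sum over
    the vertices.\<close>
  define B where "B = real (card V) * (2 * D + 8 / \<epsilon>\<^sup>2 * D)"
  have "B > 0"
    unfolding B_def using \<open>D > 0\<close> \<epsilon> nonempty_V finite_V
    by (intro mult_pos_pos add_pos_pos) (auto simp: card_gt_0_iff)
  have "(\<Sum>v\<in>V. sqnorm f v) \<le> B * energy f" if f: "finsupp_family f" for f
  proof -
    have v0_le: "sqnorm f v0 \<le> 4 / \<epsilon>\<^sup>2 * (D * energy f)"
    proof (cases "sqnorm f v0 = 0")
      case True
      then show ?thesis using \<open>D > 0\<close> energy_nonneg[of f] by simp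
    next
      case False
      then have pos: "sqnorm f v0 > 0" using sqnorm_nonneg[of f v0] by simp
      define F where "F g = (1 / sqnorm f v0) * (f v0 g)\<^sup>2" for g
      have "finsupp ?C F"
        by (rule finsupp_of1[OF finsupp_sqnorm[OF f v0]]) (simp add: F_def)
      moreover have "F g \<ge> 0" for g
        using pos by (simp add: F_def)
      moreover have "infsum F ?C = 1"
        unfolding F_def infsum_cmult_right' using pos by (simp add: sqnorm_def)
      moreover have "\<not> (finsupp ?C F \<and> (\<forall>g\<in>?C. F g \<ge> 0) \<and> infsum F ?C = 1 \<and>
        (\<forall>h\<in>K. infsum (\<lambda>g. \<bar>F (g \<otimes> h) - F g\<bar>) ?C \<le> \<epsilon>))"
        using notF by (rule contrapos_nn) (rule exI)
      ultimately have "\<exists>h\<in>K. \<not> infsum (\<lambda>g. \<bar>F (g \<otimes> h) - F g\<bar>) ?C \<le> \<epsilon>"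
        by simp
      then obtain h where h: "h \<in> K" "infsum (\<lambda>g. \<bar>F (g \<otimes> h) - F g\<bar>) ?C > \<epsilon>"
        unfolding not_le by blast
      have "(\<lambda>g. \<bar>F (g \<otimes> h) - F g\<bar>) = (\<lambda>g. (1 / sqnorm f v0) * \<bar>(f v0 (g \<otimes> h))\<^sup>2 - (f v0 g)\<^sup>2\<bar>)"
      proof
        fix g
        have "F (g \<otimes> h) - F g = (1 / sqnorm f v0) * ((f v0 (g \<otimes> h))\<^sup>2 - (f v0 g)\<^sup>2)"
          by (simp only: F_def right_diff_distrib)
        then show "\<bar>F (g \<otimes> h) - F g\<bar> = (1 / sqnorm f v0) * \<bar>(f v0 (g \<otimes> h))\<^sup>2 - (f v0 g)\<^sup>2\<bar>"
          using pos by (simp only: abs_mult) simp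
      qed
      then have "\<epsilon> < (1 / sqnorm f v0) * infsum (\<lambda>g. \<bar>(f v0 (g \<otimes> h))\<^sup>2 - (f v0 g)\<^sup>2\<bar>) ?C"
        using h(2) by (simp only: infsum_cmult_right')
      then have "\<epsilon> * sqnorm f v0 \<le> infsum (\<lambda>g. \<bar>(f v0 (g \<otimes> h))\<^sup>2 - (f v0 g)\<^sup>2\<bar>) ?C"
        using pos by (simp add: pos_less_divide_eq less_imp_le)
      then have "sqnorm f v0 \<le> 4 / \<epsilon>\<^sup>2 * sqdist f v0 v0 h"
        using h(1) K(2) \<epsilon> by (intro sqnorm_le_sqdist[OF f v0]) auto
      also have "\<dots> \<le> 4 / \<epsilon>\<^sup>2 * (D * energy f)"
        using h(1) by (intro mult_left_mono D[OF f]) (auto simp: S_def)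
      finally show ?thesis .
    qed
    have "sqnorm f v \<le> (2 * D + 8 / \<epsilon>\<^sup>2 * D) * energy f" if v: "v \<in> V" for v
    proof -
      have "sqnorm f v \<le> 2 * sqdist f v v0 \<one> + 2 * sqnorm f v0"
        by (rule sqnorm_le[OF f v v0 one_closed])
      also have "\<dots> \<le> 2 * (D * energy f) + 2 * (4 / \<epsilon>\<^sup>2 * (D * energy f))"
        using v by (intro add_mono mult_left_mono D[OF f] v0_le) (auto simp: S_def)
      finally show ?thesis by (simp add: algebra_simps)
    qed
    then have "(\<Sum>v\<in>V. sqnorm f v) \<le> (\<Sum>v\<in>V. (2 * D + 8 / \<epsilon>\<^sup>2 * D) * energy f)"
      by (intro sum_mono)
    then show ?thesis by (simp add: B_def mult.assoc)
  qed
  then show ?thesis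
    using \<open>B > 0\<close> by (intro that[of "1 / B"]) (auto simp: field_simps)
qed

end

section \<open>Decay of return weights\<close>

text \<open>Convexity of the square with its gain kept. The mixed terms \<open>a * m / 2\<close> of
  the two summands on the left cancel, and what remains is the Cauchy-Schwarz bound
  \<open>m\<^sup>2 \<le> S\<close> for total mass at most 1. The second summand becomes the
  energy.\<close>

lemma lazy_jensen:
  fixes a :: real and p b :: "'i \<Rightarrow> real"
  assumes p: "\<And>i. i \<in> I \<Longrightarrow> p i \<ge> 0" and p1: "sum p I \<le> 1"
  shows "((a + (\<Sum>i\<in>I. p i * b i)) / 2)\<^sup>2 + (\<Sum>i\<in>I. p i / 4 * (a - b i)\<^sup>2)
      \<le> a\<^sup>2 / 2 + (\<Sum>i\<in>I. p i / 2 * (b i)\<^sup>2)"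
proof -
  define m where "m = (\<Sum>i\<in>I. p i * b i)"
  define S where "S = (\<Sum>i\<in>I. p i * (b i)\<^sup>2)"
  have "0 \<le> (\<Sum>i\<in>I. p i * (b i - m)\<^sup>2)"
    using p by (intro sum_nonneg) auto
  also have "\<dots> = (\<Sum>i\<in>I. p i * (b i)\<^sup>2 - 2 * m * (p i * b i) + p i * m\<^sup>2)"
    by (intro sum.cong) (simp_all add: power2_diff algebra_simps)
  also have "\<dots> = S - 2 * m * m + sum p I * m\<^sup>2"
    by (simp add: sum.distrib sum_subtractf sum_distrib_left sum_distrib_right S_def m_def)
  also have "\<dots> \<le> S - 2 * m * m + 1 * m\<^sup>2"
    using p1 by (intro add_left_mono mult_right_mono) auto
  finally have 1: "m\<^sup>2 \<le> S" by (simp add: power2_eq_square)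
  have 2: "sum p I * a\<^sup>2 \<le> 1 * a\<^sup>2"
    using p1 by (intro mult_right_mono) auto
  have "(\<Sum>i\<in>I. p i / 4 * (a - b i)\<^sup>2)
      = (\<Sum>i\<in>I. a\<^sup>2 / 4 * p i - a / 2 * (p i * b i) + 1 / 4 * (p i * (b i)\<^sup>2))"
    by (intro sum.cong) (simp_all add: power2_diff algebra_simps)
  also have "\<dots> = a\<^sup>2 / 4 * sum p I - a / 2 * m + 1 / 4 * S"
    unfolding S_def m_def sum.distrib sum_subtractf sum_distrib_left ..
  finally have 3: "(\<Sum>i\<in>I. p i / 4 * (a - b i)\<^sup>2) = a\<^sup>2 / 4 * sum p I - a / 2 * m + 1 / 4 * S" .
  have 4: "(\<Sum>i\<in>I. p i / 2 * (b i)\<^sup>2) = S / 2"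
    by (simp add: S_def sum_divide_distrib)
  have 5: "((a + m) / 2)\<^sup>2 = a\<^sup>2 / 4 + a * m / 2 + m\<^sup>2 / 4"
    by (simp add: power2_eq_square field_simps)
  show ?thesis
    unfolding m_def[symmetric] 3 4 5 using 1 2 by (simp add: field_simps)
qed

text \<open>\<open>q v w / \<pi> v\<close> is a substochastic kernel and \<open>\<pi>\<close> a
  subinvariant measure for it. The bound on incoming weight is what yields a contraction of the
  square norm weighted by \<open>\<pi>\<close> without reversibility.\<close>

locale weighted_graph = labelled_graph +
  fixes \<pi> :: "'c \<Rightarrow> real" and q :: "'c \<Rightarrow> 'c \<Rightarrow> real"
  assumes pi_pos: "v \<in> V \<Longrightarrow> \<pi> v > 0"
    and q_nonneg: "v \<in> V \<Longrightarrow> w \<in> succs v \<Longrightarrow> q v w \<ge> 0"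
    and q_out: "v \<in> V \<Longrightarrow> (\<Sum>w\<in>succs v. q v w) \<le> \<pi> v"
    and q_in: "w \<in> V \<Longrightarrow> (\<Sum>v\<in>{v \<in> V. E v w}. q v w) \<le> \<pi> w"
begin

text \<open>Laziness removes periodicity: without it a vector almost preserved by the walk need not be almost
  constant along edges.\<close>

definition lazy_step :: "('c \<Rightarrow> 'a \<Rightarrow> real) \<Rightarrow> 'c \<Rightarrow> 'a \<Rightarrow> real" where
  "lazy_step f v g = (f v g + (\<Sum>w\<in>succs v. q v w / \<pi> v * f w (g \<otimes> lab v))) / 2"

definition wnorm :: "('c \<Rightarrow> 'a \<Rightarrow> real) \<Rightarrow> real" where
  "wnorm f = (\<Sum>v\<in>V. \<pi> v * sqnorm f v)"

text \<open>The Dirichlet form with conductances \<open>q\<close>.\<close>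

definition wenergy :: "('c \<Rightarrow> 'a \<Rightarrow> real) \<Rightarrow> real" where
  "wenergy f = (\<Sum>v\<in>V. \<Sum>w\<in>succs v. q v w * sqdist f v w (lab v))"

lemma finsupp_lazy_step:
  assumes f: "finsupp_family f"
  shows "finsupp_family (lazy_step f)"
  unfolding finsupp_family_def
proof
  fix v assume v: "v \<in> V"
  have S: "finsupp (carrier G) (\<lambda>g. \<Sum>w\<in>succs v. q v w / \<pi> v * f w (g \<otimes> lab v))"
  proof (rule finsupp_sum[OF finite_succs])
    fix w assume "w \<in> succs v"
    then have "finsupp (carrier G) (\<lambda>g. f w (g \<otimes> lab v))"
      using v by (intro finsupp_translate[OF f]) (auto simp: succs_V lab_closed)
    then show "finsupp (carrier G) (\<lambda>g. q v w / \<pi> v * f w (g \<otimes> lab v))"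
      by (rule finsupp_of1) simp
  qed
  have "finsupp (carrier G) (f v)"
    using f v by (simp add: finsupp_family_def)
  then show "finsupp (carrier G) (lazy_step f v)"
    by (rule finsupp_of2[OF _ S]) (simp only: lazy_step_def, simp)
qed

text \<open>This is \<open>lazy_jensen\<close> summed over the group. Translation by
  \<open>lab v\<close> does not change the norm of \<open>f w\<close>, so the right side no longer
  sees the labels.\<close>

lemma sqnorm_lazy_step:
  assumes f: "finsupp_family f" and v: "v \<in> V"
  shows "\<pi> v * sqnorm (lazy_step f) v + (\<Sum>w\<in>succs v. q v w * sqdist f v w (lab v)) / 4
    \<le> \<pi> v * sqnorm f v / 2 + (\<Sum>w\<in>succs v. q v w * sqnorm f w) / 2"
proof -
  let ?C = "carrier G"
  let ?l = "lab v"
  define p where "p w = q v w / \<pi> v" for w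
  have l: "?l \<in> ?C" using v by (rule lab_closed)
  have \<pi>: "\<pi> v > 0" using v by (rule pi_pos)
  have p: "p w \<ge> 0" if "w \<in> succs v" for w
    using q_nonneg[OF v that] \<pi> by (simp add: p_def)
  have p1: "sum p (succs v) \<le> 1"
    using q_out[OF v] \<pi> by (simp add: p_def sum_divide_distrib[symmetric])
  let ?D = "\<lambda>w g. p w / 4 * (f v g - f w (g \<otimes> ?l))\<^sup>2"
  let ?T = "\<lambda>w g. p w / 2 * (f w (g \<otimes> ?l))\<^sup>2"
  have D: "finsupp ?C (?D w)" "infsum (?D w) ?C = p w / 4 * sqdist f v w ?l" if w: "w \<in> succs v" for w
  proof -
    show "finsupp ?C (?D w)"
      by (rule finsupp_of1[OF finsupp_sqdist[OF f v succs_V[OF w] l]]) simp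
    show "infsum (?D w) ?C = p w / 4 * sqdist f v w ?l"
      unfolding sqdist_def by (rule infsum_cmult_right')
  qed
  have T: "finsupp ?C (?T w)" "infsum (?T w) ?C = p w / 2 * sqnorm f w" if w: "w \<in> succs v" for w
  proof -
    show "finsupp ?C (?T w)"
      by (rule finsupp_of1[OF finsupp_right_mult[OF l finsupp_sqnorm[OF f succs_V[OF w]]]]) simp
    show "infsum (?T w) ?C = p w / 2 * sqnorm f w"
      unfolding infsum_cmult_right' sqnorm_def using infsum_right_mult[OF l, of "\<lambda>g. (f w g)\<^sup>2"] by simp
  qed
  have sumD: "infsum (\<lambda>g. \<Sum>w\<in>succs v. ?D w g) ?C = (\<Sum>w\<in>succs v. p w / 4 * sqdist f v w ?l)"
    by (rule trans[OF infsum_sum_finsupp[OF finite_succs] sum.cong[OF refl D(2)]]) (rule D(1))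
  have sumT: "infsum (\<lambda>g. \<Sum>w\<in>succs v. ?T w g) ?C = (\<Sum>w\<in>succs v. p w / 2 * sqnorm f w)"
    by (rule trans[OF infsum_sum_finsupp[OF finite_succs] sum.cong[OF refl T(2)]]) (rule T(1))
  have A: "finsupp ?C (\<lambda>g. (lazy_step f v g)\<^sup>2)"
    by (rule finsupp_sqnorm[OF finsupp_lazy_step[OF f] v])
  have B: "finsupp ?C (\<lambda>g. \<Sum>w\<in>succs v. ?D w g)" "finsupp ?C (\<lambda>g. \<Sum>w\<in>succs v. ?T w g)"
    by (intro finsupp_sum finite_succs D T; assumption)+
  have F: "finsupp ?C (\<lambda>g. (f v g)\<^sup>2 / 2)"
    by (rule finsupp_of1[OF finsupp_sqnorm[OF f v]]) simp
  have "sqnorm (lazy_step f) v + (\<Sum>w\<in>succs v. p w / 4 * sqdist f v w ?l)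
      = infsum (\<lambda>g. (lazy_step f v g)\<^sup>2 + (\<Sum>w\<in>succs v. ?D w g)) ?C"
    unfolding infsum_add[OF finsupp_summable[OF A] finsupp_summable[OF B(1)]] sumD
    by (simp only: sqnorm_def)
  also have "\<dots> \<le> infsum (\<lambda>g. (f v g)\<^sup>2 / 2 + (\<Sum>w\<in>succs v. ?T w g)) ?C"
  proof (intro infsum_mono finsupp_summable)
    show "finsupp ?C (\<lambda>g. (lazy_step f v g)\<^sup>2 + (\<Sum>w\<in>succs v. ?D w g))"
      by (rule finsupp_of2[OF A B(1)]) simp
    show "finsupp ?C (\<lambda>g. (f v g)\<^sup>2 / 2 + (\<Sum>w\<in>succs v. ?T w g))"
      by (rule finsupp_of2[OF F B(2)]) simp
    fix g
    show "(lazy_step f v g)\<^sup>2 + (\<Sum>w\<in>succs v. ?D w g) \<le> (f v g)\<^sup>2 / 2 + (\<Sum>w\<in>succs v. ?T w g)"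
      using lazy_jensen[of "succs v" p "f v g" "\<lambda>w. f w (g \<otimes> ?l)", OF p p1]
      unfolding lazy_step_def p_def[symmetric] .
  qed
  also have "\<dots> = sqnorm f v / 2 + (\<Sum>w\<in>succs v. p w / 2 * sqnorm f w)"
  proof -
    have "infsum (\<lambda>g. (f v g)\<^sup>2 / 2) ?C = sqnorm f v / 2"
      using infsum_cmult_right'[of "1 / 2" "\<lambda>g. (f v g)\<^sup>2" ?C] by (simp add: sqnorm_def)
    then show ?thesis
      unfolding infsum_add[OF finsupp_summable[OF F] finsupp_summable[OF B(2)]] sumT by simp
  qed
  finally have "\<pi> v * (sqnorm (lazy_step f) v + (\<Sum>w\<in>succs v. p w / 4 * sqdist f v w ?l))
      \<le> \<pi> v * (sqnorm f v / 2 + (\<Sum>w\<in>succs v. p w / 2 * sqnorm f w))"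
    using \<pi> by (intro mult_left_mono) auto
  moreover have "\<pi> v * (\<Sum>w\<in>succs v. p w / 4 * sqdist f v w ?l) = (\<Sum>w\<in>succs v. q v w * sqdist f v w ?l) / 4"
    using \<pi> by (simp add: p_def sum_distrib_left sum_divide_distrib)
  moreover have "\<pi> v * (\<Sum>w\<in>succs v. p w / 2 * sqnorm f w) = (\<Sum>w\<in>succs v. q v w * sqnorm f w) / 2"
    using \<pi> by (simp add: p_def sum_distrib_left sum_divide_distrib)
  ultimately show ?thesis
    by (simp only: distrib_left times_divide_eq_right)
qed

text \<open>Exchanging the two sums collects the weights entering each vertex, which
  \<open>q_in\<close> bounds by \<open>\<pi>\<close>.\<close>

lemma wnorm_lazy_step:
  assumes f: "finsupp_family f"
  shows "wnorm (lazy_step f) + wenergy f / 4 \<le> wnorm f"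
proof -
  let ?X = "\<Sum>v\<in>V. \<Sum>w\<in>succs v. q v w * sqnorm f w"
  have "?X = (\<Sum>w\<in>V. \<Sum>v\<in>{v\<in>V. E v w}. q v w * sqnorm f w)"
    unfolding succs_def by (rule sum.swap_restrict[OF finite_V finite_V])
  also have "\<dots> = (\<Sum>w\<in>V. (\<Sum>v\<in>{v\<in>V. E v w}. q v w) * sqnorm f w)"
    by (simp add: sum_distrib_right)
  also have "\<dots> \<le> wnorm f"
    unfolding wnorm_def by (intro sum_mono mult_right_mono q_in sqnorm_nonneg)
  finally have X: "?X \<le> wnorm f" .
  have "wnorm (lazy_step f) + wenergy f / 4
      = (\<Sum>v\<in>V. \<pi> v * sqnorm (lazy_step f) v + (\<Sum>w\<in>succs v. q v w * sqdist f v w (lab v)) / 4)"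
    by (simp only: wnorm_def wenergy_def sum.distrib sum_divide_distrib)
  also have "\<dots> \<le> (\<Sum>v\<in>V. \<pi> v * sqnorm f v / 2 + (\<Sum>w\<in>succs v. q v w * sqnorm f w) / 2)"
    by (intro sum_mono sqnorm_lazy_step f)
  also have "\<dots> = wnorm f / 2 + ?X / 2"
    by (simp only: wnorm_def sum.distrib sum_divide_distrib)
  finally show ?thesis using X by linarith
qed

definition delta :: "'c \<Rightarrow> 'c \<Rightarrow> 'a \<Rightarrow> real" where
  "delta v0 v g = (if v = v0 \<and> g = \<one> then 1 else 0)"

text \<open>The weight of the paths of length \<open>m\<close> from \<open>(v, g)\<close> to
  \<open>(v0, \<one>)\<close>, for the walk without laziness.\<close>

primrec walk :: "'c \<Rightarrow> nat \<Rightarrow> 'c \<Rightarrow> 'a \<Rightarrow> real" where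
  "walk v0 0 = delta v0"
| "walk v0 (Suc m) = (\<lambda>v g. \<Sum>w\<in>succs v. q v w / \<pi> v * walk v0 m w (g \<otimes> lab v))"

lemma finsupp_delta: "finsupp_family (delta v0)"
  unfolding finsupp_family_def finsupp_def
  by (rule ballI, rule finite_subset[of _ "{\<one>}"]) (auto simp: delta_def split: if_splits)

lemma finsupp_lazy_iter: "finsupp_family ((lazy_step ^^ n) (delta v0))"
  by (induction n) (auto simp: finsupp_delta finsupp_lazy_step)

lemma lazy_iter_Suc:
  "(lazy_step ^^ Suc n) f v g
    = ((lazy_step ^^ n) f v g + (\<Sum>w\<in>succs v. q v w / \<pi> v * (lazy_step ^^ n) f w (g \<otimes> lab v))) / 2"
  unfolding funpow.simps comp_apply by (rule lazy_step_def)

lemma lazy_iter_nonneg: "v \<in> V \<Longrightarrow> (lazy_step ^^ n) (delta v0) v g \<ge> 0"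
proof (induction n arbitrary: v g)
  case 0
  then show ?case by (simp add: delta_def)
next
  case (Suc n)
  then show ?case
    unfolding lazy_iter_Suc
    by (intro divide_nonneg_nonneg add_nonneg_nonneg sum_nonneg mult_nonneg_nonneg q_nonneg)
      (auto simp: succs_V pi_pos less_imp_le)
qed

text \<open>With \<open>P\<close> the kernel of the walk, the \<open>n\<close>-th power of
  \<open>(1 + P) / 2\<close> expands binomially with nonnegative terms; a single one is kept.
  Pascal's rule drives the induction.\<close>

lemma lazy_iter_ge_walk:
  "v \<in> V \<Longrightarrow> real (n choose m) / 2 ^ n * walk v0 m v g \<le> (lazy_step ^^ n) (delta v0) v g"
proof (induction n arbitrary: m v g)
  case 0
  then show ?case by (cases m) (simp_all add: delta_def)
next
  case (Suc n)
  let ?F = "(lazy_step ^^ n) (delta v0)"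
  have p: "q v w / \<pi> v \<ge> 0" if "w \<in> succs v" for w
    using q_nonneg[OF Suc.prems that] pi_pos[OF Suc.prems] by simp
  show ?case
  proof (cases m)
    case 0
    have "0 \<le> (\<Sum>w\<in>succs v. q v w / \<pi> v * ?F w (g \<otimes> lab v))"
      by (intro sum_nonneg mult_nonneg_nonneg p lazy_iter_nonneg succs_V)
    with Suc.IH[OF Suc.prems, of 0 g]
    have "real (n choose 0) / 2 ^ n * walk v0 0 v g / 2
      \<le> (?F v g + (\<Sum>w\<in>succs v. q v w / \<pi> v * ?F w (g \<otimes> lab v))) / 2"
      by (intro divide_right_mono) linarith+
    then show ?thesis
      unfolding lazy_iter_Suc 0 by simp
  next
    case (Suc k)
    have "real (n choose k) / 2 ^ n * walk v0 (Suc k) v g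
        = (\<Sum>w\<in>succs v. q v w / \<pi> v * (real (n choose k) / 2 ^ n * walk v0 k w (g \<otimes> lab v)))"
      by (simp add: sum_distrib_left mult_ac)
    also have "\<dots> \<le> (\<Sum>w\<in>succs v. q v w / \<pi> v * ?F w (g \<otimes> lab v))"
      by (intro sum_mono mult_left_mono p Suc.IH[OF succs_V])
    finally have "real (n choose k) / 2 ^ n * walk v0 (Suc k) v g
        \<le> (\<Sum>w\<in>succs v. q v w / \<pi> v * ?F w (g \<otimes> lab v))" .
    with Suc.IH[OF Suc.prems, of "Suc k" g]
    have "real (n choose Suc k) / 2 ^ n * walk v0 (Suc k) v g + real (n choose k) / 2 ^ n * walk v0 (Suc k) v g
      \<le> ?F v g + (\<Sum>w\<in>succs v. q v w / \<pi> v * ?F w (g \<otimes> lab v))"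
      by (intro add_mono)
    moreover have "real (Suc n choose Suc k) / 2 ^ Suc n * walk v0 (Suc k) v g
      = (real (n choose Suc k) / 2 ^ n * walk v0 (Suc k) v g + real (n choose k) / 2 ^ n * walk v0 (Suc k) v g) / 2"
      by (simp add: add_divide_distrib distrib_right del: walk.simps)
    ultimately show ?thesis
      unfolding Suc lazy_iter_Suc by (simp only: divide_right_mono zero_le_numeral)
  qed
qed

text \<open>Run the lazy walk for \<open>2 * m\<close> steps. The norm, a square root of
  \<open>wnorm\<close>, shrinks by \<open>(1 - \<eta>) ^ m\<close>, and the central binomial
  coefficient, at least \<open>4 ^ m / (2 * m)\<close>, recovers the original walk at only
  polynomial cost.\<close>

lemma walk_return_le:
  assumes v0: "v0 \<in> V" and \<eta>: "\<eta> \<le> 1"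
    and coercive: "\<And>f. finsupp_family f \<Longrightarrow> 4 * \<eta> * wnorm f \<le> wenergy f"
    and m: "m > 0"
  shows "walk v0 m v0 \<one> \<le> 2 * real m * (1 - \<eta>) ^ m"
proof -
  let ?C = "carrier G"
  let ?F = "\<lambda>n. (lazy_step ^^ n) (delta v0)"
  have wn: "wnorm (?F n) \<le> (1 - \<eta>) ^ n * \<pi> v0" for n
  proof (induction n)
    case 0
    have sq: "sqnorm (delta v0) v = (if v = v0 then 1 else 0)" for v
    proof -
      have "sqnorm (delta v0) v = infsum (\<lambda>g. (delta v0 v g)\<^sup>2) {\<one>}"
        unfolding sqnorm_def by (rule infsum_cong_neutral) (auto simp: delta_def)
      then show ?thesis by (simp add: delta_def)
    qed
    have "wnorm (delta v0) = (\<Sum>v\<in>V. if v = v0 then \<pi> v else 0)"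
      unfolding wnorm_def by (intro sum.cong) (simp_all add: sq)
    then show ?case
      using v0 finite_V by (simp add: sum.delta)
  next
    case (Suc n)
    \<comment> \<open>The 4 in the coercivity hypothesis cancels the quarter in front of the energy
      in \<open>wnorm_lazy_step\<close>.\<close>
    have "wnorm (?F (Suc n)) \<le> wnorm (?F n) - \<eta> * wnorm (?F n)"
      using wnorm_lazy_step[OF finsupp_lazy_iter, of n v0] coercive[OF finsupp_lazy_iter, of n v0]
      unfolding funpow.simps comp_apply by linarith
    also have "\<dots> = (1 - \<eta>) * wnorm (?F n)"
      by (simp add: left_diff_distrib)
    also have "\<dots> \<le> (1 - \<eta>) * ((1 - \<eta>) ^ n * \<pi> v0)"
      using Suc.IH \<eta> by (intro mult_left_mono) auto
    finally show ?case by simp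
  qed
  have "\<pi> v0 * (?F (2 * m) v0 \<one>)\<^sup>2 \<le> \<pi> v0 * sqnorm (?F (2 * m)) v0"
  proof (intro mult_left_mono)
    have "infsum (\<lambda>g. (?F (2 * m) v0 g)\<^sup>2) {\<one>} \<le> sqnorm (?F (2 * m)) v0"
      unfolding sqnorm_def
      by (rule infsum_mono2[OF _ finsupp_summable[OF finsupp_sqnorm[OF finsupp_lazy_iter v0]]]) auto
    then show "(?F (2 * m) v0 \<one>)\<^sup>2 \<le> sqnorm (?F (2 * m)) v0" by simp
  qed (use pi_pos[OF v0] in simp)
  also have "\<dots> \<le> wnorm (?F (2 * m))"
    unfolding wnorm_def using v0 finite_V pi_pos
    by (intro member_le_sum[of v0 V "\<lambda>v. \<pi> v * sqnorm (?F (2 * m)) v"])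
      (simp_all add: sqnorm_nonneg less_imp_le)
  also have "\<dots> \<le> (1 - \<eta>) ^ (2 * m) * \<pi> v0"
    by (rule wn)
  also have "\<dots> = \<pi> v0 * ((1 - \<eta>) ^ m)\<^sup>2"
    by (simp add: power_even_eq)
  finally have "\<pi> v0 * (?F (2 * m) v0 \<one>)\<^sup>2 \<le> \<pi> v0 * ((1 - \<eta>) ^ m)\<^sup>2" .
  then have "(?F (2 * m) v0 \<one>)\<^sup>2 \<le> ((1 - \<eta>) ^ m)\<^sup>2"
    using pi_pos[OF v0] by simp
  then have F_le: "?F (2 * m) v0 \<one> \<le> (1 - \<eta>) ^ m"
    by (rule power2_le_imp_le) (use \<eta> in simp)
  have walk0: "walk v0 k v g \<ge> 0" if "v \<in> V" for k v g
    using that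
  proof (induction k arbitrary: v g)
    case 0
    then show ?case by (simp add: delta_def)
  next
    case (Suc k)
    then show ?case
      unfolding walk.simps
      by (intro divide_nonneg_nonneg sum_nonneg mult_nonneg_nonneg q_nonneg)
        (auto simp: succs_V pi_pos less_imp_le)
  qed
  have "4 ^ m / (2 * real m) / 4 ^ m * walk v0 m v0 \<one> \<le> real ((2 * m) choose m) / 2 ^ (2 * m) * walk v0 m v0 \<one>"
  proof (rule mult_right_mono[OF _ walk0[OF v0]])
    have "(2::real) ^ (2 * m) = 4 ^ m"
      by (simp add: power_mult)
    then show "4 ^ m / (2 * real m) / 4 ^ m \<le> real ((2 * m) choose m) / 2 ^ (2 * m)"
      using divide_right_mono[OF central_binomial_lower_bound[OF m], of "4 ^ m"] by (simp only: zero_le_power zero_le_numeral)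
  qed
  also have "\<dots> \<le> (1 - \<eta>) ^ m"
    using lazy_iter_ge_walk[OF v0, of "2 * m" m v0 \<one>] F_le by linarith
  finally have "1 / (2 * real m) * walk v0 m v0 \<one> \<le> (1 - \<eta>) ^ m"
    by simp
  then show ?thesis
    using m by (simp add: pos_divide_le_eq mult_ac)
qed

end

section \<open>Left supereigenvectors\<close>

context labelled_graph
begin

definition left_supereigen :: "('a \<Rightarrow> real) \<Rightarrow> ('v \<Rightarrow> real) \<Rightarrow> real \<Rightarrow> bool" where
  "left_supereigen \<kappa> l t \<longleftrightarrow> (\<forall>v\<in>V. l v > 0) \<and>
     (\<forall>w\<in>V. (\<Sum>v\<in>{v\<in>V. E v w}. l v * \<kappa> (lab v)) \<le> t * l w)"

text \<open>The left counterpart of the right eigenvector \<open>u\<close>: a weighted count of the paths ending in a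
  given vertex.\<close>

lemma left_supereigen_exists:
  assumes se: "supereigen \<kappa> u s" and s: "0 < s" "s < t"
  shows "\<exists>l. left_supereigen \<kappa> l t"
proof -
  have t: "t > 0" using s by simp
  have \<kappa>: "\<kappa> (lab v) > 0" if "v \<in> V" for v
    using se lab_closed[OF that] by (simp add: supereigen_def character_def)
  have u: "u v > 0" if "v \<in> V" for v
    using se that by (simp add: supereigen_def)
  have le: "(\<Sum>w\<in>succs v. \<kappa> (lab v) * u w) \<le> s * u v" if "v \<in> V" for v
    using se that by (simp add: supereigen_def)
  \<comment> \<open>\<open>z n w\<close> is the total \<open>\<kappa>\<close>-weight of the paths of
    length \<open>n\<close> that end in \<open>w\<close>.\<close>
  define z where "z = rec_nat (\<lambda>w. 1::real) (\<lambda>n y w. \<Sum>v\<in>{v\<in>V. E v w}. y v * \<kappa> (lab v))"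
  have z0: "z 0 w = 1" for w
    by (simp add: z_def)
  have zS: "z (Suc n) w = (\<Sum>v\<in>{v\<in>V. E v w}. z n v * \<kappa> (lab v))" for n w
    by (simp add: z_def)
  have z_nonneg: "z n w \<ge> 0" for n w
  proof (induction n arbitrary: w)
    case 0
    show ?case by (simp add: z0)
  next
    case (Suc n)
    show ?case
      unfolding zS using \<kappa> by (intro sum_nonneg mult_nonneg_nonneg Suc.IH) (simp add: less_imp_le)
  qed
  define U where "U = (\<Sum>w\<in>V. u w)"
  \<comment> \<open>Pairing with the right vector \<open>u\<close> controls the growth by
    \<open>s ^ n\<close>; as \<open>s < t\<close>, the series for \<open>l\<close>
    converges.\<close>
  have sum_le: "(\<Sum>w\<in>V. z n w * u w) \<le> s ^ n * U" for n
  proof (induction n)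
    case 0
    show ?case by (simp add: z0 U_def)
  next
    case (Suc n)
    have "(\<Sum>w\<in>V. z (Suc n) w * u w) = (\<Sum>w\<in>V. \<Sum>v\<in>{v\<in>V. E v w}. z n v * \<kappa> (lab v) * u w)"
      unfolding zS by (simp only: sum_distrib_right)
    also have "\<dots> = (\<Sum>v\<in>V. \<Sum>w\<in>succs v. z n v * \<kappa> (lab v) * u w)"
      unfolding succs_def by (rule sum.swap_restrict[OF finite_V finite_V, symmetric])
    also have "\<dots> = (\<Sum>v\<in>V. z n v * (\<Sum>w\<in>succs v. \<kappa> (lab v) * u w))"
      by (simp only: sum_distrib_left mult.assoc)
    also have "\<dots> \<le> (\<Sum>v\<in>V. z n v * (s * u v))"
      by (intro sum_mono mult_left_mono le z_nonneg)
    also have "\<dots> = s * (\<Sum>v\<in>V. z n v * u v)"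
      by (simp add: sum_distrib_left mult_ac)
    also have "\<dots> \<le> s * (s ^ n * U)"
      using Suc.IH s(1) by (intro mult_left_mono) auto
    finally show ?case by (simp only: power_Suc mult.assoc)
  qed
  define l where "l w = suminf (\<lambda>n. z n w / t ^ n)" for w
  have summable: "summable (\<lambda>n. z n w / t ^ n)" if w: "w \<in> V" for w
  proof -
    have le: "norm (z n w / t ^ n) \<le> U / u w * (s / t) ^ n" for n
    proof -
      have "z n w * u w \<le> (\<Sum>w\<in>V. z n w * u w)"
        using w finite_V u z_nonneg
        by (intro member_le_sum[of w V "\<lambda>w. z n w * u w"]) (simp_all add: less_imp_le)
      also have "\<dots> \<le> s ^ n * U" by (rule sum_le)
      finally have "z n w \<le> U / u w * s ^ n"
        using u[OF w] by (simp add: pos_le_divide_eq mult.commute)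
      then have "z n w / t ^ n \<le> U / u w * s ^ n / t ^ n"
        using t by (intro divide_right_mono) auto
      then show ?thesis
        using z_nonneg[of n w] t by (simp add: power_divide)
    qed
    have "summable (\<lambda>n. U / u w * (s / t) ^ n)"
      using s by (intro summable_mult summable_geometric) simp
    then show ?thesis
      by (rule summable_comparison_test'[where N = 0]) (rule le)
  qed
  have "l v > 0" if "v \<in> V" for v
    unfolding l_def using z_nonneg t
    by (intro suminf_pos2[OF summable[OF that], of 0]) (simp_all add: z0)
  moreover have "(\<Sum>v\<in>{v\<in>V. E v w}. l v * \<kappa> (lab v)) \<le> t * l w" if w: "w \<in> V" for w
  proof -
    have "(\<Sum>v\<in>{v\<in>V. E v w}. l v * \<kappa> (lab v))
        = (\<Sum>v\<in>{v\<in>V. E v w}. suminf (\<lambda>n. z n v / t ^ n * \<kappa> (lab v)))"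
      unfolding l_def by (intro sum.cong refl suminf_mult2 summable) simp
    also have "\<dots> = suminf (\<lambda>n. \<Sum>v\<in>{v\<in>V. E v w}. z n v / t ^ n * \<kappa> (lab v))"
      by (intro suminf_sum[symmetric] summable_mult2 summable) simp
    also have "(\<lambda>n. \<Sum>v\<in>{v\<in>V. E v w}. z n v / t ^ n * \<kappa> (lab v)) = (\<lambda>n. t * (z (Suc n) w / t ^ Suc n))"
    proof
      fix n
      have "(\<Sum>v\<in>{v\<in>V. E v w}. z n v / t ^ n * \<kappa> (lab v)) = z (Suc n) w / t ^ n"
        unfolding zS sum_divide_distrib by (intro sum.cong) simp_all
      then show "(\<Sum>v\<in>{v\<in>V. E v w}. z n v / t ^ n * \<kappa> (lab v)) = t * (z (Suc n) w / t ^ Suc n)"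
        using t by simp
    qed
    also have "suminf (\<lambda>n. t * (z (Suc n) w / t ^ Suc n)) = t * suminf (\<lambda>n. z (Suc n) w / t ^ Suc n)"
      using summable[OF w] by (intro suminf_mult) (simp only: summable_Suc_iff[of "\<lambda>n. z n w / t ^ n"])
    \<comment> \<open>Only the starting term 1 is lost, so the incoming sum is
      \<open>t * (l w - 1)\<close>.\<close>
    also have "suminf (\<lambda>n. z (Suc n) w / t ^ Suc n) = l w - 1"
      using suminf_split_head[OF summable[OF w]] by (simp add: l_def z0)
    finally show ?thesis using t by (simp add: algebra_simps)
  qed
  ultimately have "left_supereigen \<kappa> l t"
    by (simp add: left_supereigen_def)
  then show ?thesis by blast
qed

text \<open>The Harnack inequality for the left vector: at each step the incoming sum is bounded
  below by the one edge that the path uses.\<close>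

lemma left_path_le:
  assumes "character \<kappa>" and t: "t \<ge> 0"
    and left: "left_supereigen \<kappa> l t"
    and "npaths n v w a > 0" "v \<in> V" "a \<in> carrier G"
  shows "l v * \<kappa> a \<le> t ^ n * l w"
  using assms(4-)
proof (induction n arbitrary: v a)
  case 0
  then have "v = w" "a = \<one>" by (auto split: if_splits)
  with character_one[OF assms(1)] show ?case by simp
next
  case (Suc n)
  let ?b = "inv (lab v) \<otimes> a"
  obtain v' where v': "v' \<in> succs v" "npaths n v' w ?b > 0"
    using npaths_SucE[OF Suc.prems(1)] by blast
  have b: "?b \<in> carrier G" "lab v \<in> carrier G" and a: "lab v \<otimes> ?b = a"
    using Suc.prems lab_closed by (auto simp: mult_inv_cancel_left)
  have pos: "\<kappa> c > 0" if "c \<in> carrier G" for c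
    using assms(1) that by (simp add: character_def)
  have "l v * \<kappa> (lab v) \<le> (\<Sum>v\<in>{v\<in>V. E v v'}. l v * \<kappa> (lab v))"
    using Suc.prems v'(1) finite_V left pos lab_closed
    by (intro member_le_sum[of v _ "\<lambda>v. l v * \<kappa> (lab v)"]) (auto simp: succs_def less_imp_le left_supereigen_def)
  also have "\<dots> \<le> t * l v'"
    using left succs_V[OF v'(1)] by (simp add: left_supereigen_def)
  finally have "l v * \<kappa> (lab v) * \<kappa> ?b \<le> t * l v' * \<kappa> ?b"
    using pos[OF b(1)] by (intro mult_right_mono) auto
  also have "\<dots> \<le> t * (t ^ n * l w)"
    using Suc.IH[OF v'(2) succs_V[OF v'(1)] b(1)] t by (simp add: mult.assoc mult_left_mono)
  finally have "l v * (\<kappa> (lab v) * \<kappa> ?b) \<le> t ^ Suc n * l w"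
    by (simp add: mult.assoc)
  moreover have "\<kappa> (lab v \<otimes> ?b) = \<kappa> (lab v) * \<kappa> ?b"
    using assms(1) b unfolding character_def by blast
  ultimately show ?case by (simp only: a)
qed

end

section \<open>Uniform lower bounds on weights and exponential decay\<close>

context transitive_labelled_graph
begin

text \<open>Every edge lies on a closed path with trivial label. The weights of the edges of such a path are
  at most \<open>1\<close> after normalisation and their product is \<open>t ^ (- n)\<close>, which bounds each of them below.\<close>

lemma uniform_weights:
  assumes T: "T \<ge> 1"
  shows "\<exists>c>0. \<forall>t \<kappa> u l. 0 < t \<longrightarrow> t \<le> T \<longrightarrow> supereigen \<kappa> u t \<longrightarrow> left_supereigen \<kappa> l t \<longrightarrow>
    (\<forall>v\<in>V. \<forall>w\<in>succs v. \<forall>v'\<in>V. c * (l v' * u v') \<le> l v * \<kappa> (lab v) * u w / t)"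
proof -
  \<comment> \<open>For each pair a path back whose label undoes that of the first vertex, to close
    up an edge, and a path with trivial label, to compare arbitrary vertices.\<close>
  define S where "S = (\<lambda>(v, w). (w, v, inv (lab v))) ` (V \<times> V) \<union> (\<lambda>(v, w). (v, w, \<one>)) ` (V \<times> V)"
  have S: "finite S" "S \<subseteq> V \<times> V \<times> carrier G"
    using finite_V lab_closed by (auto simp: S_def)
  obtain m where m: "\<forall>v w g. (v, w, g) \<in> S \<longrightarrow> (\<exists>n\<le>m. npaths n v w g > 0)"
    using uniform_length[OF S] by (elim exE)
  \<comment> \<open>Since \<open>T \<ge> 1\<close>, this dominates every Harnack constant
    \<open>t ^ n\<close> with \<open>n \<le> m\<close> and \<open>t \<le> T\<close>.\<close>
  define B where "B = T ^ m"
  have "B \<ge> 1" unfolding B_def using T by simp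
  \<comment> \<open>The three factors \<open>B\<close> compare \<open>l\<close> at \<open>v'\<close>
    and \<open>v\<close>, \<open>u\<close> at \<open>v'\<close> and \<open>v\<close>, and
    \<open>u\<close> at the two ends of the edge; \<open>T\<close> replaces \<open>t\<close> in the
    denominator.\<close>
  have bound: "1 / (B * B * B * T) * (l v' * u v') \<le> l v * \<kappa> (lab v) * u w / t"
    if t: "0 < t" "t \<le> T" and se: "supereigen \<kappa> u t" and left: "left_supereigen \<kappa> l t"
      and v: "v \<in> V" and ws: "w \<in> succs v" and v': "v' \<in> V" for t \<kappa> u l v w v'
  proof -
    have w: "w \<in> V" using ws by (rule succs_V)
    have l: "\<And>v. v \<in> V \<Longrightarrow> l v > 0"
      using left by (simp add: left_supereigen_def)
    have \<kappa>: "character \<kappa>" and u: "\<And>v. v \<in> V \<Longrightarrow> u v > 0"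
      using se by (auto simp: supereigen_def)
    have tn: "t ^ n \<le> B" if "n \<le> m" for n
    proof -
      have "t ^ n \<le> T ^ n" using t by (intro power_mono) auto
      also have "\<dots> \<le> B" unfolding B_def using that T by (rule power_increasing)
      finally show ?thesis .
    qed
    have u_le: "\<kappa> a * u y \<le> B * u x" if xyS: "(x, y, a) \<in> S" for x y a
    proof -
      have xya: "x \<in> V" "y \<in> V" "a \<in> carrier G" using xyS S(2) by auto
      obtain n where n: "n \<le> m" "npaths n x y a > 0" using m xyS by blast
      have pos: "\<kappa> a * u y > 0" using \<kappa> u xya by (simp add: character_def)
      have "1 * (\<kappa> a * u y) \<le> real (npaths n x y a) * (\<kappa> a * u y)"
        using n(2) pos by (intro mult_right_mono) auto
      also have "\<dots> \<le> t ^ n * u x"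
        using t xya by (intro supereigen_npaths_le[OF se]) auto
      also have "\<dots> \<le> B * u x"
        using tn[OF n(1)] u[OF xya(1)] by (intro mult_right_mono) auto
      finally show ?thesis by simp
    qed
    have l_le: "l v' \<le> B * l v"
    proof -
      have "(v', v, \<one>) \<in> S" using v v' by (auto simp: S_def)
      then obtain n where n: "n \<le> m" "npaths n v' v \<one> > 0" using m by blast
      have "l v' * \<kappa> \<one> \<le> t ^ n * l v"
        using t by (intro left_path_le[OF \<kappa> _ left n(2) v']) auto
      also have "\<dots> \<le> B * l v"
        using tn[OF n(1)] l[OF v] by (intro mult_right_mono) auto
      finally show ?thesis by (simp add: character_one[OF \<kappa>])
    qed
    have "(v, v', \<one>) \<in> S" using v v' by (auto simp: S_def)
    from u_le[OF this] have u_le': "u v' \<le> B * u v" by (simp add: character_one[OF \<kappa>])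
    have "(w, v, inv (lab v)) \<in> S" using v w by (auto simp: S_def)
    from u_le[OF this] have "\<kappa> (lab v) * (\<kappa> (inv (lab v)) * u v) \<le> \<kappa> (lab v) * (B * u w)"
      using \<kappa> lab_closed[OF v] by (intro mult_left_mono) (auto simp: character_def less_imp_le)
    moreover have "\<kappa> (lab v) * \<kappa> (inv (lab v)) = \<kappa> (lab v \<otimes> inv (lab v))"
      using \<kappa> lab_closed[OF v] unfolding character_def by (metis inv_closed)
    then have "\<kappa> (lab v) * (\<kappa> (inv (lab v)) * u v) = u v"
      using lab_closed[OF v] by (simp add: character_one[OF \<kappa>] mult.assoc[symmetric])
    ultimately have "u v \<le> \<kappa> (lab v) * (B * u w)"
      by (simp only:)
    then have uv: "u v \<le> B * (\<kappa> (lab v) * u w)"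
      by (simp only: mult.left_commute)
    have B0: "B > 0" using \<open>B \<ge> 1\<close> by simp
    have w0: "\<kappa> (lab v) * u w > 0"
      using \<kappa> u[OF w] lab_closed[OF v] by (simp add: character_def)
    have "l v' * u v' \<le> (B * l v) * (B * (B * (\<kappa> (lab v) * u w)))"
    proof (intro mult_mono l_le)
      show "u v' \<le> B * (B * (\<kappa> (lab v) * u w))"
        using u_le' mult_left_mono[OF uv, of B] B0 by linarith
    qed (use l[OF v] u[OF v'] B0 in auto)
    also have "\<dots> = B * B * B * (l v * \<kappa> (lab v) * u w)"
      by (simp add: mult_ac)
    finally have "1 / (B * B * B * T) * (l v' * u v') \<le> 1 / (B * B * B * T) * (B * B * B * (l v * \<kappa> (lab v) * u w))"
      using B0 T by (intro mult_left_mono) auto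
    also have "\<dots> = l v * \<kappa> (lab v) * u w / T"
      using B0 by simp
    also have "\<dots> \<le> l v * \<kappa> (lab v) * u w / t"
      using t l[OF v] w0 by (intro divide_left_mono) (auto simp: mult.assoc)
    finally show ?thesis .
  qed
  have "1 / (B * B * B * T) > 0" using \<open>B \<ge> 1\<close> T by simp
  with bound show ?thesis
    by (intro exI[of _ "1 / (B * B * B * T)"] conjI allI impI ballI) simp_all
qed

text \<open>Both ingredients of \<open>\<eta>\<close> are fixed first: \<open>\<theta>\<close>
  depends on the labelled graph, and \<open>c\<close> on the graph and \<open>T\<close>. Only then
  do \<open>\<kappa>\<close>, \<open>u\<close> and the left vector produce a
  \<open>weighted_graph\<close>, whose return weights are the normalised path counts.\<close>

lemma return_decay:
  assumes "\<not> reiter G" and T: "T \<ge> 1"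
  shows "\<exists>\<eta>. 0 < \<eta> \<and> \<eta> < 1 \<and> (\<forall>s t \<kappa> u v m. 0 < s \<longrightarrow> s < t \<longrightarrow> t \<le> T \<longrightarrow> supereigen \<kappa> u s \<longrightarrow> v \<in> V \<longrightarrow>
    m > 0 \<longrightarrow> real (npaths m v v \<one>) \<le> 2 * real m * (t * (1 - \<eta>)) ^ m)"
proof -
  obtain \<theta> where \<theta>: "\<theta> > 0" "\<And>f. finsupp_family f \<Longrightarrow> \<theta> * (\<Sum>v\<in>V. sqnorm f v) \<le> energy f"
    using coercive[OF assms(1)] by blast
  obtain c where c: "c > 0"
    "\<forall>t \<kappa> u l. 0 < t \<longrightarrow> t \<le> T \<longrightarrow> supereigen \<kappa> u t \<longrightarrow> left_supereigen \<kappa> l t \<longrightarrow>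
    (\<forall>v\<in>V. \<forall>w\<in>succs v. \<forall>v'\<in>V. c * (l v' * u v') \<le> l v * \<kappa> (lab v) * u w / t)"
    using uniform_weights[OF T] by (elim exE conjE)
  define k where "k = real (card V)"
  have k: "k > 0" using finite_V nonempty_V by (simp add: k_def card_gt_0_iff)
  \<comment> \<open>With \<open>P\<close> the total vertex weight, edge weights are at least
    \<open>c * P / k\<close>, while \<open>wnorm\<close> is at most \<open>P\<close> times the plain
    square norm. The factors \<open>P\<close> cancel and \<open>c * \<theta> / k\<close>
    remains.\<close>
  define y where "y = c * \<theta> / k"
  have y: "y > 0" using c(1) \<theta>(1) k by (simp add: y_def)
  define \<eta> where "\<eta> = min (1 / 2) (y / 4)"
  have \<eta>: "0 < \<eta>" "\<eta> < 1" and "4 * \<eta> \<le> y"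
    using y by (auto simp: \<eta>_def min_def)
  then have \<eta>_le: "4 * \<eta> \<le> c * \<theta> / k"
    by (simp only: y_def)
  have "real (npaths m v0 v0 \<one>) \<le> 2 * real m * (t * (1 - \<eta>)) ^ m"
    if s: "0 < s" "s < t" and tT: "t \<le> T" and se: "supereigen \<kappa> u s" and v0: "v0 \<in> V" and m: "m > 0"
    for s t \<kappa> u v0 m
  proof -
    have t: "t > 0" using s by simp
    have \<kappa>: "character \<kappa>" and u: "\<And>v. v \<in> V \<Longrightarrow> u v > 0"
      using se by (auto simp: supereigen_def)
    have right: "(\<Sum>w\<in>succs v. \<kappa> (lab v) * u w) \<le> t * u v" if "v \<in> V" for v
    proof -
      have "(\<Sum>w\<in>succs v. \<kappa> (lab v) * u w) \<le> s * u v"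
        using se that by (simp add: supereigen_def)
      also have "\<dots> \<le> t * u v" using s u[OF that] by (intro mult_right_mono) auto
      finally show ?thesis .
    qed
    have se': "supereigen \<kappa> u t"
      using \<kappa> u right by (simp add: supereigen_def)
    obtain l where lse: "left_supereigen \<kappa> l t"
      using left_supereigen_exists[OF se s] by (elim exE)
    then have l: "\<And>v. v \<in> V \<Longrightarrow> l v > 0"
      and left: "\<And>w. w \<in> V \<Longrightarrow> (\<Sum>v\<in>{v\<in>V. E v w}. l v * \<kappa> (lab v)) \<le> t * l w"
      by (simp_all add: left_supereigen_def)
    define \<pi> where "\<pi> v = l v * u v" for v
    define q where "q v w = l v * \<kappa> (lab v) * u w / t" for v w
    have c_le: "c * \<pi> v' \<le> q v w" if "v \<in> V" "w \<in> succs v" "v' \<in> V" for v w v'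
      unfolding \<pi>_def q_def using c(2) t tT se' lse that by blast
    interpret weighted_graph G V E lab \<pi> q
    proof
      fix v assume v: "v \<in> V"
      show "\<pi> v > 0" using l[OF v] u[OF v] by (simp add: \<pi>_def)
      show "q v w \<ge> 0" if "w \<in> succs v" for w
        using l[OF v] u[OF succs_V[OF that]] \<kappa> lab_closed[OF v] t by (simp add: q_def character_def less_imp_le)
      have "(\<Sum>w\<in>succs v. q v w) = l v * (\<Sum>w\<in>succs v. \<kappa> (lab v) * u w) / t"
        by (simp add: q_def sum_distrib_left sum_divide_distrib mult.assoc)
      also have "\<dots> \<le> l v * (t * u v) / t"
        using l[OF v] t by (intro divide_right_mono mult_left_mono right v) auto
      finally show "(\<Sum>w\<in>succs v. q v w) \<le> \<pi> v" using t by (simp add: \<pi>_def)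
    next
      fix w assume w: "w \<in> V"
      have "(\<Sum>v\<in>{v \<in> V. E v w}. q v w) = (\<Sum>v\<in>{v\<in>V. E v w}. l v * \<kappa> (lab v)) * u w / t"
        by (simp add: q_def sum_distrib_right sum_divide_distrib)
      also have "\<dots> \<le> t * l w * u w / t"
        using u[OF w] t by (intro divide_right_mono mult_right_mono left w) auto
      finally show "(\<Sum>v\<in>{v \<in> V. E v w}. q v w) \<le> \<pi> w" using t by (simp add: \<pi>_def)
    qed
    \<comment> \<open>A Doob transform: the normalising factors telescope along a path, so all paths
      between two given points carry the same weight and the walk counts them.\<close>
    have walk: "walk v0 n v g = real (npaths n v v0 (inv g)) * \<kappa> (inv g) * u v0 / (t ^ n * u v)"
      if "v \<in> V" "g \<in> carrier G" for n v g
      using that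
    proof (induction n arbitrary: v g)
      case 0
      then have "inv g = \<one> \<longleftrightarrow> g = \<one>" by (simp add: inv_eq_1_iff)
      then show ?case
        using 0 u[OF v0] character_one[OF \<kappa>] by (simp add: delta_def)
    next
      case (Suc n)
      have lv: "lab v \<in> carrier G" "g \<otimes> lab v \<in> carrier G" using Suc.prems lab_closed by auto
      have gi: "inv (g \<otimes> lab v) = inv (lab v) \<otimes> inv g"
        using Suc.prems lv by (simp add: inv_mult_group)
      have \<kappa>g: "\<kappa> (lab v) * \<kappa> (inv (lab v) \<otimes> inv g) = \<kappa> (inv g)"
      proof -
        have "\<kappa> (lab v) * \<kappa> (inv (lab v) \<otimes> inv g) = \<kappa> (lab v \<otimes> (inv (lab v) \<otimes> inv g))"
          using \<kappa> lv Suc.prems by (simp add: character_def del: inv_mult_group)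
        then show ?thesis using lv Suc.prems by (simp add: mult_inv_cancel_left)
      qed
      have "walk v0 (Suc n) v g = (\<Sum>w\<in>succs v. real (npaths n w v0 (inv (lab v) \<otimes> inv g)) *
          (\<kappa> (lab v) * \<kappa> (inv (lab v) \<otimes> inv g)) * u v0 / (t ^ Suc n * u v))"
        unfolding walk.simps
      proof (intro sum.cong refl)
        fix w assume w: "w \<in> succs v"
        have "q v w / \<pi> v = \<kappa> (lab v) * u w / (t * u v)"
          using l[OF Suc.prems(1)] by (simp add: q_def \<pi>_def)
        then show "q v w / \<pi> v * walk v0 n w (g \<otimes> lab v) = real (npaths n w v0 (inv (lab v) \<otimes> inv g)) *
          (\<kappa> (lab v) * \<kappa> (inv (lab v) \<otimes> inv g)) * u v0 / (t ^ Suc n * u v)"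
          unfolding Suc.IH[OF succs_V[OF w] lv(2)] gi using u[OF succs_V[OF w]] by (simp add: mult_ac)
      qed
      then show ?case
        unfolding \<kappa>g npaths.simps by (simp add: sum_distrib_right sum_divide_distrib)
    qed
    have coerc: "4 * \<eta> * wnorm f \<le> wenergy f" if f: "finsupp_family f" for f
    proof -
      define P where "P = (\<Sum>v\<in>V. \<pi> v)"
      have P: "P \<ge> 0" unfolding P_def by (intro sum_nonneg) (simp add: pi_pos less_imp_le)
      have "\<pi> v \<le> P" if "v \<in> V" for v
        unfolding P_def using that finite_V by (intro member_le_sum) (auto simp: pi_pos less_imp_le)
      then have "wnorm f \<le> (\<Sum>v\<in>V. P * sqnorm f v)"
        unfolding wnorm_def by (intro sum_mono mult_right_mono sqnorm_nonneg)
      then have wn: "wnorm f \<le> P * (\<Sum>v\<in>V. sqnorm f v)"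
        by (simp add: sum_distrib_left)
      have qP: "c * P / k \<le> q v w" if "v \<in> V" "w \<in> succs v" for v w
      proof -
        have "c * P = (\<Sum>v'\<in>V. c * \<pi> v')" by (simp add: P_def sum_distrib_left)
        also have "\<dots> \<le> (\<Sum>v'\<in>V. q v w)" by (intro sum_mono c_le that)
        finally show ?thesis using k by (simp add: k_def pos_divide_le_eq mult.commute)
      qed
      have "4 * \<eta> * wnorm f \<le> c * \<theta> / k * wnorm f"
        using \<eta>_le by (intro mult_right_mono) (auto simp: wnorm_def pi_pos less_imp_le sqnorm_nonneg intro!: sum_nonneg)
      also have "\<dots> \<le> c * \<theta> / k * (P * (\<Sum>v\<in>V. sqnorm f v))"
        using wn c(1) \<theta>(1) k by (intro mult_left_mono) auto
      also have "\<dots> = c * P / k * (\<theta> * (\<Sum>v\<in>V. sqnorm f v))"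
        by simp
      also have "\<dots> \<le> c * P / k * energy f"
        using \<theta>(2)[OF f] c(1) P k by (intro mult_left_mono) auto
      also have "\<dots> = (\<Sum>v\<in>V. \<Sum>w\<in>succs v. c * P / k * sqdist f v w (lab v))"
        by (simp only: energy_def sum_distrib_left)
      also have "\<dots> \<le> wenergy f"
        unfolding wenergy_def by (intro sum_mono mult_right_mono qP sqdist_nonneg)
      finally show ?thesis .
    qed
    have "real (npaths m v0 v0 \<one>) / t ^ m = walk v0 m v0 \<one>"
      using walk[OF v0 one_closed, of m] u[OF v0] character_one[OF \<kappa>] by simp
    also have "\<dots> \<le> 2 * real m * (1 - \<eta>) ^ m"
      by (rule walk_return_le[OF v0 _ coerc m]) (use \<eta> in auto)
    finally show ?thesis
      using t by (simp add: pos_divide_le_eq power_mult_distrib mult_ac)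
  qed
  with \<eta> show ?thesis by blast
qed

end

section \<open>Exponential growth rates\<close>

definition growth_rate :: "(nat \<Rightarrow> nat) \<Rightarrow> ereal" where
  "growth_rate c = limsup (\<lambda>n. if c n = 0 then -\<infinity> else ereal (ln (real (c n)) / real n))"

lemma growth_rate_lessD:
  assumes "growth_rate c < ereal r"
  shows "\<exists>C. \<forall>n. real (c n) \<le> C * exp r ^ n"
proof -
  have "\<forall>\<^sub>F n in sequentially. (if c n = 0 then -\<infinity> else ereal (ln (real (c n)) / real n)) < ereal r"
    using assms unfolding growth_rate_def by (rule Limsup_lessD)
  then obtain N where N: "\<And>n. n \<ge> N \<Longrightarrow> (if c n = 0 then -\<infinity> else ereal (ln (real (c n)) / real n)) < ereal r"
    unfolding eventually_sequentially by blast
  \<comment> \<open>The sum takes care of the indices up to \<open>N\<close>, the 1 of all later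
    ones.\<close>
  define C where "C = 1 + (\<Sum>i\<le>N. real (c i) / exp r ^ i)"
  have "C \<ge> 1" unfolding C_def by (simp add: sum_nonneg)
  have "real (c n) \<le> C * exp r ^ n" for n
  proof (cases "n \<le> N")
    case True
    have "real (c n) / exp r ^ n \<le> (\<Sum>i\<le>N. real (c i) / exp r ^ i)"
      using True by (intro member_le_sum[of n _ "\<lambda>i. real (c i) / exp r ^ i"]) auto
    also have "\<dots> \<le> C" by (simp add: C_def)
    finally show ?thesis by (simp add: pos_divide_le_eq)
  next
    case False
    show ?thesis
    proof (cases "c n = 0")
      case True
      then show ?thesis using \<open>C \<ge> 1\<close> by simp
    next
      case nz: False
      have "n > 0" using False by simp
      have "ln (real (c n)) / real n < r"
        using N[of n] False nz by simp
      then have "ln (real (c n)) \<le> real n * r"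
        using \<open>n > 0\<close> by (simp add: pos_divide_less_eq mult.commute less_imp_le)
      then have "exp (ln (real (c n))) \<le> exp (real n * r)" by simp
      then have "real (c n) \<le> 1 * exp r ^ n"
        using nz by (simp add: exp_of_nat_mult)
      also have "\<dots> \<le> C * exp r ^ n"
        using \<open>C \<ge> 1\<close> by (intro mult_right_mono) auto
      finally show ?thesis .
    qed
  qed
  then show ?thesis by blast
qed

text \<open>The factor \<open>n\<close> is tolerated because \<open>ln n / n\<close> tends to 0; it
  absorbs the polynomial loss of \<open>walk_return_le\<close>.\<close>

lemma growth_rate_le:
  assumes "C > 0" and le: "\<And>n. n > 0 \<Longrightarrow> real (c n) \<le> C * real n * exp r ^ n"
  shows "growth_rate c \<le> ereal r"
proof -
  define b where "b n = ln C / real n + ln (real n) / real n + r" for n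
  have "growth_rate c \<le> limsup (\<lambda>n. ereal (b n))"
    unfolding growth_rate_def
  proof (rule Limsup_mono)
    show "\<forall>\<^sub>F n in sequentially. (if c n = 0 then -\<infinity> else ereal (ln (real (c n)) / real n)) \<le> ereal (b n)"
    proof (rule eventually_mono[OF eventually_gt_at_top[of 0]])
      fix n :: nat assume n: "n > 0"
      show "(if c n = 0 then -\<infinity> else ereal (ln (real (c n)) / real n)) \<le> ereal (b n)"
      proof (cases "c n = 0")
        case nz: False
        have "ln (real (c n)) \<le> ln (C * real n * exp r ^ n)"
          using le[OF n] nz by (intro ln_mono) auto
        also have "\<dots> = ln C + ln (real n) + real n * r"
          using assms(1) n by (simp add: ln_mult ln_realpow)
        finally have "ln (real (c n)) / real n \<le> (ln C + ln (real n) + real n * r) / real n"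
          by (intro divide_right_mono) auto
        also have "\<dots> = b n"
          using n by (simp add: b_def add_divide_distrib)
        finally show ?thesis using nz by simp
      qed simp
    qed
  qed
  also have "\<dots> = ereal r"
  proof (rule lim_imp_Limsup)
    have "(\<lambda>n. ln C / real n) \<longlonglongrightarrow> 0"
      by (rule lim_const_over_n)
    moreover have "(\<lambda>n. ln (real n) / real n) \<longlonglongrightarrow> 0"
      by (rule lim_ln_over_n)
    ultimately have "b \<longlonglongrightarrow> 0 + 0 + r"
      unfolding b_def by (intro tendsto_intros)
    then show "(\<lambda>n. ereal (b n)) \<longlonglongrightarrow> ereal r" by simp
  qed simp
  finally show ?thesis .
qed

text \<open>The value -1 is arbitrary and serves to exclude minus infinity: a smaller rate would
  push a positive integer below 1.\<close>

lemma growth_rate_ge: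
  assumes "d > 0" and ge: "\<And>j. c (Suc j * d) > 0"
  shows "growth_rate c \<ge> ereal (- 1)"
proof (rule ccontr)
  assume "\<not> growth_rate c \<ge> ereal (- 1)"
  then have "growth_rate c < ereal (- 1)" by simp
  then obtain C where C: "\<And>n. real (c n) \<le> C * exp (- 1) ^ n"
    using growth_rate_lessD[of c "- 1"] by auto
  have "C > 0"
  proof (rule ccontr)
    assume "\<not> C > 0"
    then have "C * exp (- 1) ^ (Suc 0 * d) \<le> 0"
      by (simp add: mult_nonpos_nonneg)
    with C[of "Suc 0 * d"] ge[of 0] show False by simp
  qed
  obtain j where j: "exp (- 1) ^ j < 1 / C"
    using real_arch_pow_inv[of "1 / C" "exp (- 1)"] \<open>C > 0\<close> by auto
  have "j \<le> Suc j * d" using \<open>d > 0\<close> by (cases d) auto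
  then have "exp (- 1 :: real) ^ (Suc j * d) \<le> exp (- 1) ^ j"
    by (intro power_decreasing) auto
  then have "C * exp (- 1) ^ (Suc j * d) \<le> C * exp (- 1) ^ j"
    using \<open>C > 0\<close> by (intro mult_left_mono) auto
  also have "\<dots> < C * (1 / C)"
    using j \<open>C > 0\<close> by (intro mult_strict_left_mono)
  also have "\<dots> = 1"
    using \<open>C > 0\<close> by simp
  finally have "C * exp (- 1) ^ (Suc j * d) < 1" .
  with C[of "Suc j * d"] ge[of j] show False by linarith
qed

section \<open>Words of the subshift as a labelled graph\<close>

lemma funpow_shift: "(shift ^^ n) x = (\<lambda>i. x (i + n))"
proof (induction n)
  case (Suc n)
  show ?case
    unfolding funpow.simps comp_apply Suc by (simp add: shift_def)
qed simp

lemma sft_funpow_shift: "x \<in> sft A \<Longrightarrow> (shift ^^ n) x \<in> sft A"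
  by (simp add: funpow_shift sft_def)

lemma sft_shift: "x \<in> sft A \<Longrightarrow> shift x \<in> sft A"
  by (simp add: shift_def sft_def)

definition word :: "nat \<Rightarrow> (nat \<Rightarrow> 'a) \<Rightarrow> 'a list" where
  "word k x = map x [0..<k]"

lemma word_eq_iff: "word k x = word k y \<longleftrightarrow> (\<forall>i<k. x i = y i)"
  by (auto simp: word_def)

definition words :: "('a \<Rightarrow> 'a \<Rightarrow> bool) \<Rightarrow> nat \<Rightarrow> 'a list set" where
  "words A k = word k ` sft A"

definition word_edge :: "('a \<Rightarrow> 'a \<Rightarrow> bool) \<Rightarrow> nat \<Rightarrow> 'a list \<Rightarrow> 'a list \<Rightarrow> bool" where
  "word_edge A k v w \<longleftrightarrow> (\<exists>x\<in>sft A. v = word k x \<and> w = word k (shift x))"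

text \<open>Any point with the given initial word would do when \<open>psi\<close> is determined by
  the first \<open>k\<close> symbols; \<open>word_label_word\<close> records this.\<close>

definition word_label :: "('a \<Rightarrow> 'a \<Rightarrow> bool) \<Rightarrow> nat \<Rightarrow> ((nat \<Rightarrow> 'a) \<Rightarrow> 'g) \<Rightarrow> 'a list \<Rightarrow> 'g" where
  "word_label A k psi v = psi (SOME x. x \<in> sft A \<and> word k x = v)"

lemma word_label_representative:
  "v \<in> words A k \<Longrightarrow> \<exists>x\<in>sft A. word k x = v \<and> word_label A k psi v = psi x"
proof -
  assume "v \<in> words A k"
  then have "\<exists>x. x \<in> sft A \<and> word k x = v" by (auto simp: words_def)
  from someI_ex[OF this] show ?thesis
    unfolding word_label_def by (intro bexI[of _ "SOME x. x \<in> sft A \<and> word k x = v"]) simp_all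
qed

lemma finite_words: "finite (words (A :: 'a::finite \<Rightarrow> 'a \<Rightarrow> bool) k)"
proof (rule finite_subset)
  show "words A k \<subseteq> {xs. set xs \<subseteq> UNIV \<and> length xs = k}"
    by (auto simp: words_def word_def)
qed (rule finite_lists_length_eq[OF finite])

section \<open>Points of the subshift as paths\<close>

locale skew_product = group G for G (structure) +
  fixes A :: "'s::finite \<Rightarrow> 's \<Rightarrow> bool" and psi :: "(nat \<Rightarrow> 's) \<Rightarrow> 'a" and k :: nat
  assumes sft_nonempty: "sft A \<noteq> {}"
    and k_pos: "k > 0"
    and psi_closed: "x \<in> sft A \<Longrightarrow> psi x \<in> carrier G"
    and psi_word: "x \<in> sft A \<Longrightarrow> y \<in> sft A \<Longrightarrow> word k x = word k y \<Longrightarrow> psi x = psi y"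
    and skew_transitive: "skew_transitive G (sft A) psi"
begin

sublocale labelled_graph G "words A k" "word_edge A k" "word_label A k psi"
proof
  show "finite (words A k)" by (rule finite_words)
next
  fix v assume "v \<in> words A k"
  then show "word_label A k psi v \<in> carrier G"
    using word_label_representative[of v A k psi] psi_closed by auto
qed

lemma word_label_word:
  assumes "x \<in> sft A"
  shows "word_label A k psi (word k x) = psi x"
proof -
  have "word k x \<in> words A k" using assms by (simp add: words_def)
  then obtain y where "y \<in> sft A" "word k y = word k x" "word_label A k psi (word k x) = psi y"
    using word_label_representative by blast
  with psi_word[OF \<open>y \<in> sft A\<close> assms] show ?thesis by simp
qed

lemma cocycle_closed: "x \<in> sft A \<Longrightarrow> cocycle G psi n x \<in> carrier G"
  by (induction n) (auto simp: psi_closed sft_funpow_shift)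

text \<open>\<open>cocycle\<close> splits off the last factor, whereas \<open>npaths\<close> splits
  off the first edge; this reconciles the two recursions.\<close>

lemma cocycle_Suc_shift: "x \<in> sft A \<Longrightarrow> cocycle G psi (Suc n) x = psi x \<otimes> cocycle G psi n (shift x)"
proof (induction n)
  case 0
  then show ?case by (simp add: psi_closed)
next
  case (Suc n)
  have "psi x \<in> carrier G" "cocycle G psi n (shift x) \<in> carrier G" "psi ((shift ^^ n) (shift x)) \<in> carrier G"
    using Suc.prems by (simp_all add: psi_closed cocycle_closed sft_shift sft_funpow_shift)
  moreover have "(shift ^^ Suc n) x = (shift ^^ n) (shift x)"
    by (simp add: funpow_swap1)
  ultimately show ?case
    using Suc.IH[OF Suc.prems] by (simp only: cocycle.simps(2)[of G psi "Suc n" x] cocycle.simps(2)[of G psi n "shift x"] m_assoc)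
qed

lemma cocycle_cong:
  assumes "x \<in> sft A" "y \<in> sft A" "\<And>i. i < n + k \<Longrightarrow> x i = y i"
  shows "cocycle G psi n x = cocycle G psi n y"
  using assms(3)
proof (induction n)
  case (Suc n)
  have "psi ((shift ^^ n) x) = psi ((shift ^^ n) y)"
    using Suc.prems assms(1,2)
    by (intro psi_word sft_funpow_shift) (auto simp: word_eq_iff funpow_shift)
  with Suc show ?case by simp
qed simp

text \<open>Fixing the tail \<open>z\<close> turns paths into points: a path of length
  \<open>n\<close> ending in \<open>word k z\<close> corresponds to exactly one such preimage of
  \<open>z\<close>.\<close>

definition arrivals :: "nat \<Rightarrow> 's list \<Rightarrow> (nat \<Rightarrow> 's) \<Rightarrow> 'a \<Rightarrow> (nat \<Rightarrow> 's) set" where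
  "arrivals n v z g = {x \<in> sft A. (shift ^^ n) x = z \<and> word k x = v \<and> cocycle G psi n x = g}"

text \<open>\<open>shift\<close> maps these preimages bijectively onto a disjoint union over the
  successors of \<open>v\<close>. The symbol it forgets is the first letter of \<open>v\<close>,
  available since \<open>k > 0\<close>.\<close>

lemma card_arrivals:
  assumes z: "z \<in> sft A" and "v \<in> words A k" "g \<in> carrier G"
  shows "finite (arrivals n v z g) \<and> card (arrivals n v z g) = npaths n v (word k z) g"
  using assms(2,3)
proof (induction n arbitrary: v g)
  case 0
  have "arrivals 0 v z g = (if v = word k z \<and> g = \<one> then {z} else {})"
    using z by (auto simp: arrivals_def)
  then show ?case by simp
next
  case (Suc n)
  let ?h = "inv (word_label A k psi v) \<otimes> g"
  have lv: "word_label A k psi v \<in> carrier G" by (rule lab_closed[OF Suc.prems(1)])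
  have h: "?h \<in> carrier G" using lv Suc.prems by simp
  have "bij_betw shift (arrivals (Suc n) v z g) (\<Union>v'\<in>succs v. arrivals n v' z ?h)"
    unfolding bij_betw_def
  proof
    show "inj_on shift (arrivals (Suc n) v z g)"
    proof (rule inj_onI)
      fix x y assume x: "x \<in> arrivals (Suc n) v z g" and y: "y \<in> arrivals (Suc n) v z g" and s: "shift x = shift y"
      have "word k x = word k y" using x y by (simp add: arrivals_def)
      then have "x 0 = y 0" using k_pos by (simp add: word_eq_iff)
      moreover have "x (Suc i) = y (Suc i)" for i using fun_cong[OF s, of i] by (simp add: shift_def)
      ultimately show "x = y" by (metis ext not0_implies_Suc)
    qed
    show "shift ` arrivals (Suc n) v z g = (\<Union>v'\<in>succs v. arrivals n v' z ?h)"
    proof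
      show "shift ` arrivals (Suc n) v z g \<subseteq> (\<Union>v'\<in>succs v. arrivals n v' z ?h)"
      proof
        fix y assume "y \<in> shift ` arrivals (Suc n) v z g"
        then obtain x where x: "x \<in> sft A" "(shift ^^ Suc n) x = z" "word k x = v" "cocycle G psi (Suc n) x = g"
          and y: "y = shift x" by (auto simp: arrivals_def)
        have yS: "y \<in> sft A" using x(1) y by (simp add: sft_shift)
        have "word k y \<in> succs v"
        proof -
          have "word k y \<in> words A k" using yS by (simp add: words_def)
          moreover have "word_edge A k v (word k y)" using x y by (auto simp: word_edge_def)
          ultimately show ?thesis by (simp add: succs_def)
        qed
        moreover have "(shift ^^ n) y = z"
          using x(2) y by (simp add: funpow_swap1)
        moreover have "cocycle G psi n y = ?h"
        proof -
          have "g = word_label A k psi v \<otimes> cocycle G psi n y"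
            using x cocycle_Suc_shift[OF x(1), of n] word_label_word[OF x(1)] y by simp
          then show ?thesis
            using lv cocycle_closed[OF yS, of n] by (simp add: m_assoc[symmetric])
        qed
        ultimately show "y \<in> (\<Union>v'\<in>succs v. arrivals n v' z ?h)"
          using yS by (auto simp: arrivals_def)
      qed
      show "(\<Union>v'\<in>succs v. arrivals n v' z ?h) \<subseteq> shift ` arrivals (Suc n) v z g"
      proof
        fix y assume "y \<in> (\<Union>v'\<in>succs v. arrivals n v' z ?h)"
        then have yS: "y \<in> sft A" and yz: "(shift ^^ n) y = z" and yv: "word k y \<in> succs v"
          and yc: "cocycle G psi n y = ?h" by (auto simp: arrivals_def)
        obtain x' where x': "x' \<in> sft A" "v = word k x'" "word k y = word k (shift x')"
          using yv by (auto simp: succs_def word_edge_def)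
        have y_eq: "y i = x' (Suc i)" if "i < k" for i
          using x'(3) that by (simp add: word_eq_iff shift_def)
        \<comment> \<open>\<open>A\<close> restricts neighbouring symbols only, so prepending
          creates one new transition, and the edge from \<open>v\<close> guarantees it.\<close>
        define x where "x = (\<lambda>i. case i of 0 \<Rightarrow> x' 0 | Suc j \<Rightarrow> y j)"
        have sx: "shift x = y" by (simp add: x_def shift_def)
        have "A (x' 0) (x' (Suc 0))" using x'(1) by (simp add: sft_def)
        then have "A (x' 0) (y 0)" using y_eq[OF k_pos] by simp
        then have xS: "x \<in> sft A"
          using yS by (auto simp: sft_def x_def split: nat.split)
        have wx: "word k x = v"
          unfolding x'(2) word_eq_iff using y_eq by (auto simp: x_def split: nat.split)
        have "cocycle G psi (Suc n) x = word_label A k psi v \<otimes> ?h"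
          using cocycle_Suc_shift[OF xS, of n] word_label_word[OF xS] wx sx yc by simp
        also have "\<dots> = g" using lv Suc.prems by (simp add: mult_inv_cancel_left)
        finally have "cocycle G psi (Suc n) x = g" .
        moreover have "(shift ^^ Suc n) x = z" using yz sx by (simp add: funpow_swap1)
        ultimately have "x \<in> arrivals (Suc n) v z g" using xS wx by (simp add: arrivals_def)
        then show "y \<in> shift ` arrivals (Suc n) v z g" using sx by blast
      qed
    qed
  qed
  then have b: "finite (arrivals (Suc n) v z g) = finite (\<Union>v'\<in>succs v. arrivals n v' z ?h)"
    "card (arrivals (Suc n) v z g) = card (\<Union>v'\<in>succs v. arrivals n v' z ?h)"
    by (rule bij_betw_finite, rule bij_betw_same_card)
  have IH: "finite (arrivals n v' z ?h)" "card (arrivals n v' z ?h) = npaths n v' (word k z) ?h" if "v' \<in> succs v" for v'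
    using Suc.IH[OF succs_V[OF that] h] by auto
  have "card (\<Union>v'\<in>succs v. arrivals n v' z ?h) = (\<Sum>v'\<in>succs v. card (arrivals n v' z ?h))"
    using IH(1) finite_succs by (intro card_UN_disjoint) (auto simp: arrivals_def)
  with b IH finite_succs show ?case by simp
qed

sublocale transitive_labelled_graph G "words A k" "word_edge A k" "word_label A k psi"
proof
  show "words A k \<noteq> {}" using sft_nonempty by (simp add: words_def)
next
  fix v w g assume v: "v \<in> words A k" and w: "w \<in> words A k" and g: "g \<in> carrier G"
  obtain x y where x: "x \<in> sft A" "v = word k x" and y: "y \<in> sft A" "w = word k y"
    using v w by (auto simp: words_def)
  obtain n z where n: "n > 0" and z: "z \<in> sft A" "\<forall>i<k. z i = x i" "\<forall>i<k. (shift ^^ n) z i = y i"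
    "\<one> \<otimes> cocycle G psi n z = g"
    using skew_transitive[unfolded skew_transitive_def, rule_format, OF x(1) y(1) one_closed g, of k] by blast
  have "z \<in> arrivals n v ((shift ^^ n) z) g"
    using z x cocycle_closed[OF z(1)] by (simp add: arrivals_def word_eq_iff)
  moreover have "word k ((shift ^^ n) z) = w"
    using z(3) y by (simp add: word_eq_iff)
  ultimately have "npaths n v w g > 0"
    using card_arrivals[OF sft_funpow_shift[OF z(1), of n] v g, of n]
    by (metis card_gt_0_iff empty_iff)
  with n show "\<exists>n>0. npaths n v w g > 0" by blast
qed

text \<open>A periodic point is its first \<open>n\<close> symbols repeated. Replacing all later
  periods by \<open>z\<close>, which also begins with \<open>v\<close>, keeps the first
  \<open>n + k\<close> symbols and therefore the cocycle; this reduces the count to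
  \<open>card_arrivals\<close>.\<close>

lemma card_periodic_word:
  assumes n: "n > 0" and v: "v \<in> words A k" and g: "g \<in> carrier G"
  defines "P \<equiv> {x \<in> sft A. (shift ^^ n) x = x \<and> word k x = v \<and> cocycle G psi n x = g}"
  shows "finite P \<and> card P = npaths n v v g"
proof -
  obtain z where z: "z \<in> sft A" "word k z = v" using v by (auto simp: words_def)
  define spl where "spl x = (\<lambda>i. if i < n then x i else z (i - n))" for x
  define per where "per y = (\<lambda>i. y (i mod n))" for y :: "nat \<Rightarrow> 's"
  have P_props: "x (i + n) = x i" if "x \<in> P" for x i
  proof -
    have "(shift ^^ n) x = x" using that by (simp add: P_def)
    then have "(\<lambda>i. x (i + n)) = x" by (simp only: funpow_shift)
    from fun_cong[OF this, of i] show ?thesis .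
  qed
  have P_mod: "x (i mod n) = x i" if x: "x \<in> P" for x i
  proof (induction i rule: less_induct)
    case (less i)
    show ?case
    proof (cases "i < n")
      case False
      then have "x (i mod n) = x ((i - n) mod n)" by (simp add: le_mod_geq)
      also have "\<dots> = x (i - n)" using less False n by simp
      also have "\<dots> = x i" using P_props[OF x, of "i - n"] False by simp
      finally show ?thesis .
    qed simp
  qed
  have spl_agree: "spl x i = x i" if x: "x \<in> P" and i: "i < n + k" for x i
  proof (cases "i < n")
    case False
    have "word k x = word k z" using x z by (simp add: P_def)
    then have "z (i - n) = x (i - n)" using i False by (simp add: word_eq_iff)
    also have "\<dots> = x i" using P_props[OF x, of "i - n"] False by simp
    finally show ?thesis using False by (simp add: spl_def)
  qed (simp add: spl_def)
  have spl_mem: "spl x \<in> arrivals n v z g" if x: "x \<in> P" for x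
  proof -
    have xS: "x \<in> sft A" using x by (simp add: P_def)
    have "A (spl x i) (spl x (Suc i))" for i
    proof (cases "i < n")
      case True
      then have "spl x i = x i" "spl x (Suc i) = x (Suc i)"
        using spl_agree[OF x, of i] spl_agree[OF x, of "Suc i"] k_pos by auto
      then show ?thesis using xS by (simp add: sft_def)
    next
      case False
      then show ?thesis using z(1) by (simp add: spl_def sft_def Suc_diff_le)
    qed
    then have sS: "spl x \<in> sft A" by (simp add: sft_def)
    moreover have "(shift ^^ n) (spl x) = z" by (simp add: funpow_shift spl_def)
    moreover have "word k (spl x) = word k x"
      unfolding word_eq_iff using spl_agree[OF x] by simp
    then have "word k (spl x) = v"
      using x by (simp add: P_def)
    moreover have "cocycle G psi n (spl x) = g"
      using cocycle_cong[OF sS xS, of n] spl_agree[OF x] x by (simp add: P_def)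
    ultimately show ?thesis by (simp add: arrivals_def)
  qed
  have per_mem: "per y \<in> P" and per_spl: "spl (per y) = y" if y: "y \<in> arrivals n v z g" for y
  proof -
    have yS: "y \<in> sft A" and yz: "(shift ^^ n) y = z" and yv: "word k y = v" and yc: "cocycle G psi n y = g"
      using y by (auto simp: arrivals_def)
    have y_tail: "y (i + n) = z i" for i using fun_cong[OF yz, of i] by (simp add: funpow_shift)
    have y_head: "z i = y i" if "i < k" for i using yv z(2) that by (metis word_eq_iff)
    have agree: "y i = per y i" if "i < n + k" for i
      using that
    proof (induction i rule: less_induct)
      case (less i)
      show ?case
      proof (cases "i < n")
        case False
        then have "y i = y (i - n)" using y_tail[of "i - n"] y_head[of "i - n"] less.prems by simp
        also have "\<dots> = per y (i - n)" using less False n by simp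
        also have "\<dots> = per y i" using False by (simp add: per_def le_mod_geq)
        finally show ?thesis .
      qed (simp add: per_def)
    qed
    have "A (per y i) (per y (Suc i))" for i
    proof (cases "Suc (i mod n) = n")
      case True
      have "A (y (i mod n)) (y n)" using yS True unfolding sft_def by (metis mem_Collect_eq)
      \<comment> \<open>The seam between two periods: the tail \<open>z\<close> begins with the same
        word as \<open>y\<close>.\<close>
      moreover have "y n = y 0" using y_tail[of 0] y_head[OF k_pos] by simp
      ultimately show ?thesis using True by (simp add: per_def mod_Suc)
    next
      case False
      then show ?thesis using yS by (simp add: per_def mod_Suc sft_def)
    qed
    then have pS: "per y \<in> sft A" by (simp add: sft_def)
    moreover have "(shift ^^ n) (per y) = per y" by (simp add: funpow_shift per_def)
    moreover have "word k y = word k (per y)"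
      unfolding word_eq_iff using agree by simp
    then have "word k (per y) = v"
      using yv by simp
    moreover have "cocycle G psi n (per y) = g"
      using cocycle_cong[OF yS pS, of n] agree yc by simp
    ultimately show "per y \<in> P" by (simp add: P_def)
    show "spl (per y) = y"
    proof
      fix i show "spl (per y) i = y i"
        using y_tail[of "i - n"] by (cases "i < n") (simp_all add: spl_def per_def)
    qed
  qed
  have spl_per: "per (spl x) = x" if x: "x \<in> P" for x
  proof
    fix i show "per (spl x) i = x i"
      using P_mod[OF x, of i] n by (simp add: per_def spl_def)
  qed
  have "bij_betw spl P (arrivals n v z g)"
    by (rule bij_betw_byWitness[where f' = per]) (use spl_mem per_mem per_spl spl_per in auto)
  then show ?thesis
    using card_arrivals[OF z(1) v g, of n] z(2) by (simp add: bij_betw_finite bij_betw_same_card)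
qed

definition returns :: "nat \<Rightarrow> nat" where
  "returns n = card {x \<in> sft A. (shift ^^ n) x = x \<and> cocycle G psi n x = \<one>}"

lemma gurevic_eq_growth_rate: "gurevic_entropy G (sft A) psi = growth_rate returns"
  unfolding gurevic_entropy_def growth_rate_def returns_def Let_def ..

lemma returns_eq_sum:
  assumes "n > 0"
  shows "returns n = (\<Sum>v\<in>words A k. npaths n v v \<one>)"
proof -
  let ?P = "\<lambda>v. {x \<in> sft A. (shift ^^ n) x = x \<and> word k x = v \<and> cocycle G psi n x = \<one>}"
  have "{x \<in> sft A. (shift ^^ n) x = x \<and> cocycle G psi n x = \<one>} = (\<Union>v\<in>words A k. ?P v)"
    by (auto simp: words_def)
  then have "returns n = card (\<Union>v\<in>words A k. ?P v)" by (simp only: returns_def)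
  also have "\<dots> = (\<Sum>v\<in>words A k. card (?P v))"
    using card_periodic_word[OF assms _ one_closed] finite_V by (intro card_UN_disjoint) auto
  finally show ?thesis
    using card_periodic_word[OF assms _ one_closed] by simp
qed

lemma gurevic_lessD:
  assumes "gurevic_entropy G (sft A) psi < ereal r"
  shows "\<exists>C. \<forall>n. \<forall>v\<in>words A k. real (npaths n v v \<one>) \<le> C * exp r ^ n"
proof -
  obtain C where C: "\<And>n. real (returns n) \<le> C * exp r ^ n"
    using growth_rate_lessD[OF assms[unfolded gurevic_eq_growth_rate]] by blast
  \<comment> \<open>The maximum covers \<open>n = 0\<close>, where the path count is 1 and
    \<open>returns_eq_sum\<close> does not apply.\<close>
  have "real (npaths n v v \<one>) \<le> max C 1 * exp r ^ n" if v: "v \<in> words A k" for n v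
  proof (cases "n = 0")
    case False
    then have n: "n > 0" by simp
    have "npaths n v v \<one> \<le> returns n"
      unfolding returns_eq_sum[OF n] using v finite_V
      by (intro member_le_sum[of v _ "\<lambda>v. npaths n v v \<one>"]) auto
    then have "real (npaths n v v \<one>) \<le> C * exp r ^ n"
      using C[of n] by linarith
    also have "\<dots> \<le> max C 1 * exp r ^ n" by (intro mult_right_mono) auto
    finally show ?thesis .
  qed simp
  then show ?thesis by blast
qed

lemma gurevic_le:
  assumes "C > 0" and le: "\<And>n v. n > 0 \<Longrightarrow> v \<in> words A k \<Longrightarrow> real (npaths n v v \<one>) \<le> C * real n * exp r ^ n"
  shows "gurevic_entropy G (sft A) psi \<le> ereal r"
  unfolding gurevic_eq_growth_rate
proof (rule growth_rate_le)
  have "card (words A k) > 0" using finite_V nonempty_V by (simp add: card_gt_0_iff)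
  then show "real (card (words A k)) * C > 0" using assms(1) by simp
  fix n :: nat assume n: "n > 0"
  have "real (returns n) = (\<Sum>v\<in>words A k. real (npaths n v v \<one>))"
    by (simp add: returns_eq_sum[OF n])
  also have "\<dots> \<le> (\<Sum>v\<in>words A k. C * real n * exp r ^ n)"
    by (intro sum_mono le n)
  finally show "real (returns n) \<le> real (card (words A k)) * C * real n * exp r ^ n"
    by (simp add: mult.assoc)
qed

text \<open>The final contradiction subtracts a positive number from the entropy, which is
  conclusive only for a real value. The lower bound comes from repeating one closed path.\<close>

lemma gurevic_finite: "\<exists>r. gurevic_entropy G (sft A) psi = ereal r"
proof -
  have card: "card (words A k) > 0" using finite_V nonempty_V by (simp add: card_gt_0_iff)
  have "gurevic_entropy G (sft A) psi \<le> ereal (ln (real (card (words A k))))"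
  proof (rule gurevic_le[of 1])
    fix n :: nat and v assume n: "n > 0"
    have "real (npaths n v v \<one>) \<le> 1 * real (card (words A k)) ^ n"
      using npaths_le[of n v v \<one>] by (simp flip: of_nat_power)
    also have "\<dots> \<le> real n * real (card (words A k)) ^ n"
      using n by (intro mult_right_mono) auto
    finally show "real (npaths n v v \<one>) \<le> 1 * real n * exp (ln (real (card (words A k)))) ^ n"
      using card by simp
  qed simp
  moreover have "gurevic_entropy G (sft A) psi \<ge> ereal (- 1)"
  proof -
    obtain v where v: "v \<in> words A k" using nonempty_V by blast
    obtain d where d: "d > 0" "npaths d v v \<one> > 0" using transitive[OF v v one_closed] by blast
    have "npaths (Suc j * d) v v \<one> > 0" for j
    proof (induction j)
      case 0
      then show ?case using d by simp
    next
      case (Suc j)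
      have "0 < npaths d v v \<one> * npaths (Suc j * d) v v \<one>" using d Suc by simp
      also have "\<dots> \<le> npaths (d + Suc j * d) v v (\<one> \<otimes> \<one>)" by (rule npaths_mult_le[OF v]) auto
      finally show ?case by simp
    qed
    moreover have "npaths n v v \<one> \<le> returns n" if "n > 0" for n
      unfolding returns_eq_sum[OF that] using v finite_V
      by (intro member_le_sum[of v _ "\<lambda>v. npaths n v v \<one>"]) auto
    ultimately have "returns (Suc j * d) > 0" for j
      using d(1) by (metis less_le_trans mult_pos_pos zero_less_Suc)
    then show ?thesis
      unfolding gurevic_eq_growth_rate by (rule growth_rate_ge[OF d(1)])
  qed
  ultimately show ?thesis
    by (cases "gurevic_entropy G (sft A) psi") auto
qed

end

section \<open>The abelianization\<close>

lemma (in group)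
  shows comm_group_abelianization: "comm_group (abelianization G)"
    and ab_proj_hom: "ab_proj G \<in> hom G (abelianization G)"
    and ab_proj_surj: "ab_proj G ` carrier G = carrier (abelianization G)"
proof -
  interpret N: normal "derived G (carrier G)" G by (rule derived_self_is_normal)
  show "comm_group (abelianization G)"
    unfolding abelianization_def by (rule derived_quot_is_comm_group)
  show "ab_proj G \<in> hom G (abelianization G)"
    using N.r_coset_hom_Mod unfolding abelianization_def ab_proj_def[abs_def] .
  show "ab_proj G ` carrier G = carrier (abelianization G)"
    by (auto simp: abelianization_def ab_proj_def FactGroup_def RCOSETS_def)
qed

lemma (in group) ab_proj_mult:
  "a \<in> carrier G \<Longrightarrow> b \<in> carrier G \<Longrightarrow> ab_proj G (a \<otimes> b) = ab_proj G a \<otimes>\<^bsub>abelianization G\<^esub> ab_proj G b"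
  using ab_proj_hom by (simp add: hom_def)

lemma (in group) ab_proj_closed: "a \<in> carrier G \<Longrightarrow> ab_proj G a \<in> carrier (abelianization G)"
  using ab_proj_surj by blast

lemma (in group) ab_proj_one: "ab_proj G \<one> = \<one>\<^bsub>abelianization G\<^esub>"
proof -
  interpret Q: comm_group "abelianization G" by (rule comm_group_abelianization)
  show ?thesis by (rule hom_one[OF ab_proj_hom is_group Q.is_group])
qed

context labelled_graph
begin

lemma character_derived:
  assumes \<kappa>: "character \<kappa>" and "h \<in> derived G (carrier G)"
  shows "h \<in> carrier G \<and> \<kappa> h = 1"
  using assms(2) unfolding derived_def
proof (induction h rule: generate.induct)
  case one
  then show ?case using character_one[OF \<kappa>] by simp
next
  have mult: "\<kappa> (a \<otimes> b) = \<kappa> a * \<kappa> b" if "a \<in> carrier G" "b \<in> carrier G" for a b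
    using \<kappa> that by (simp add: character_def)
  have inv: "\<kappa> a * \<kappa> (inv a) = 1" if "a \<in> carrier G" for a
    using mult[of a "inv a"] that character_one[OF \<kappa>] by simp
  {
    case (incl h)
    then obtain a b where ab: "a \<in> carrier G" "b \<in> carrier G" "h = a \<otimes> b \<otimes> inv a \<otimes> inv b" by auto
    then have "\<kappa> h = (\<kappa> a * \<kappa> (inv a)) * (\<kappa> b * \<kappa> (inv b))" by (simp add: mult)
    with ab show ?case by (simp add: inv)
  next
    case (inv h)
    then obtain a b where ab: "a \<in> carrier G" "b \<in> carrier G" "h = a \<otimes> b \<otimes> inv a \<otimes> inv b" by auto
    then have "\<kappa> h = (\<kappa> a * \<kappa> (inv a)) * (\<kappa> b * \<kappa> (inv b))" by (simp add: mult)
    then have "h \<in> carrier G" "\<kappa> h = 1" using ab \<open>\<And>a. a \<in> carrier G \<Longrightarrow> \<kappa> a * \<kappa> (inv a) = 1\<close> by simp_all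
    then show ?case using \<open>\<And>a. a \<in> carrier G \<Longrightarrow> \<kappa> a * \<kappa> (inv a) = 1\<close>[of h] by simp
  next
    case (eng h1 h2)
    then show ?case by (simp add: mult)
  }
qed

lemma character_ab_proj_eq:
  assumes \<kappa>: "character \<kappa>" and "a \<in> carrier G" "b \<in> carrier G" "ab_proj G a = ab_proj G b"
  shows "\<kappa> a = \<kappa> b"
proof -
  have "a \<in> ab_proj G a"
    unfolding ab_proj_def by (rule rcos_self[OF assms(2) derived_is_subgroup]) simp
  then have "a \<in> ab_proj G b"
    by (simp only: assms(4))
  then obtain h where h: "h \<in> derived G (carrier G)" "a = h \<otimes> b"
    by (auto simp: ab_proj_def r_coset_def)
  with character_derived[OF \<kappa> h(1)] \<kappa> assms(3) show ?thesis
    by (simp add: character_def)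
qed

end

lemma cocycle_ab_proj:
  assumes "group G" "\<And>x. x \<in> sft A \<Longrightarrow> psi x \<in> carrier G" "x \<in> sft A"
  shows "cocycle G psi n x \<in> carrier G \<and>
    cocycle (abelianization G) (ab_proj G \<circ> psi) n x = ab_proj G (cocycle G psi n x)"
proof -
  interpret group G by fact
  show ?thesis
    by (induction n) (simp_all add: ab_proj_one ab_proj_mult assms(2) sft_funpow_shift[OF assms(3)])
qed

lemma skew_transitive_abelianization:
  assumes "group G" "\<And>x. x \<in> sft A \<Longrightarrow> psi x \<in> carrier G" "skew_transitive G (sft A) psi"
  shows "skew_transitive (abelianization G) (sft A) (ab_proj G \<circ> psi)"
proof -
  interpret group G by fact
  show ?thesis
    unfolding skew_transitive_def
  proof (intro ballI allI)
    fix x y g h m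
    assume x: "x \<in> sft A" and y: "y \<in> sft A" and "g \<in> carrier (abelianization G)" "h \<in> carrier (abelianization G)"
    then obtain a b where a: "a \<in> carrier G" "g = ab_proj G a" and b: "b \<in> carrier G" "h = ab_proj G b"
      unfolding ab_proj_surj[symmetric] by blast
    obtain n z where n: "n > 0" "z \<in> sft A" "\<forall>i<m. z i = x i" "\<forall>i<m. (shift ^^ n) z i = y i"
      "a \<otimes>\<^bsub>G\<^esub> cocycle G psi n z = b"
      using assms(3)[unfolded skew_transitive_def, rule_format, OF x y a(1) b(1), of m] by blast
    have "g \<otimes>\<^bsub>abelianization G\<^esub> cocycle (abelianization G) (ab_proj G \<circ> psi) n z = h"
    proof -
      have c: "cocycle G psi n z \<in> carrier G"
        "cocycle (abelianization G) (ab_proj G \<circ> psi) n z = ab_proj G (cocycle G psi n z)"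
        using cocycle_ab_proj[OF assms(1,2) n(2), where n = n] by auto
      show ?thesis
        unfolding a(2) b(2) c(2) n(5)[symmetric] by (rule ab_proj_mult[OF a(1) c(1), symmetric])
    qed
    with n show "\<exists>n>0. \<exists>z\<in>sft A. (\<forall>i<m. z i = x i) \<and> (\<forall>i<m. (shift ^^ n) z i = y i) \<and>
        g \<otimes>\<^bsub>abelianization G\<^esub> cocycle (abelianization G) (ab_proj G \<circ> psi) n z = h"
      by blast
  qed
qed

section \<open>Entropy and amenability\<close>

text \<open>Both extensions live on the same word graph and differ only in their labels, so a vector
  \<open>u\<close> serves for either.\<close>

locale skew_product_pair =
  skew_product G A psi k + Q: skew_product "abelianization G" A "ab_proj G \<circ> psi" k
  for G (structure) and A psi k
begin

lemma word_label_ab_proj: "word_label A k (ab_proj G \<circ> psi) v = ab_proj G (word_label A k psi v)"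
  by (simp add: word_label_def)

lemma supereigen_pullback:
  assumes "Q.supereigen \<kappa> u t"
  shows "supereigen (\<lambda>g. \<kappa> (ab_proj G g)) u t"
  using assms
  by (auto simp: supereigen_def Q.supereigen_def character_def Q.character_def ab_proj_closed ab_proj_mult
      word_label_ab_proj)

text \<open>A character is constant on the fibres of \<open>ab_proj\<close>, so an arbitrary
  representative defines it on the quotient.\<close>

lemma supereigen_descend:
  assumes se: "supereigen \<kappa> u t"
  shows "\<exists>\<kappa>'. Q.supereigen \<kappa>' u t"
proof -
  have \<kappa>: "character \<kappa>" using se by (simp add: supereigen_def)
  define \<kappa>' where "\<kappa>' c = \<kappa> (SOME g. g \<in> carrier G \<and> ab_proj G g = c)" for c
  have \<kappa>': "\<kappa>' (ab_proj G g) = \<kappa> g" if g: "g \<in> carrier G" for g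
  proof -
    have "\<exists>h. h \<in> carrier G \<and> ab_proj G h = ab_proj G g" using g by blast
    from someI_ex[OF this] show ?thesis
      unfolding \<kappa>'_def using character_ab_proj_eq[OF \<kappa> _ g] by blast
  qed
  have "Q.character \<kappa>'"
    unfolding Q.character_def ab_proj_surj[symmetric]
    using \<kappa> by (auto simp: \<kappa>' character_def ab_proj_mult[symmetric])
  then have "Q.supereigen \<kappa>' u t"
    using se by (simp add: Q.supereigen_def supereigen_def \<kappa>' lab_closed word_label_ab_proj)
  then show ?thesis by blast
qed

lemma amenable_imp_gurevic_le:
  assumes "amenable G"
  shows "gurevic_entropy (abelianization G) (sft A) (ab_proj G \<circ> psi) \<le> gurevic_entropy G (sft A) psi"
    (is "?hab \<le> ?h")
proof (rule ccontr)
  assume "\<not> ?hab \<le> ?h"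
  then have "?h < ?hab" by simp
  obtain r where r: "?h < ereal r" "ereal r < ?hab"
    using ereal_dense2[OF \<open>?h < ?hab\<close>] by auto
  \<comment> \<open>Two intermediate values are needed: the path counts grow at most like
    \<open>exp r\<close>, and the supereigenvector exists at the strictly larger
    \<open>exp r'\<close>, still below the entropy to be contradicted.\<close>
  obtain r' where r': "ereal r < ereal r'" "ereal r' < ?hab"
    using ereal_dense2[OF r(2)] by auto
  obtain C where C: "\<forall>n. \<forall>v\<in>words A k. real (npaths n v v \<one>) \<le> C * exp r ^ n"
    using gurevic_lessD[OF r(1)] by blast
  have "exp r < exp r'" using r'(1) by simp
  from amenable_imp_supereigen[OF assms exp_gt_zero this, of C] C
  obtain \<kappa>0 u where "supereigen \<kappa>0 u (exp r')" by auto
  from supereigen_descend[OF this] obtain \<kappa> where se: "Q.supereigen \<kappa> u (exp r')" by (elim exE)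
  have le: "real (Q.npaths n v v \<one>\<^bsub>abelianization G\<^esub>) \<le> exp r' ^ n" if v: "v \<in> words A k" for n v
  proof -
    have "\<kappa> \<one>\<^bsub>abelianization G\<^esub> = 1"
      using se by (intro Q.character_one) (simp add: Q.supereigen_def)
    moreover have "u v > 0" using se v by (simp add: Q.supereigen_def)
    ultimately show ?thesis
      using Q.supereigen_npaths_le[OF se _ v Q.one_closed, of n v] by simp
  qed
  have "?hab \<le> ereal r'"
  proof (rule Q.gurevic_le[of 1])
    fix n :: nat and v assume n: "n > 0" and v: "v \<in> words A k"
    have "1 * exp r' ^ n \<le> real n * exp r' ^ n"
      using n by (intro mult_right_mono) auto
    with le[OF v, of n] show "real (Q.npaths n v v \<one>\<^bsub>abelianization G\<^esub>) \<le> 1 * real n * exp r' ^ n"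
      by linarith
  qed simp
  with r'(2) show False by simp
qed

text \<open>Projection multiplies along a path, so each path counted on the left is also counted on
  the right.\<close>

lemma npaths_le_ab:
  "npaths n v w g \<le> Q.npaths n v w (ab_proj G g)" if "v \<in> words A k" "g \<in> carrier G"
  using that
proof (induction n arbitrary: v g)
  case 0
  show ?case
    unfolding npaths.simps Q.npaths.simps by (simp add: ab_proj_one)
next
  case (Suc n)
  have lv: "word_label A k psi v \<in> carrier G" by (rule lab_closed[OF Suc.prems(1)])
  have "ab_proj G (inv (word_label A k psi v)) = inv\<^bsub>abelianization G\<^esub> (ab_proj G (word_label A k psi v))"
    using lv ab_proj_mult[of "inv (word_label A k psi v)" "word_label A k psi v"]
    by (intro Q.inv_equality[symmetric]) (auto simp: ab_proj_one ab_proj_closed)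
  then have eq: "inv\<^bsub>abelianization G\<^esub> (word_label A k (ab_proj G \<circ> psi) v) \<otimes>\<^bsub>abelianization G\<^esub> ab_proj G g
      = ab_proj G (inv (word_label A k psi v) \<otimes> g)"
    using lv Suc.prems by (simp add: word_label_ab_proj ab_proj_mult)
  show ?case
    unfolding npaths.simps Q.npaths.simps eq
    using Suc.prems lv by (intro sum_mono Suc.IH) (auto simp: succs_V)
qed

lemma gurevic_le_ab:
  "gurevic_entropy G (sft A) psi \<le> gurevic_entropy (abelianization G) (sft A) (ab_proj G \<circ> psi)"
    (is "?h \<le> ?hab")
proof (rule ccontr)
  assume "\<not> ?h \<le> ?hab"
  then have "?hab < ?h" by simp
  obtain r where r: "?hab < ereal r" "ereal r < ?h"
    using ereal_dense2[OF \<open>?hab < ?h\<close>] by auto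
  obtain C where C: "\<forall>n. \<forall>v\<in>words A k. real (Q.npaths n v v \<one>\<^bsub>abelianization G\<^esub>) \<le> C * exp r ^ n"
    using Q.gurevic_lessD[OF r(1)] by blast
  have "?h \<le> ereal r"
  proof (rule gurevic_le[of "max C 1"])
    fix n :: nat and v assume n: "n > 0" and v: "v \<in> words A k"
    have "real (npaths n v v \<one>) \<le> real (Q.npaths n v v \<one>\<^bsub>abelianization G\<^esub>)"
      using npaths_le_ab[OF v one_closed, of n v] by (simp add: ab_proj_one)
    also have "\<dots> \<le> C * exp r ^ n"
      using C v by blast
    also have "\<dots> \<le> (max C 1 * real n) * exp r ^ n"
    proof (intro mult_right_mono)
      have "max C 1 * 1 \<le> max C 1 * real n" using n by (intro mult_left_mono) auto
      then show "C \<le> max C 1 * real n" by linarith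
    qed simp
    finally show "real (npaths n v v \<one>) \<le> max C 1 * real n * exp r ^ n" .
  qed simp
  with r(2) show False by simp
qed

lemma gurevic_eq_imp_amenable:
  assumes eq: "gurevic_entropy G (sft A) psi = gurevic_entropy (abelianization G) (sft A) (ab_proj G \<circ> psi)"
  shows "amenable G"
proof (rule ccontr)
  assume "\<not> amenable G"
  then have nr: "\<not> reiter G" using reiter_imp_amenable by blast
  interpret ab: comm_group "abelianization G" by (rule comm_group_abelianization)
  have am: "amenable (abelianization G)" by (rule Q.reiter_imp_amenable[OF ab.reiter])
  obtain r where r: "gurevic_entropy G (sft A) psi = ereal r"
    using gurevic_finite by blast
  \<comment> \<open>Since \<open>\<delta>\<close> will be at most 1, every \<open>t\<close> used
    below stays under \<open>T\<close>; this lets \<open>\<eta>\<close> be obtained before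
    \<open>\<delta>\<close> is chosen.\<close>
  define T where "T = max 1 (exp (r + 1))"
  have "T \<ge> 1" by (simp add: T_def)
  obtain \<eta> where \<eta>: "0 < \<eta>" "\<eta> < 1" and decay: "\<forall>s t \<kappa> u v m. 0 < s \<longrightarrow> s < t \<longrightarrow> t \<le> T \<longrightarrow>
      supereigen \<kappa> u s \<longrightarrow> v \<in> words A k \<longrightarrow> m > 0 \<longrightarrow> real (npaths m v v \<one>) \<le> 2 * real m * (t * (1 - \<eta>)) ^ m"
    using return_decay[OF nr \<open>T \<ge> 1\<close>] by (elim exE conjE)
  \<comment> \<open>At most half of the gain \<open>- ln (1 - \<eta>)\<close>, so that
    \<open>r + \<delta> + ln (1 - \<eta>)\<close> still lies below \<open>r\<close>.\<close>
  define \<delta> where "\<delta> = min 1 (- ln (1 - \<eta>) / 2)"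
  have ln: "ln (1 - \<eta>) < 0" using \<eta> by (simp add: ln_less_zero)
  then have \<delta>: "\<delta> > 0" "\<delta> \<le> 1" "\<delta> \<le> - ln (1 - \<eta>) / 2" by (auto simp: \<delta>_def)
  \<comment> \<open>The rates \<open>\<delta> / 3\<close>, \<open>\<delta> / 2\<close> and
    \<open>\<delta>\<close> above \<open>r\<close> belong to the path counts, the right vector and
    the left vector; each step needs a strictly larger one.\<close>
  have "gurevic_entropy (abelianization G) (sft A) (ab_proj G \<circ> psi) < ereal (r + \<delta> / 3)"
    unfolding eq[symmetric] r using \<delta>(1) by simp
  from Q.gurevic_lessD[OF this]
  obtain C where C: "\<forall>n. \<forall>v\<in>words A k. real (Q.npaths n v v \<one>\<^bsub>abelianization G\<^esub>) \<le> C * exp (r + \<delta> / 3) ^ n"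
    by (elim exE)
  have "exp (r + \<delta> / 3) < exp (r + \<delta> / 2)" using \<delta>(1) by simp
  from Q.amenable_imp_supereigen[OF am exp_gt_zero this, of C] C
  obtain \<kappa>0 u where "Q.supereigen \<kappa>0 u (exp (r + \<delta> / 2))" by auto
  from supereigen_pullback[OF this]
  obtain \<kappa> where se: "supereigen \<kappa> u (exp (r + \<delta> / 2))" by (rule that)
  have "gurevic_entropy G (sft A) psi \<le> ereal (r + \<delta> + ln (1 - \<eta>))"
  proof (rule gurevic_le[of 2])
    fix n :: nat and v assume n: "n > 0" and v: "v \<in> words A k"
    have "exp (r + \<delta> / 2) < exp (r + \<delta>)" "exp (r + \<delta>) \<le> T"
      using \<delta> by (auto simp: T_def le_max_iff_disj)
    from decay[rule_format, OF exp_gt_zero this se v n]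
    have "real (npaths n v v \<one>) \<le> 2 * real n * (exp (r + \<delta>) * (1 - \<eta>)) ^ n" .
    moreover have "exp (r + \<delta>) * (1 - \<eta>) = exp (r + \<delta> + ln (1 - \<eta>))"
      using \<eta> by (simp add: exp_add)
    ultimately show "real (npaths n v v \<one>) \<le> 2 * real n * exp (r + \<delta> + ln (1 - \<eta>)) ^ n"
      by (simp only:)
  qed simp
  with r \<delta>(3) ln show False by simp
qed

end

theorem theorem1p3:
  fixes A :: "'a::finite \<Rightarrow> 'a \<Rightarrow> bool"
    and G :: "('g, 'b) monoid_scheme"
    and psi :: "(nat \<Rightarrow> 'a) \<Rightarrow> 'g"
  assumes "group G"
    and "countable (carrier G)"
    and "sft A \<noteq> {}"
    and "shift_mixing (sft A)"
    and "locally_constant_cocycle G (sft A) psi"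
    and "skew_transitive G (sft A) psi"
  shows "gurevic_entropy G (sft A) psi =
           gurevic_entropy (abelianization G) (sft A) (ab_proj G \<circ> psi)
         \<longleftrightarrow> amenable G"
proof -
  interpret group G by fact
  interpret ab: comm_group "abelianization G" by (rule comm_group_abelianization)
  have closed: "psi x \<in> carrier G" if "x \<in> sft A" for x
    using assms(5) that by (simp add: locally_constant_cocycle_def)
  obtain k where k: "\<forall>x\<in>sft A. \<forall>y\<in>sft A. (\<forall>i<k. x i = y i) \<longrightarrow> psi x = psi y"
    using assms(5) unfolding locally_constant_cocycle_def by (elim conjE exE)
  \<comment> \<open>Length \<open>Suc k\<close> instead of \<open>k\<close>, because words must be
    nonempty to remember their first symbol.\<close>
  have word: "psi x = psi y" if "x \<in> sft A" "y \<in> sft A" "word (Suc k) x = word (Suc k) y" for x y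
    by (rule k[rule_format, OF that(1,2)]) (use that(3) in \<open>simp add: word_eq_iff\<close>)
  interpret skew_product_pair G A psi "Suc k"
  proof unfold_locales
    show "skew_transitive (abelianization G) (sft A) (ab_proj G \<circ> psi)"
      by (rule skew_transitive_abelianization[OF assms(1) closed assms(6)])
    fix x y assume xy: "x \<in> sft A" "y \<in> sft A" "word (Suc k) x = word (Suc k) y"
    show "psi x = psi y" by (rule word[OF xy])
    then show "(ab_proj G \<circ> psi) x = (ab_proj G \<circ> psi) y" by simp
  qed (simp_all add: assms(3,6) closed ab_proj_closed)
  show ?thesis
  proof
    assume "amenable G"
    then show "gurevic_entropy G (sft A) psi = gurevic_entropy (abelianization G) (sft A) (ab_proj G \<circ> psi)"
      by (intro antisym gurevic_le_ab amenable_imp_gurevic_le)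
  qed (rule gurevic_eq_imp_amenable)
qed

end
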